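(* Let $J\subsetneq\{0,\ldots,r\}$, $c\in C^J$ and $\mathfrak{t}\in T_J$. The formulas $$\pi_{c,\mathfrak{t}}(T_j)x^y:=k_j^{\chi_{\mathbb{Z}}(\alpha_j(y))}\,s_{j,\mathfrak{t}}x^y+(k_j-k_j^{-1})\nabla_j(x^y),\qquad \pi_{c,\mathfrak{t}}(x^\mu)x^y:=x^{y+\mu}$$ for $0\leq j\leq r$, $\mu\in Q^\vee$ and $y\in\mathcal{O}_c$ define a representation $\pi_{c,\mathfrak{t}}:\mathbb{H}\rightarrow\mathrm{End}(\mathcal{P}^{(c)})$ of the double affine Hecke algebra $\mathbb{H}$.
   Context: Root data. Let $E$ be a Euclidean space with scalar product $\langle\cdot,\cdot\rangle$; its dual $E^*$ carries the transported scalar product and norm. $\Phi_0\subset E^*$ is a reduced irreducible root system (in its real span), normalised so that long roots have squared norm $2/m^2$ for some $m\in\mathbb{Z}_{>0}$ (if all roots have equal length they are called long). For $\alpha\in\Phi_0$, $\alpha^\vee\in E$ is determined by $\langle y,\alpha^\vee\rangle=2\alpha(y)/\|\alpha\|^2$ ($y\in E$), and $s_\alpha(y)=y-\alpha(y)\alpha^\vee$. $W_0$ is the Weyl group generated by the $s_\alpha$, $Q^\vee$ is the lattice spanned by the $\alpha^\vee$, $\alpha_1,\ldots,\alpha_r$ are fixed simple roots, $\Phi_0^\pm$ the positive/negative roots, $\varphi$ the highest root, $s_i=s_{\alpha_i}$. The affine Weyl group $W=W_0\ltimes Q^\vee$ acts on $E$, with $\tau(\mu)y=y+\mu$ for $\mu\in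 Q^\vee$. $\Phi=\Phi_0\times\mathbb{Z}$, where $a=(\alpha,\ell)$ is the affine function $a(y)=\alpha(y)+\ell$ on $E$ with gradient $Da=\alpha$. Put $\alpha_0=(-\varphi,1)$, $s_0=\tau(\varphi^\vee)s_\varphi$; $(W,\{s_0,\ldots,s_r\})$ is a Coxeter system. $\overline{C}_+=\{y\in E:\ 0\le\alpha(y)\le 1\ \forall\alpha\in\Phi_0^+\}$, and for $J\subsetneq\{0,\ldots,r\}$, $C^J=\{c\in\overline{C}_+:\ \alpha_j(c)=0\Leftrightarrow j\in J\}$. $\mathcal{O}_c=Wc$, and for $y\in\mathcal{O}_c$, $w_y\in W$ is the element of shortest length with $w_yc=y$. Parameters. $\mathbf{F}$ is a field of characteristic zero, $q\in\mathbf{F}^\times$ is not a root of unity, $q_\alpha=q^{2/\|\alpha\|^2}$. $T=\mathrm{Hom}(Q^\vee,\mathbf{F}^\times)$, $\mathfrak{t}^\mu$ is the value of $\mathfrak{t}\in T$ at $\mu$, and $\mathfrak{t}^{\alpha_0^\vee}:=q_\varphi\mathfrak{t}^{-\varphi^\vee}$. $W$ acts on $T$ by $(v\mathfrak{t})^\mu=\mathfrak{t}^{v^{-1}\mu}$ ($v\in W_0$), $(\tau(\nu)\mathfrak{t})^\mu=q^{\langle\nu,\mu\rangle}\mathfrak{t}^\mu$. $T_J=\{\mathfrak{t}\in T:\ \mathfrak{t}^{\alpha_j^\vee}=1\ \forall j\in J\}$, and for $\mathfrak{t}\in T_J$, $y\in\mathcal{O}_c$ put $\mathfrak{t}_y=w_y\mathfrak{t}$.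 The $k_\alpha\in\mathbf{F}^\times$ ($\alpha\in\Phi_0$) depend only on $\|\alpha\|$; $k_i=k_{\alpha_i}$ for $i\geq 1$ and $k_0=k_\varphi$. Double affine Hecke algebra. $W$ acts on $\mathcal{P}=\bigoplus_{\mu\in Q^\vee}\mathbf{F}x^\mu$ (group algebra) by $v(x^\mu)=x^{v\mu}$, $\tau(\nu)(x^\mu)=q^{-\langle\nu,\mu\rangle}x^\mu$; $x^{\alpha_0^\vee}:=q_\varphi x^{-\varphi^\vee}$. $\mathbb{H}$ is the unital associative $\mathbf{F}$-algebra generated by $T_0,\ldots,T_r$ and $x^\mu$ ($\mu\in Q^\vee$) subject to the braid relations of $(W,\{s_0,\ldots,s_r\})$ for the $T_j$, the relations $(T_j-k_j)(T_j+k_j^{-1})=0$, $x^\lambda x^\mu=x^{\lambda+\mu}$, $x^0=1$, and $$T_jx^\mu-s_j(x^\mu)T_j=(k_j-k_j^{-1})\frac{x^\mu-s_j(x^\mu)}{1-x^{\alpha_j^\vee}}\qquad(0\le j\le r).$$ Quasi-polynomials. $\mathbf{F}[E]=\bigoplus_{y\in E}\mathbf{F}x^y$ is the group algebra of $E$, $\mathcal{P}^{(c)}=\bigoplus_{y\in\mathcal{O}_c}\mathbf{F}x^y$. $\chi_{\mathbb{Z}}:\mathbb{R}\to\{0,1\}$ is the characteristic function of $\mathbb{Z}$, $\lfloor\cdot\rfloor$ the floor function, $\nabla_j(x^y)=\dfrac{1-x^{-\lfloor D\alpha_j(y)\rfloor\alpha_j^\vee}}{1-x^{\alpha_j^\vee}}\,x^y$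 (where $x^{n\alpha_0^\vee}=(x^{\alpha_0^\vee})^n$), $s_{i,\mathfrak{t}}x^y=x^{s_iy}$ for $1\le i\le r$ and $s_{0,\mathfrak{t}}x^y=\mathfrak{t}_y^{\varphi^\vee}x^{s_\varphi y}$. *)

theory Defs
  imports "HOL-Analysis.Analysis" "HOL-Algebra.QuotRing" "HOL-Algebra.Module"
    "HOL-Library.Poly_Mapping"
begin

section \<open>Associative algebras given by generators and relations\<close>

text \<open>
  An algebra over the type-class field \<open>'f\<close> is encoded by a \<^type>\<open>module_ext\<close> record: it
  carries a (not necessarily commutative) ring structure together with a scalar multiplication.
\<close>

definition alg_hom ::
  "('f, 'a, 'm) module_scheme \<Rightarrow> ('f, 'b, 'n) module_scheme \<Rightarrow> ('a \<Rightarrow> 'b) set" where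
  "alg_hom A B = {h \<in> ring_hom A B. \<forall>a. \<forall>x \<in> carrier A. h (a \<odot>\<^bsub>A\<^esub> x) = a \<odot>\<^bsub>B\<^esub> h x}"

text \<open>
  The free monoid on \<open>'g\<close>, written additively, so that \<open>'g free_mon \<Rightarrow>\<^sub>0 'f\<close> with its
  convolution product is the free associative algebra on \<open>'g\<close>.
\<close>

datatype 'g free_mon = Word (letters: "'g list")

instantiation free_mon :: (type) monoid_add
begin

definition "0 = Word []"
definition "u + v = Word (letters u @ letters v)"

instance
  by standard (simp_all add: zero_free_mon_def plus_free_mon_def)

end

definition scal :: "'f::comm_ring_1 \<Rightarrow> 'm::monoid_add \<Rightarrow>\<^sub>0 'f" where
  "scal a = Poly_Mapping.single 0 a"

definition free_alg :: "'g set \<Rightarrow> ('f::comm_ring_1, 'g free_mon \<Rightarrow>\<^sub>0 'f) module" where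
  "free_alg G =
    \<lparr>carrier = {p. \<forall>w \<in> Poly_Mapping.keys p. set (letters w) \<subseteq> G},
     mult = (*), one = 1, zero = 0, add = (+), smult = (\<lambda>a p. scal a * p)\<rparr>"

text \<open>
  The quotient of an algebra by a two-sided ideal; the scalar multiplication is the induced one,
  in the style of \<^const>\<open>rcoset_mult\<close>.
\<close>

definition quot_alg :: "('f, 'a) module \<Rightarrow> 'a set \<Rightarrow> ('f, 'a set) module" where
  "quot_alg A I =
    \<lparr>carrier = carrier (A Quot I), mult = mult (A Quot I), one = one (A Quot I),
     zero = zero (A Quot I), add = add (A Quot I),
     smult = (\<lambda>a X. \<Union>x \<in> X. I +>\<^bsub>A\<^esub> (a \<odot>\<^bsub>A\<^esub> x))\<rparr>"

text \<open>
  The algebra of linear endomorphisms of a linear subspace \<open>V\<close> of a monoid algebra.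
  Endomorphisms are extensional, i.e. equal to \<^const>\<open>undefined\<close> outside \<open>V\<close>.
\<close>

definition End_alg ::
  "('m::monoid_add \<Rightarrow>\<^sub>0 'f) set \<Rightarrow>
   ('f::comm_ring_1, ('m \<Rightarrow>\<^sub>0 'f) \<Rightarrow> ('m \<Rightarrow>\<^sub>0 'f)) module" where
  "End_alg V =
    \<lparr>carrier = {f \<in> V \<rightarrow>\<^sub>E V. (\<forall>u \<in> V. \<forall>v \<in> V. f (u + v) = f u + f v) \<and>
                            (\<forall>a. \<forall>v \<in> V. f (scal a * v) = scal a * f v)},
     mult = (\<lambda>f g. \<lambda>v \<in> V. f (g v)), one = (\<lambda>v \<in> V. v),
     zero = (\<lambda>v \<in> V. 0), add = (\<lambda>f g. \<lambda>v \<in> V. f v + g v),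
     smult = (\<lambda>a f. \<lambda>v \<in> V. scal a * f v)\<rparr>"

section \<open>Root systems\<close>

text \<open>
  The Euclidean space \<open>E\<close> is the type \<open>'a\<close>. Its dual, with the transported scalar product, is
  identified with \<open>'a\<close>: a vector \<open>\<beta>\<close> stands for the functional \<open>\<lambda>y. \<beta> \<bullet> y\<close>.
\<close>

definition coroot :: "'a::euclidean_space \<Rightarrow> 'a" where
  "coroot \<beta> = (2 / (norm \<beta>)\<^sup>2) *\<^sub>R \<beta>"

definition refl :: "'a::euclidean_space \<Rightarrow> 'a \<Rightarrow> 'a" where
  "refl \<beta> y = y - (\<beta> \<bullet> y) *\<^sub>R coroot \<beta>"

text \<open>A root system in its real span; the span need not be the whole space.\<close>

definition root_system :: "'a::euclidean_space set \<Rightarrow> bool" where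
  "root_system \<Phi> \<longleftrightarrow> finite \<Phi> \<and> 0 \<notin> \<Phi> \<and>
     (\<forall>\<beta> \<in> \<Phi>. refl \<beta> ` \<Phi> = \<Phi>) \<and> (\<forall>\<beta> \<in> \<Phi>. \<forall>\<gamma> \<in> \<Phi>. \<gamma> \<bullet> coroot \<beta> \<in> \<int>)"

definition reduced :: "'a::euclidean_space set \<Rightarrow> bool" where
  "reduced \<Phi> \<longleftrightarrow> (\<forall>\<beta> \<in> \<Phi>. \<forall>x. x *\<^sub>R \<beta> \<in> \<Phi> \<longrightarrow> x = 1 \<or> x = -1)"

definition irreducible_rs :: "'a::euclidean_space set \<Rightarrow> bool" where
  "irreducible_rs \<Phi> \<longleftrightarrow> \<Phi> \<noteq> {} \<and>
     \<not> (\<exists>A B. A \<noteq> {} \<and> B \<noteq> {} \<and> A \<union> B = \<Phi> \<and> A \<inter> B = {} \<and> (\<forall>\<beta> \<in> A. \<forall>\<gamma> \<in> B. \<beta> \<bullet> \<gamma> = 0))"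

definition long_root :: "'a::euclidean_space set \<Rightarrow> 'a \<Rightarrow> bool" where
  "long_root \<Phi> \<beta> \<longleftrightarrow> \<beta> \<in> \<Phi> \<and> (\<forall>\<gamma> \<in> \<Phi>. norm \<gamma> \<le> norm \<beta>)"

definition nonneg_comb :: "nat \<Rightarrow> (nat \<Rightarrow> 'a::euclidean_space) \<Rightarrow> 'a \<Rightarrow> bool" where
  "nonneg_comb r \<alpha> v \<longleftrightarrow> (\<exists>n :: nat \<Rightarrow> nat. v = (\<Sum>i = 1..r. real (n i) *\<^sub>R \<alpha> i))"

text \<open>\<open>\<alpha> 1, \<dots>, \<alpha> r\<close> are simple roots; other values of \<open>\<alpha>\<close> are irrelevant.\<close>

definition simple_roots :: "'a::euclidean_space set \<Rightarrow> nat \<Rightarrow> (nat \<Rightarrow> 'a) \<Rightarrow> bool" where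
  "simple_roots \<Phi> r \<alpha> \<longleftrightarrow> \<alpha> ` {1..r} \<subseteq> \<Phi> \<and> inj_on \<alpha> {1..r} \<and> independent (\<alpha> ` {1..r}) \<and>
     (\<forall>\<beta> \<in> \<Phi>. nonneg_comb r \<alpha> \<beta> \<or> nonneg_comb r \<alpha> (- \<beta>))"

text \<open>Reflections are involutions, so the monoid they generate is a group.\<close>

inductive_set weyl_group :: "'a::euclidean_space set \<Rightarrow> ('a \<Rightarrow> 'a) set" for \<Phi> where
  weyl_id: "id \<in> weyl_group \<Phi>"
| weyl_refl: "\<beta> \<in> \<Phi> \<Longrightarrow> v \<in> weyl_group \<Phi> \<Longrightarrow> refl \<beta> \<circ> v \<in> weyl_group \<Phi>"

definition coroot_lattice :: "'a::euclidean_space set \<Rightarrow> 'a set" where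
  "coroot_lattice \<Phi> = {\<Sum>\<beta> \<in> \<Phi>. real_of_int (n \<beta>) *\<^sub>R coroot \<beta> | n. True}"

text \<open>
  The affine Weyl group, as a group of affine transformations. Such a \<open>w\<close> decomposes uniquely as
  \<open>\<tau>(\<nu>) v\<close> with \<open>\<nu> = w 0\<close> and \<open>v = lin_part w\<close>.
\<close>

definition affine_weyl :: "'a::euclidean_space set \<Rightarrow> ('a \<Rightarrow> 'a) set" where
  "affine_weyl \<Phi> = {\<lambda>y. v y + \<mu> | v \<mu>. v \<in> weyl_group \<Phi> \<and> \<mu> \<in> coroot_lattice \<Phi>}"

definition lin_part :: "('a::euclidean_space \<Rightarrow> 'a) \<Rightarrow> 'a \<Rightarrow> 'a" where
  "lin_part w y = w y - w 0"

definition orbit :: "'a::euclidean_space set \<Rightarrow> 'a \<Rightarrow> 'a set" where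
  "orbit \<Phi> c = (\<lambda>w. w c) ` affine_weyl \<Phi>"

text \<open>Integral powers with exponent given as a real number (which is an integer in all uses).\<close>

definition ipow :: "'f::field \<Rightarrow> real \<Rightarrow> 'f" where
  "ipow a x = a powi \<lfloor>x\<rfloor>"

text \<open>
  The fractions \<open>f / (1 - x\<^bsup>\<alpha>\<^sub>j\<^sup>\<or>\<^esup>)\<close> of the theory are exact quotients in the group algebra: in all uses
  \<open>h\<close> exists and is unique.
\<close>

definition exact_div :: "('m::comm_monoid_add \<Rightarrow>\<^sub>0 'f::comm_ring_1) \<Rightarrow> ('m \<Rightarrow>\<^sub>0 'f) \<Rightarrow> ('m \<Rightarrow>\<^sub>0 'f)" where
  "exact_div f g = (THE h. h * g = f)"

definition mono_x :: "'a::euclidean_space \<Rightarrow> ('a \<Rightarrow>\<^sub>0 'f::field)" where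
  "mono_x y = Poly_Mapping.single y 1"

text \<open>The type \<open>'a \<Rightarrow>\<^sub>0 'f\<close> is \<open>F[E]\<close>; \<open>poly_space \<Phi> c\<close> is the subspace \<open>P\<^sup>(\<^sup>c\<^sup>)\<close>.\<close>

definition poly_space :: "'a::euclidean_space set \<Rightarrow> 'a \<Rightarrow> ('a \<Rightarrow>\<^sub>0 'f::field) set" where
  "poly_space \<Phi> c = {p. Poly_Mapping.keys p \<subseteq> orbit \<Phi> c}"

locale root_datum =
  fixes \<Phi> :: "'a::euclidean_space set"
    and r :: nat
    and \<alpha> :: "nat \<Rightarrow> 'a"
  assumes root_system: "root_system \<Phi>"
    and reduced: "reduced \<Phi>"
    and irreducible: "irreducible_rs \<Phi>"
    and simple_roots: "simple_roots \<Phi> r \<alpha>"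
    and normalised: "\<exists>m :: nat. m > 0 \<and> (\<forall>\<beta>. long_root \<Phi> \<beta> \<longrightarrow> (norm \<beta>)\<^sup>2 = 2 / (real m)\<^sup>2)"
begin

definition pos_roots :: "'a set" where
  "pos_roots = {\<beta> \<in> \<Phi>. nonneg_comb r \<alpha> \<beta>}"

definition highest_root :: 'a where
  "highest_root = (THE \<phi>. \<phi> \<in> \<Phi> \<and> (\<forall>\<beta> \<in> \<Phi>. nonneg_comb r \<alpha> (\<phi> - \<beta>)))"

text \<open>Gradients \<open>D\<alpha>\<^sub>j\<close> of the simple affine roots, and the affine functions themselves.\<close>

definition grad :: "nat \<Rightarrow> 'a" where
  "grad j = (if j = 0 then - highest_root else \<alpha> j)"

definition aff_root :: "nat \<Rightarrow> 'a \<Rightarrow> real" where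
  "aff_root j y = grad j \<bullet> y + (if j = 0 then 1 else 0)"

definition simple_refl :: "nat \<Rightarrow> 'a \<Rightarrow> 'a" where
  "simple_refl j =
    (if j = 0 then (\<lambda>y. refl highest_root y + coroot highest_root) else refl (\<alpha> j))"

definition alcove :: "'a set" where
  "alcove = {y. \<forall>\<beta> \<in> pos_roots. 0 \<le> \<beta> \<bullet> y \<and> \<beta> \<bullet> y \<le> 1}"

definition face :: "nat set \<Rightarrow> 'a set" where
  "face J = {c \<in> alcove. \<forall>j \<in> {0..r}. aff_root j c = 0 \<longleftrightarrow> j \<in> J}"

definition word_prod :: "nat list \<Rightarrow> 'a \<Rightarrow> 'a" where
  "word_prod js = foldr (\<lambda>j w. simple_refl j \<circ> w) js id"

definition cox_length :: "('a \<Rightarrow> 'a) \<Rightarrow> nat" where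
  "cox_length w = (LEAST n. \<exists>js. length js = n \<and> set js \<subseteq> {0..r} \<and> word_prod js = w)"

text \<open>The element \<open>w\<^sub>y\<close> for \<open>y\<close> in the orbit of \<open>c\<close>.\<close>

definition min_elt :: "'a \<Rightarrow> 'a \<Rightarrow> 'a \<Rightarrow> 'a" where
  "min_elt c y = (ARG_MIN cox_length w. w \<in> affine_weyl \<Phi> \<and> w c = y)"

text \<open>\<open>m\<close> is the (finite) order of \<open>s\<^sub>i s\<^sub>j\<close>.\<close>

definition cox_order :: "nat \<Rightarrow> nat \<Rightarrow> nat \<Rightarrow> bool" where
  "cox_order i j m \<longleftrightarrow> m > 0 \<and> (simple_refl i \<circ> simple_refl j) ^^ m = id \<and>
     (\<forall>n. 0 < n \<and> n < m \<longrightarrow> (simple_refl i \<circ> simple_refl j) ^^ n \<noteq> id)"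

end

section \<open>The double affine Hecke algebra\<close>

datatype 'a daha_gen = T_gen nat | X_gen 'a

definition gen :: "'a daha_gen \<Rightarrow> ('a daha_gen free_mon \<Rightarrow>\<^sub>0 'f::field)" where
  "gen g = Poly_Mapping.single (Word [g]) 1"

text \<open>The linear map \<open>x\<^sup>\<mu> \<mapsto> X_gen \<mu>\<close> from the group algebra into the free algebra.\<close>

definition poly_word :: "('a \<Rightarrow>\<^sub>0 'f::field) \<Rightarrow> ('a daha_gen free_mon \<Rightarrow>\<^sub>0 'f)" where
  "poly_word p = (\<Sum>\<mu> \<in> Poly_Mapping.keys p. scal (Poly_Mapping.lookup p \<mu>) * gen (X_gen \<mu>))"

text \<open>The alternating word \<open>T\<^sub>i T\<^sub>j T\<^sub>i \<dots>\<close> with \<open>m\<close> factors.\<close>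

fun alt_T :: "nat \<Rightarrow> nat \<Rightarrow> nat \<Rightarrow> ('a daha_gen free_mon \<Rightarrow>\<^sub>0 'f::field)" where
  "alt_T i j 0 = 1"
| "alt_T i j (Suc m) = gen (T_gen i) * alt_T j i m"

locale daha_datum = root_datum \<Phi> r \<alpha>
  for \<Phi> :: "'a::euclidean_space set" and r :: nat and \<alpha> :: "nat \<Rightarrow> 'a" +
  fixes q :: "'f::field_char_0"
    and k :: "'a \<Rightarrow> 'f"
  assumes q_nonzero: "q \<noteq> 0"
    and q_not_root_of_unity: "\<forall>n :: nat. n > 0 \<longrightarrow> q ^ n \<noteq> 1"
    and k_nonzero: "\<forall>\<beta> \<in> \<Phi>. k \<beta> \<noteq> 0"
    and k_norm: "\<forall>\<beta> \<in> \<Phi>. \<forall>\<gamma> \<in> \<Phi>. norm \<beta> = norm \<gamma> \<longrightarrow> k \<beta> = k \<gamma>"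
begin

definition q_root :: "'a \<Rightarrow> 'f" where
  "q_root \<beta> = ipow q (2 / (norm \<beta>)\<^sup>2)"

definition k_simple :: "nat \<Rightarrow> 'f" where
  "k_simple j = (if j = 0 then k highest_root else k (\<alpha> j))"

text \<open>The action \<open>(\<tau>(\<nu>) v)(x\<^sup>\<mu>) = q\<^bsup>-\<langle>\<nu>, v \<mu>\<rangle>\<^esup> x\<^bsup>v \<mu>\<^esup>\<close> on monomials.\<close>

definition act_mono :: "('a \<Rightarrow> 'a) \<Rightarrow> 'a \<Rightarrow> ('a \<Rightarrow>\<^sub>0 'f)" where
  "act_mono w \<mu> = scal (ipow q (- (w 0 \<bullet> lin_part w \<mu>))) * mono_x (lin_part w \<mu>)"

text \<open>\<open>x\<^bsup>n \<alpha>\<^sub>j\<^sup>\<or>\<^esup>\<close>; for \<open>j = 0\<close> this is the \<open>n\<close>-th power of \<open>q\<^sub>\<phi> x\<^bsup>-\<phi>\<^sup>\<or>\<^esup>\<close>.\<close>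

definition x_coroot :: "nat \<Rightarrow> int \<Rightarrow> ('a \<Rightarrow>\<^sub>0 'f)" where
  "x_coroot j n =
    (if j = 0 then scal (q_root highest_root powi n) * mono_x (- of_int n *\<^sub>R coroot highest_root)
     else mono_x (of_int n *\<^sub>R coroot (\<alpha> j)))"

definition daha_gens :: "'a daha_gen set" where
  "daha_gens = T_gen ` {0..r} \<union> X_gen ` coroot_lattice \<Phi>"

definition daha_free :: "('f, 'a daha_gen free_mon \<Rightarrow>\<^sub>0 'f) module" where
  "daha_free = free_alg daha_gens"

text \<open>For each defining relation \<open>lhs = rhs\<close> this contains \<open>lhs - rhs\<close>.\<close>

definition daha_relators :: "('a daha_gen free_mon \<Rightarrow>\<^sub>0 'f) set" where
  "daha_relators =
     {alt_T i j m - alt_T j i m | i j m. i \<in> {0..r} \<and> j \<in> {0..r} \<and> i \<noteq> j \<and> cox_order i j m} \<union>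
     {(gen (T_gen j) - scal (k_simple j)) * (gen (T_gen j) + scal (inverse (k_simple j)))
       | j. j \<in> {0..r}} \<union>
     {gen (X_gen \<mu>) * gen (X_gen \<nu>) - gen (X_gen (\<mu> + \<nu>))
       | \<mu> \<nu>. \<mu> \<in> coroot_lattice \<Phi> \<and> \<nu> \<in> coroot_lattice \<Phi>} \<union>
     {gen (X_gen 0) - 1} \<union>
     {gen (T_gen j) * gen (X_gen \<mu>) - poly_word (act_mono (simple_refl j) \<mu>) * gen (T_gen j)
        - scal (k_simple j - inverse (k_simple j)) *
          poly_word (exact_div (mono_x \<mu> - act_mono (simple_refl j) \<mu>) (1 - x_coroot j 1))
       | j \<mu>. j \<in> {0..r} \<and> \<mu> \<in> coroot_lattice \<Phi>}"

definition daha_ideal :: "('a daha_gen free_mon \<Rightarrow>\<^sub>0 'f) set" where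
  "daha_ideal = genideal daha_free daha_relators"

definition daha :: "('f, ('a daha_gen free_mon \<Rightarrow>\<^sub>0 'f) set) module" where
  "daha = quot_alg daha_free daha_ideal"

text \<open>The images of the generators \<open>T\<^sub>j\<close> and \<open>x\<^sup>\<mu>\<close> in the double affine Hecke algebra.\<close>

definition daha_T :: "nat \<Rightarrow> ('a daha_gen free_mon \<Rightarrow>\<^sub>0 'f) set" where
  "daha_T j = daha_ideal +>\<^bsub>daha_free\<^esub> gen (T_gen j)"

definition daha_X :: "'a \<Rightarrow> ('a daha_gen free_mon \<Rightarrow>\<^sub>0 'f) set" where
  "daha_X \<mu> = daha_ideal +>\<^bsub>daha_free\<^esub> gen (X_gen \<mu>)"

section \<open>Quasi-polynomials\<close>

text \<open>
  Elements of \<open>T = Hom(Q\<^sup>\<or>, F\<^sup>\<times>)\<close> are functions on \<open>'a\<close> of which only the values on the coroot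
  lattice matter.
\<close>

definition torus :: "('a \<Rightarrow> 'f) set" where
  "torus = {t. (\<forall>\<mu> \<in> coroot_lattice \<Phi>. t \<mu> \<noteq> 0) \<and>
     (\<forall>\<mu> \<in> coroot_lattice \<Phi>. \<forall>\<nu> \<in> coroot_lattice \<Phi>. t (\<mu> + \<nu>) = t \<mu> * t \<nu>)}"

definition torus_coroot :: "('a \<Rightarrow> 'f) \<Rightarrow> nat \<Rightarrow> 'f" where
  "torus_coroot t j =
    (if j = 0 then q_root highest_root * t (- coroot highest_root) else t (coroot (\<alpha> j)))"

definition torus_face :: "nat set \<Rightarrow> ('a \<Rightarrow> 'f) set" where
  "torus_face J = {t \<in> torus. \<forall>j \<in> J. torus_coroot t j = 1}"

text \<open>The action \<open>(\<tau>(\<nu>) v t)\<^sup>\<mu> = q\<^bsup>\<langle>\<nu>, \<mu>\<rangle>\<^esup> t\<^bsup>v\<^sup>-\<^sup>1 \<mu>\<^esup>\<close>.\<close>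

definition act_torus :: "('a \<Rightarrow> 'a) \<Rightarrow> ('a \<Rightarrow> 'f) \<Rightarrow> 'a \<Rightarrow> 'f" where
  "act_torus w t \<mu> = ipow q (w 0 \<bullet> \<mu>) * t (inv_into UNIV (lin_part w) \<mu>)"

definition torus_at :: "'a \<Rightarrow> ('a \<Rightarrow> 'f) \<Rightarrow> 'a \<Rightarrow> 'a \<Rightarrow> 'f" where
  "torus_at c t y = act_torus (min_elt c y) t"

text \<open>\<open>s\<^bsub>j,t\<^esub> x\<^sup>y\<close> and \<open>\<nabla>\<^sub>j(x\<^sup>y)\<close>, for \<open>y\<close> in the orbit of \<open>c\<close>.\<close>

definition s_op :: "'a \<Rightarrow> ('a \<Rightarrow> 'f) \<Rightarrow> nat \<Rightarrow> 'a \<Rightarrow> ('a \<Rightarrow>\<^sub>0 'f)" where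
  "s_op c t j y =
    (if j = 0 then scal (torus_at c t y (coroot highest_root)) * mono_x (refl highest_root y)
     else mono_x (refl (\<alpha> j) y))"

definition nabla :: "nat \<Rightarrow> 'a \<Rightarrow> ('a \<Rightarrow>\<^sub>0 'f)" where
  "nabla j y =
    exact_div (1 - x_coroot j (- \<lfloor>grad j \<bullet> y\<rfloor>)) (1 - x_coroot j 1) * mono_x y"

end

end

theory Submission
  imports Defs
begin

text \<open>
  Let \<open>V\<close> be the span of the monomials \<open>x\<^sup>y\<close> with \<open>y\<close> in the orbit of \<open>c\<close>. The free algebra on the
  generators of the double affine Hecke algebra acts on \<open>V\<close> by the given formulas. The content of the
  theorem is that the defining relations act by zero; the map on the quotient is then induced
  (\<open>rep_alg_hom\<close>) and it is unique because the generators generate (\<open>rep_unique\<close>).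

  \<^emph>\<open>The twist.\<close> The character \<open>t\<^sub>y\<close> has to satisfy \<open>t\<^sub>w\<^sub>y = w t\<^sub>y\<close> for all \<open>w\<close> in the affine Weyl
  group, and \<open>t\<^sub>y\<close> has to take the value \<open>q\<^sub>\<phi>\<^sup>n\<close> at \<open>\<phi>\<^sup>\<or>\<close> whenever \<open>\<phi>(y) = n\<close> is an integer. The
  first fact holds because the stabiliser of \<open>c\<close> is generated by the simple reflections that it
  contains (\<open>affine_stabilizer\<close>, by the exchange argument), and these fix \<open>t\<close>. The second one is
  transported to \<open>c\<close>, where it is an induction over the positive affine roots
  (\<open>torus_at_highest_root\<close>). Consequently the affine Weyl group acts on \<open>V\<close> by twisted permutations
  of the monomials, with \<open>s\<^sub>j\<close> acting by \<open>s\<^bsub>j,t\<^esub>\<close>.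

  \<^emph>\<open>Cross and quadratic relations.\<close> The cross relation is immediate from the additivity of the floor
  function under integral shifts (\<open>T_cross\<close>). It implies that
  \<open>T\<^sub>j\<^sup>2 - (k\<^sub>j - k\<^sub>j\<^sup>-\<^sup>1) T\<^sub>j - 1\<close> commutes with \<open>x\<^bsup>\<alpha>\<^sub>j\<^sup>\<or>\<^esup>\<close>, so that the quadratic relation
  has to be checked on \<open>x\<^sup>y\<close> for \<open>-1 \<le> D\<alpha>\<^sub>j(y) < 1\<close> only, where the fraction \<open>\<nabla>\<^sub>j(x\<^sup>y)\<close> is \<open>0\<close> or
  \<open>x\<^sup>y\<close> (\<open>T_quadratic\<close>).

  \<^emph>\<open>Braid relations.\<close> Fix two simple affine roots whose reflections have a product of finite order
  \<open>m\<close>; their gradients span a root system of rank two, and \<open>m \<in> {2, 3, 4, 6}\<close>. Let \<open>K \<subseteq> V\<close> be the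
  subspace on which the braid relation holds. The quadratic relations alone show that \<open>K\<close> is
  stable under both operators and their inverses. The cross relations show that \<open>K\<close> is
  stable under multiplication by the lattice of the two coroots: for even \<open>m\<close>
  the braid relation says that one operator \<open>D\<close> commutes with the palindrome \<open>C\<close> of length \<open>m - 1\<close> in
  the two operators. For a suitable lattice monomial \<open>X\<close> commuting with \<open>D\<close> one computes
  \<open>C X = X\<^sup>-\<^sup>1 C\<^sup>-\<^sup>1 - z\<close> with a scalar \<open>z\<close>, and commuting with \<open>C\<^sup>-\<^sup>1\<close> is the same as commuting with
  \<open>C\<close>; the case \<open>m = 3\<close> is similar (\<open>braid_ker_shift_2\<close> to \<open>braid_ker_shift_6\<close>). Hence it suffices to
  treat one exponent in each coset of that lattice. A representative \<open>z\<close> of minimal norm satisfies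
  \<open>\<bar>\<beta>(z)\<bar> \<le> 1\<close> for all roots \<open>\<beta>\<close> of the rank two system (\<open>minimal_bounds\<close>), and it can be taken to be
  dominant by the stability under the operators (\<open>ker_descent\<close>). At such a \<open>z\<close> each operator
  multiplies a twisted permutation by a factor depending on \<open>\<beta>(z)\<close>, where \<open>\<beta>\<close> runs through the
  positive roots in one of two opposite orders on the two sides of the braid relation; the products of the factors agree,
  and the permutations satisfy the braid relation because they represent the affine Weyl group
  (\<open>ker_dominant\<close>).
\<close>

text \<open>The index set of the simple roots is kept in the form \<open>{1..r}\<close> rather than \<open>{Suc 0..r}\<close>.\<close>

declare One_nat_def [simp del]

section \<open>Reflections\<close>

lemma refl_eq: "refl \<beta> y = y - (2 * (\<beta> \<bullet> y) / (norm \<beta>)\<^sup>2) *\<^sub>R \<beta>"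
  by (simp add: refl_def coroot_def)

lemma inner_coroot: "x \<bullet> coroot \<beta> = 2 * (x \<bullet> \<beta>) / (norm \<beta>)\<^sup>2"
  by (simp add: coroot_def)

lemma coroot_inner: "coroot \<beta> \<bullet> x = 2 * (\<beta> \<bullet> x) / (norm \<beta>)\<^sup>2"
  by (simp add: coroot_def)

lemma coroot_minus [simp]: "coroot (- \<beta>) = - coroot \<beta>"
  by (simp add: coroot_def)

lemma refl_minus_root [simp]: "refl (- \<beta>) = refl \<beta>"
  by (rule ext) (simp add: refl_def)

lemma self_inner_coroot: "\<beta> \<noteq> 0 \<Longrightarrow> \<beta> \<bullet> coroot \<beta> = 2"
  by (simp add: inner_coroot dot_square_norm)

lemma linear_refl: "linear (refl \<beta>)"
  by (rule linearI) (simp_all add: refl_def algebra_simps)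

lemmas refl_add = linear_add[OF linear_refl]
  and refl_diff = linear_diff[OF linear_refl]
  and refl_scale = linear_scale[OF linear_refl]
  and refl_neg = linear_neg[OF linear_refl]
  and refl_zero [simp] = linear_0[OF linear_refl]

lemma refl_self [simp]: "refl \<beta> \<beta> = - \<beta>"
proof (cases "\<beta> = 0")
  case False
  then show ?thesis by (simp add: refl_eq dot_square_norm scaleR_2)
qed simp

lemma refl_refl [simp]: "refl \<beta> (refl \<beta> y) = y"
  by (simp add: refl_eq[of \<beta> y] refl_diff refl_scale)

lemma inner_refl_refl [simp]: "refl \<beta> x \<bullet> refl \<beta> y = x \<bullet> y"
proof (cases "\<beta> = 0")
  case False
  then show ?thesis
    by (simp add: refl_eq inner_diff_left inner_diff_right inner_commute[of _ \<beta>] dot_square_norm)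
qed (simp add: refl_eq)

lemma inner_refl_left: "refl \<beta> x \<bullet> y = x \<bullet> refl \<beta> y"
  by (metis inner_refl_refl refl_refl)

lemma norm_refl [simp]: "norm (refl \<beta> x) = norm x"
  by (simp add: norm_eq_sqrt_inner)

lemma coroot_refl: "coroot (refl \<gamma> \<beta>) = refl \<gamma> (coroot \<beta>)"
  by (simp add: coroot_def refl_scale)

lemma refl_coroot_self [simp]: "refl \<beta> (coroot \<beta>) = - coroot \<beta>"
  by (metis coroot_minus coroot_refl refl_self)

section \<open>Root systems with a base\<close>

context root_datum
begin

lemma finite_roots: "finite \<Phi>" and zero_not_root: "0 \<notin> \<Phi>"
  using root_system by (auto simp: root_system_def)

lemma root_nz: "\<beta> \<in> \<Phi> \<Longrightarrow> \<beta> \<noteq> 0"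
  using zero_not_root by blast

lemma refl_root: "\<beta> \<in> \<Phi> \<Longrightarrow> \<gamma> \<in> \<Phi> \<Longrightarrow> refl \<beta> \<gamma> \<in> \<Phi>"
  using root_system by (force simp: root_system_def)

lemma root_neg: "\<beta> \<in> \<Phi> \<Longrightarrow> - \<beta> \<in> \<Phi>"
  using refl_root[of \<beta> \<beta>] by simp

lemma cartan_int: "\<beta> \<in> \<Phi> \<Longrightarrow> \<gamma> \<in> \<Phi> \<Longrightarrow> \<beta> \<bullet> coroot \<gamma> \<in> \<int>"
  using root_system by (auto simp: root_system_def)

lemma proportional_roots: "\<beta> \<in> \<Phi> \<Longrightarrow> x *\<^sub>R \<beta> \<in> \<Phi> \<Longrightarrow> x = 1 \<or> x = - 1"
  using reduced by (auto simp: reduced_def)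

lemma simple_root: "j \<in> {1..r} \<Longrightarrow> \<alpha> j \<in> \<Phi>"
  using simple_roots by (auto simp: simple_roots_def)

lemma pos_or_neg: "\<beta> \<in> \<Phi> \<Longrightarrow> nonneg_comb r \<alpha> \<beta> \<or> nonneg_comb r \<alpha> (- \<beta>)"
  using simple_roots by (auto simp: simple_roots_def)

text \<open>
  The coordinate functionals of the simple roots, extended linearly to the whole space, and the
  resulting height functional.
\<close>

definition cf :: "nat \<Rightarrow> 'a \<Rightarrow> real" where
  "cf i = (SOME f. linear f \<and> (\<forall>k \<in> {1..r}. f (\<alpha> k) = (if k = i then 1 else 0)))"

definition ht :: "'a \<Rightarrow> real" where
  "ht v = (\<Sum>i = 1..r. cf i v)"

lemma cf_spec: "linear (cf i) \<and> (\<forall>k \<in> {1..r}. cf i (\<alpha> k) = (if k = i then 1 else 0))"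
proof -
  have inj: "inj_on \<alpha> {1..r}" and ind: "independent (\<alpha> ` {1..r})"
    using simple_roots by (auto simp: simple_roots_def)
  let ?g = "\<lambda>v. if inv_into {1..r} \<alpha> v = i then (1::real) else 0"
  obtain f where "linear f" "\<forall>v \<in> \<alpha> ` {1..r}. f v = ?g v"
    using linear_independent_extend[OF ind, of ?g] by blast
  then have "linear f \<and> (\<forall>k \<in> {1..r}. f (\<alpha> k) = (if k = i then 1 else 0))"
    using inv_into_f_f[OF inj] by simp
  then show ?thesis unfolding cf_def
    by (rule someI[where P = "\<lambda>f. linear f \<and> (\<forall>k \<in> {1..r}. f (\<alpha> k) = (if k = i then 1 else 0))"])
qed

lemma linear_cf: "linear (cf i)" using cf_spec by blast

lemma cf_simple: "k \<in> {1..r} \<Longrightarrow> cf i (\<alpha> k) = (if k = i then 1 else 0)" using cf_spec by blast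

lemmas cf_add = linear_add[OF linear_cf]
  and cf_diff = linear_diff[OF linear_cf]
  and cf_scale = linear_scale[OF linear_cf]
  and cf_neg = linear_neg[OF linear_cf]
  and cf_sum = linear_sum[OF linear_cf]

lemma linear_ht: "linear ht"
  by (rule linearI) (simp_all add: ht_def cf_add cf_scale sum.distrib sum_distrib_left)

lemmas ht_add = linear_add[OF linear_ht]
  and ht_diff = linear_diff[OF linear_ht]
  and ht_scale = linear_scale[OF linear_ht]
  and ht_neg = linear_neg[OF linear_ht]

lemma ht_simple: "k \<in> {1..r} \<Longrightarrow> ht (\<alpha> k) = 1"
  by (simp add: ht_def cf_simple)

lemma cf_comb: "i \<in> {1..r} \<Longrightarrow> cf i (\<Sum>k = 1..r. c k *\<^sub>R \<alpha> k) = c i"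
proof -
  assume i: "i \<in> {1..r}"
  have "cf i (\<Sum>k = 1..r. c k *\<^sub>R \<alpha> k) = (\<Sum>k = 1..r. if k = i then c k else 0)"
    unfolding cf_sum by (rule sum.cong) (auto simp: cf_scale cf_simple)
  then show ?thesis using i by simp
qed

lemma nonneg_comb_iff:
  "nonneg_comb r \<alpha> v \<longleftrightarrow> v = (\<Sum>i = 1..r. cf i v *\<^sub>R \<alpha> i) \<and> (\<forall>i \<in> {1..r}. cf i v \<in> \<nat>)"
proof
  assume "nonneg_comb r \<alpha> v"
  then obtain n where v: "v = (\<Sum>i = 1..r. real (n i) *\<^sub>R \<alpha> i)"
    by (auto simp: nonneg_comb_def)
  have c: "cf i v = real (n i)" if "i \<in> {1..r}" for i
    using cf_comb[OF that, of "\<lambda>i. real (n i)"] v by simp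
  then have "v = (\<Sum>i = 1..r. cf i v *\<^sub>R \<alpha> i)"
    by (subst v) (rule sum.cong, auto)
  then show "v = (\<Sum>i = 1..r. cf i v *\<^sub>R \<alpha> i) \<and> (\<forall>i \<in> {1..r}. cf i v \<in> \<nat>)"
    using c by simp
next
  assume r: "v = (\<Sum>i = 1..r. cf i v *\<^sub>R \<alpha> i) \<and> (\<forall>i \<in> {1..r}. cf i v \<in> \<nat>)"
  have c: "real (nat \<lfloor>cf i v\<rfloor>) = cf i v" if "i \<in> {1..r}" for i
    using r that by (metis Nats_cases floor_of_nat nat_int)
  have "v = (\<Sum>i = 1..r. cf i v *\<^sub>R \<alpha> i)" using r by blast
  also have "\<dots> = (\<Sum>i = 1..r. real (nat \<lfloor>cf i v\<rfloor>) *\<^sub>R \<alpha> i)"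
    by (rule sum.cong) (use c in simp_all)
  finally show "nonneg_comb r \<alpha> v"
    unfolding nonneg_comb_def by (rule exI[where x = "\<lambda>i. nat \<lfloor>cf i v\<rfloor>"])
qed

lemma nonneg_comb_cf: "nonneg_comb r \<alpha> v \<Longrightarrow> i \<in> {1..r} \<Longrightarrow> 0 \<le> cf i v"
  by (metis Nats_cases nonneg_comb_iff of_nat_0_le_iff)

lemma nonneg_comb_ht: "nonneg_comb r \<alpha> v \<Longrightarrow> ht v \<in> \<nat>"
proof -
  have "(\<Sum>i \<in> A. cf i v) \<in> \<nat>" if "finite A" "\<forall>i \<in> A. cf i v \<in> \<nat>" for A
    using that by (induction A rule: finite_induct) auto
  moreover assume "nonneg_comb r \<alpha> v"
  ultimately show ?thesis unfolding ht_def nonneg_comb_iff by blast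
qed

lemma nonneg_comb_add: "nonneg_comb r \<alpha> v \<Longrightarrow> nonneg_comb r \<alpha> w \<Longrightarrow> nonneg_comb r \<alpha> (v + w)"
proof -
  assume "nonneg_comb r \<alpha> v" "nonneg_comb r \<alpha> w"
  then obtain m n where "v = (\<Sum>i = 1..r. real (m i) *\<^sub>R \<alpha> i)" "w = (\<Sum>i = 1..r. real (n i) *\<^sub>R \<alpha> i)"
    by (auto simp: nonneg_comb_def)
  then have "v + w = (\<Sum>i = 1..r. real (m i + n i) *\<^sub>R \<alpha> i)"
    by (simp add: sum.distrib scaleR_add_left)
  then show ?thesis unfolding nonneg_comb_def by (rule exI[where x = "\<lambda>i. m i + n i"])
qed

lemma nonneg_comb_zero: "nonneg_comb r \<alpha> 0"
  unfolding nonneg_comb_def by (intro exI[of _ "\<lambda>_. 0"]) simp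

lemma nonneg_comb_simple: "j \<in> {1..r} \<Longrightarrow> nonneg_comb r \<alpha> (real n *\<^sub>R \<alpha> j)"
  unfolding nonneg_comb_def
  by (intro exI[of _ "\<lambda>i. if i = j then n else 0"])
     (simp add: if_distrib[of "\<lambda>n. real n *\<^sub>R _"] if_distrib[of real] if_distrib[of
       "\<lambda>x. x *\<^sub>R _"] cong: if_cong)

lemma root_comb: "\<beta> \<in> \<Phi> \<Longrightarrow> \<beta> = (\<Sum>i = 1..r. cf i \<beta> *\<^sub>R \<alpha> i)"
  using pos_or_neg[of \<beta>] by (auto simp: nonneg_comb_iff cf_neg sum_negf)

lemma not_pos_neg: "\<beta> \<in> \<Phi> \<Longrightarrow> nonneg_comb r \<alpha> \<beta> \<Longrightarrow> \<not> nonneg_comb r \<alpha> (- \<beta>)"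
proof
  assume b: "\<beta> \<in> \<Phi>" "nonneg_comb r \<alpha> \<beta>" "nonneg_comb r \<alpha> (- \<beta>)"
  have "cf i \<beta> = 0" if "i \<in> {1..r}" for i
    using nonneg_comb_cf[OF b(2) that] nonneg_comb_cf[OF b(3) that] by (simp add: cf_neg)
  then have "\<beta> = 0" using root_comb[OF b(1)] by simp
  then show False using b root_nz by blast
qed

lemma pos_if_cf: "\<beta> \<in> \<Phi> \<Longrightarrow> i \<in> {1..r} \<Longrightarrow> 0 < cf i \<beta> \<Longrightarrow> nonneg_comb r \<alpha> \<beta>"
  using pos_or_neg[of \<beta>] nonneg_comb_cf[of "- \<beta>" i] by (auto simp: cf_neg)

lemma ht_pos_root: "\<beta> \<in> \<Phi> \<Longrightarrow> nonneg_comb r \<alpha> \<beta> \<Longrightarrow> 0 < ht \<beta>"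
proof -
  assume b: "\<beta> \<in> \<Phi>" "nonneg_comb r \<alpha> \<beta>"
  have "\<exists>i \<in> {1..r}. cf i \<beta> \<noteq> 0"
  proof (rule ccontr)
    assume "\<not> ?thesis"
    then have "\<beta> = 0" using root_comb[OF b(1)] by simp
    then show False using b root_nz by blast
  qed
  then show ?thesis
    unfolding ht_def using nonneg_comb_cf[OF b(2)]
    by (metis finite_atLeastAtMost order_le_less sum_pos2)
qed

lemma refl_simple_cf: "i \<in> {1..r} \<Longrightarrow> j \<in> {1..r} \<Longrightarrow> i \<noteq> j \<Longrightarrow> cf i (refl (\<alpha> j) v) = cf i v"
  by (simp add: refl_eq cf_diff cf_scale cf_simple)

text \<open>A simple reflection permutes the positive roots other than the simple root itself.\<close>

lemma simple_refl_pos: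
  assumes b: "\<beta> \<in> \<Phi>" "nonneg_comb r \<alpha> \<beta>" and j: "j \<in> {1..r}" and ne: "\<beta> \<noteq> \<alpha> j"
  shows "nonneg_comb r \<alpha> (refl (\<alpha> j) \<beta>)"
proof -
  have "\<exists>i \<in> {1..r}. i \<noteq> j \<and> cf i \<beta> \<noteq> 0"
  proof (rule ccontr)
    assume "\<not> ?thesis"
    then have z: "cf i \<beta> = 0" if "i \<in> {1..r}" "i \<noteq> j" for i using that by blast
    have "\<beta> = (\<Sum>i = 1..r. cf i \<beta> *\<^sub>R \<alpha> i)" using root_comb b by blast
    also have "\<dots> = (\<Sum>i = 1..r. if i = j then cf j \<beta> *\<^sub>R \<alpha> j else 0)"
      by (rule sum.cong) (use z in auto)
    finally have e: "\<beta> = cf j \<beta> *\<^sub>R \<alpha> j" using j by simp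
    then have "cf j \<beta> = 1 \<or> cf j \<beta> = - 1"
      using proportional_roots[OF simple_root[OF j]] b by metis
    then show False using nonneg_comb_cf[OF b(2) j] e ne by auto
  qed
  then obtain i where i: "i \<in> {1..r}" "i \<noteq> j" "cf i \<beta> \<noteq> 0" by blast
  then have "0 < cf i (refl (\<alpha> j) \<beta>)"
    using refl_simple_cf[OF i(1) j i(2)] nonneg_comb_cf[OF b(2) i(1)] by simp
  then show ?thesis using pos_if_cf[OF refl_root[OF simple_root[OF j] b(1)] i(1)] by blast
qed

lemma cartan_pos_int:
  assumes "\<beta> \<in> \<Phi>" "\<gamma> \<in> \<Phi>" "0 < \<beta> \<bullet> \<gamma>"
  shows "\<exists>m :: int. 0 < m \<and> \<beta> \<bullet> coroot \<gamma> = of_int m"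
proof -
  obtain m where m: "\<beta> \<bullet> coroot \<gamma> = of_int m" using cartan_int assms Ints_cases by blast
  have "0 < \<beta> \<bullet> coroot \<gamma>" using assms root_nz by (simp add: inner_coroot)
  then show ?thesis using m by auto
qed

lemma inner_comb:
  "\<beta> = (\<Sum>i = 1..r. cf i \<beta> *\<^sub>R \<alpha> i) \<Longrightarrow> \<beta> \<bullet> v = (\<Sum>i = 1..r. cf i \<beta> * (\<alpha> i \<bullet> v))"
  by (drule arg_cong[where f = "\<lambda>x. x \<bullet> v"]) (simp add: inner_sum_left)

lemma simple_pos: "j \<in> {1..r} \<Longrightarrow> nonneg_comb r \<alpha> (\<alpha> j)"
  using nonneg_comb_simple[of j 1] by simp

lemma pos_root_induct [consumes 2, case_names simple step]:
  assumes "\<beta> \<in> \<Phi>" "nonneg_comb r \<alpha> \<beta>"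
    and simple: "\<And>j. j \<in> {1..r} \<Longrightarrow> P (\<alpha> j)"
    and step: "\<And>\<beta> j. \<beta> \<in> \<Phi> \<Longrightarrow> nonneg_comb r \<alpha> \<beta> \<Longrightarrow> j \<in> {1..r} \<Longrightarrow> 0 < \<alpha> j \<bullet> \<beta> \<Longrightarrow>
       nonneg_comb r \<alpha> (refl (\<alpha> j) \<beta>) \<Longrightarrow> P (refl (\<alpha> j) \<beta>) \<Longrightarrow> P \<beta>"
  shows "P \<beta>"
  using assms(1,2)
proof (induction "nat \<lfloor>ht \<beta>\<rfloor>" arbitrary: \<beta> rule: less_induct)
  case less
  show ?case
  proof (cases "\<exists>j \<in> {1..r}. \<beta> = \<alpha> j")
    case True
    then show ?thesis using simple by blast
  next
    case False
    have "\<exists>j \<in> {1..r}. 0 < \<alpha> j \<bullet> \<beta>"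
    proof (rule ccontr)
      assume "\<not> ?thesis"
      then have "(\<Sum>i = 1..r. cf i \<beta> * (\<alpha> i \<bullet> \<beta>)) \<le> 0"
        using nonneg_comb_cf[OF less.prems(2)]
        by (intro sum_nonpos mult_nonneg_nonpos) (auto simp: not_less)
      then have "\<beta> \<bullet> \<beta> \<le> 0" using inner_comb[OF root_comb[OF less.prems(1)]] by simp
      then show False using root_nz[OF less.prems(1)] by (metis inner_gt_zero_iff not_less)
    qed
    then obtain j where j: "j \<in> {1..r}" "0 < \<alpha> j \<bullet> \<beta>" by blast
    have p: "nonneg_comb r \<alpha> (refl (\<alpha> j) \<beta>)"
      using simple_refl_pos[OF less.prems j(1)] False j by blast
    have rt: "refl (\<alpha> j) \<beta> \<in> \<Phi>" using refl_root simple_root j less.prems by blast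
    obtain m :: int where m: "0 < m" "\<beta> \<bullet> coroot (\<alpha> j) = of_int m"
      using cartan_pos_int[OF less.prems(1) simple_root[OF j(1)]] j by (auto simp: inner_commute)
    have "ht (refl (\<alpha> j) \<beta>) = ht \<beta> - of_int m"
      using m(2) by (simp add: refl_eq inner_coroot inner_commute ht_diff ht_scale ht_simple[OF j(1)])
    moreover have "0 < ht (refl (\<alpha> j) \<beta>)" using ht_pos_root rt p by blast
    ultimately have "nat \<lfloor>ht (refl (\<alpha> j) \<beta>)\<rfloor> < nat \<lfloor>ht \<beta>\<rfloor>" using m(1) by linarith
    then show ?thesis using less.hyps rt p step[OF less.prems j p] by blast
  qed
qed

lemma inner_roots_bound:
  assumes "\<beta> \<in> \<Phi>" "\<gamma> \<in> \<Phi>" "\<gamma> \<noteq> \<beta>" "\<gamma> \<noteq> - \<beta>"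
  shows "\<bar>\<beta> \<bullet> \<gamma>\<bar> < norm \<beta> * norm \<gamma>"
proof -
  have "\<bar>\<beta> \<bullet> \<gamma>\<bar> \<noteq> norm \<beta> * norm \<gamma>"
  proof
    assume "\<bar>\<beta> \<bullet> \<gamma>\<bar> = norm \<beta> * norm \<gamma>"
    then have "norm \<beta> *\<^sub>R \<gamma> = norm \<gamma> *\<^sub>R \<beta> \<or> norm \<beta> *\<^sub>R \<gamma> = - norm \<gamma> *\<^sub>R \<beta>"
      using norm_cauchy_schwarz_abs_eq by blast
    then have "\<gamma> = (norm \<gamma> / norm \<beta>) *\<^sub>R \<beta> \<or> \<gamma> = (- norm \<gamma> / norm \<beta>) *\<^sub>R \<beta>"
      using root_nz[OF assms(1)]
      by (metis (no_types, opaque_lifting) divide_inverse_commute eq_vector_fraction_iff norm_eq_zero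
          scaleR_scaleR)
    then show False using proportional_roots[OF assms(1)] assms(2-4)
      by (metis scaleR_minus1_left scaleR_one)
  qed
  then show ?thesis using Cauchy_Schwarz_ineq2[of \<beta> \<gamma>] by linarith
qed

lemma cartan_product:
  assumes "\<beta> \<in> \<Phi>" "\<gamma> \<in> \<Phi>" "\<gamma> \<noteq> \<beta>" "\<gamma> \<noteq> - \<beta>"
  shows "(\<beta> \<bullet> coroot \<gamma>) * (\<gamma> \<bullet> coroot \<beta>) < 4"
proof -
  have "(\<beta> \<bullet> \<gamma>)\<^sup>2 < (norm \<beta>)\<^sup>2 * (norm \<gamma>)\<^sup>2"
    using inner_roots_bound[OF assms]
    by (metis abs_ge_zero power2_abs power_mult_distrib power_strict_mono zero_less_numeral)
  then show ?thesis using root_nz assms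
    by (simp add: inner_coroot inner_commute field_simps power2_eq_square)
qed

lemma root_diff:
  assumes b: "\<beta> \<in> \<Phi>" and g: "\<gamma> \<in> \<Phi>" and p: "0 < \<beta> \<bullet> \<gamma>" and ne: "\<beta> \<noteq> \<gamma>"
  shows "\<beta> - \<gamma> \<in> \<Phi>"
proof -
  have ne': "\<gamma> \<noteq> - \<beta>" using p inner_ge_zero[of \<beta>] by (auto simp del: inner_ge_zero)
  obtain m n :: int where m: "0 < m" "\<beta> \<bullet> coroot \<gamma> = of_int m"
    and n: "0 < n" "\<gamma> \<bullet> coroot \<beta> = of_int n"
    using cartan_pos_int b g p by (metis inner_commute)
  have "of_int m * of_int n < (4::real)"
    using cartan_product[OF b g _ ne'] ne m n by auto
  then have mn: "m * n < 4" by (metis of_int_less_iff of_int_mult of_int_numeral)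
  have "m = 1 \<or> n = 1"
  proof (rule ccontr)
    assume "\<not> ?thesis"
    then have "2 \<le> m" "2 \<le> n" using m n by auto
    then have "2 * 2 \<le> m * n" by (intro mult_mono) auto
    then show False using mn by simp
  qed
  then show ?thesis
  proof
    assume "m = 1"
    then have "refl \<gamma> \<beta> = \<beta> - \<gamma>" using m p by (simp add: refl_eq inner_coroot inner_commute)
    then show ?thesis using refl_root[OF g b] by simp
  next
    assume "n = 1"
    then have "refl \<beta> \<gamma> = \<gamma> - \<beta>" using n p by (simp add: refl_eq inner_coroot inner_commute)
    then show ?thesis using root_neg[OF refl_root[OF b g]] by simp
  qed
qed

lemma simple_obtuse:
  assumes "i \<in> {1..r}" "j \<in> {1..r}" "i \<noteq> j"
  shows "\<alpha> i \<bullet> \<alpha> j \<le> 0"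
proof (rule ccontr)
  assume "\<not> ?thesis"
  moreover have "inj_on \<alpha> {1..r}" using simple_roots unfolding simple_roots_def by blast
  then have "\<alpha> i \<noteq> \<alpha> j" using assms by (auto dest: inj_onD)
  ultimately have d: "\<alpha> i - \<alpha> j \<in> \<Phi>"
    using root_diff[OF simple_root[OF assms(1)] simple_root[OF assms(2)]] by linarith
  have "cf i (\<alpha> i - \<alpha> j) = 1" "cf j (\<alpha> i - \<alpha> j) = - 1"
    using assms by (auto simp: cf_diff cf_simple)
  then show False
    using pos_if_cf[OF d assms(1)] nonneg_comb_cf[of "\<alpha> i - \<alpha> j" j] assms(2) by simp
qed

section \<open>The highest root\<close>

lemma exists_maximal_above:
  assumes b: "\<beta> \<in> \<Phi>"
  obtains \<phi> where "\<phi> \<in> \<Phi>" "nonneg_comb r \<alpha> (\<phi> - \<beta>)"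
    "\<And>\<gamma>. \<gamma> \<in> \<Phi> \<Longrightarrow> nonneg_comb r \<alpha> (\<gamma> - \<phi>) \<Longrightarrow> \<gamma> = \<phi>"
proof -
  let ?A = "{\<gamma> \<in> \<Phi>. nonneg_comb r \<alpha> (\<gamma> - \<beta>)}"
  have fin: "finite ?A" and ne: "?A \<noteq> {}" using finite_roots b nonneg_comb_zero by auto
  then have "Max (ht ` ?A) \<in> ht ` ?A" by (intro Max_in) auto
  then obtain \<phi> where p: "\<phi> \<in> ?A" and ph: "ht \<phi> = Max (ht ` ?A)" by auto
  then have mx: "ht \<gamma> \<le> ht \<phi>" if "\<gamma> \<in> ?A" for \<gamma> using fin that by simp
  have "\<gamma> = \<phi>" if g: "\<gamma> \<in> \<Phi>" and n: "nonneg_comb r \<alpha> (\<gamma> - \<phi>)" for \<gamma>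
  proof -
    have "\<gamma> \<in> ?A" using nonneg_comb_add[OF n, of "\<phi> - \<beta>"] p g by simp
    then have "ht (\<gamma> - \<phi>) \<le> 0" using mx by (simp add: ht_diff)
    then have "\<forall>i \<in> {1..r}. cf i (\<gamma> - \<phi>) = 0"
      using nonneg_comb_cf[OF n] unfolding ht_def
      by (metis (no_types, lifting) finite_atLeastAtMost order_antisym sum_nonneg sum_nonneg_eq_0_iff)
    moreover have "\<gamma> - \<phi> = (\<Sum>i = 1..r. cf i (\<gamma> - \<phi>) *\<^sub>R \<alpha> i)"
      using n nonneg_comb_iff by blast
    ultimately show ?thesis by simp
  qed
  then show thesis using that p by blast
qed

context
  fixes \<phi> :: 'a
  assumes phi: "\<phi> \<in> \<Phi>"
    and maximal: "\<And>\<gamma>. \<gamma> \<in> \<Phi> \<Longrightarrow> nonneg_comb r \<alpha> (\<gamma> - \<phi>) \<Longrightarrow> \<gamma> = \<phi>"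
begin

lemma maximal_dominant: "j \<in> {1..r} \<Longrightarrow> 0 \<le> \<phi> \<bullet> \<alpha> j"
proof (rule ccontr)
  assume j: "j \<in> {1..r}" and "\<not> 0 \<le> \<phi> \<bullet> \<alpha> j"
  then obtain m :: int where m: "0 < m" "- \<phi> \<bullet> coroot (\<alpha> j) = of_int m"
    using cartan_pos_int[OF root_neg[OF phi] simple_root[OF j]] by auto
  then have e: "refl (\<alpha> j) \<phi> - \<phi> = real (nat m) *\<^sub>R \<alpha> j"
    by (simp add: refl_eq inner_coroot inner_commute flip: scaleR_minus_left)
  then have "nonneg_comb r \<alpha> (refl (\<alpha> j) \<phi> - \<phi>)" using nonneg_comb_simple j by simp
  then have "refl (\<alpha> j) \<phi> = \<phi>" using maximal refl_root simple_root phi j by blast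
  then show False using e m root_nz[OF simple_root[OF j]] by simp
qed

lemma maximal_pos: "nonneg_comb r \<alpha> \<phi>"
proof (rule ccontr)
  assume "\<not> ?thesis"
  then have n: "nonneg_comb r \<alpha> (- \<phi>)" using pos_or_neg phi by blast
  have "\<phi> \<bullet> \<phi> = (\<Sum>i = 1..r. cf i \<phi> * (\<alpha> i \<bullet> \<phi>))" using inner_comb[OF root_comb[OF phi]] .
  also have "\<dots> \<le> 0"
    using nonneg_comb_cf[OF n] maximal_dominant
    by (intro sum_nonpos mult_nonpos_nonneg) (auto simp: cf_neg inner_commute)
  finally show False using root_nz[OF phi] by (metis inner_gt_zero_iff not_less)
qed

text \<open>
  By irreducibility every simple root occurs in a maximal root: otherwise the roots supported on
  the simple roots that occur and those supported on the remaining ones form an orthogonal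
  partition.
\<close>

lemma maximal_full_support:
  assumes i: "i \<in> {1..r}"
  shows "0 < cf i \<phi>"
proof (rule ccontr)
  assume ni: "\<not> 0 < cf i \<phi>"
  define S where "S = {l \<in> {1..r}. 0 < cf l \<phi>}"
  define T where "T = {l \<in> {1..r}. \<not> 0 < cf l \<phi>}"
  have ST: "S \<union> T = {1..r}" "S \<inter> T = {}" by (auto simp: S_def T_def)
  have zero: "cf l \<phi> = 0" if "l \<in> T" for l
    using that nonneg_comb_cf[OF maximal_pos] unfolding T_def by force
  have orth: "\<alpha> l \<bullet> \<alpha> k = 0" if "l \<in> S" "k \<in> T" for l k
  proof -
    have nonpos: "cf l \<phi> * (\<alpha> l \<bullet> \<alpha> k) \<le> 0" if "l \<in> {1..r}" for l
    proof (cases "l \<in> S")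
      case True
      then show ?thesis using simple_obtuse[of l k] \<open>k \<in> T\<close>
        by (intro mult_nonneg_nonpos) (auto simp: S_def T_def)
    next
      case False
      then show ?thesis using zero that ST by auto
    qed
    have "\<phi> \<bullet> \<alpha> k = (\<Sum>l = 1..r. cf l \<phi> * (\<alpha> l \<bullet> \<alpha> k))" using inner_comb[OF root_comb[OF phi]] .
    moreover have "0 \<le> \<phi> \<bullet> \<alpha> k" using maximal_dominant that ST by auto
    ultimately have "(\<Sum>l = 1..r. - (cf l \<phi> * (\<alpha> l \<bullet> \<alpha> k))) = 0"
      using sum_nonpos[of "{1..r}" "\<lambda>l. cf l \<phi> * (\<alpha> l \<bullet> \<alpha> k)"] nonpos
      by (auto simp: sum_negf)
    then have "- (cf l \<phi> * (\<alpha> l \<bullet> \<alpha> k)) = 0"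
      using nonpos sum_nonneg_eq_0_iff[of "{1..r}" "\<lambda>l. - (cf l \<phi> * (\<alpha> l \<bullet> \<alpha> k))"] that(1) ST(1)
      by force
    then show ?thesis using that by (auto simp: S_def)
  qed
  define A where "A = {\<beta> \<in> \<Phi>. \<forall>l \<in> T. cf l \<beta> = 0}"
  define B where "B = {\<beta> \<in> \<Phi>. \<forall>l \<in> S. cf l \<beta> = 0}"
  have inner0: "\<beta> \<bullet> \<gamma> = 0"
    if "\<beta> \<in> \<Phi>" "\<gamma> \<in> \<Phi>" "\<forall>l \<in> T. cf l \<beta> = 0" "\<forall>l \<in> S. cf l \<gamma> = 0" for \<beta> \<gamma>
  proof -
    have "\<alpha> l \<bullet> \<gamma> = 0" if "l \<in> S" for l
    proof -
      have "\<gamma> \<bullet> \<alpha> l = (\<Sum>k = 1..r. cf k \<gamma> * (\<alpha> k \<bullet> \<alpha> l))"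
        using inner_comb[OF root_comb[OF \<open>\<gamma> \<in> \<Phi>\<close>]] .
      also have "\<dots> = 0"
      proof (rule sum.neutral, rule ballI)
        fix k assume "k \<in> {1..r}"
        then have "k \<in> S \<or> k \<in> T" using ST by blast
        then show "cf k \<gamma> * (\<alpha> k \<bullet> \<alpha> l) = 0"
          using orth[OF that, of k] \<open>\<forall>l \<in> S. cf l \<gamma> = 0\<close> by (auto simp: inner_commute)
      qed
      finally show ?thesis by (simp add: inner_commute)
    qed
    then have "cf l \<beta> * (\<alpha> l \<bullet> \<gamma>) = 0" if "l \<in> {1..r}" for l
      using that ST(1) \<open>\<forall>l \<in> T. cf l \<beta> = 0\<close> by (cases "l \<in> S") auto
    then have "(\<Sum>l = 1..r. cf l \<beta> * (\<alpha> l \<bullet> \<gamma>)) = 0" by (intro sum.neutral) blast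
    then show ?thesis using inner_comb[OF root_comb[OF \<open>\<beta> \<in> \<Phi>\<close>]] by simp
  qed
  have pos: "\<beta> \<in> A \<union> B" if "\<beta> \<in> \<Phi>" "nonneg_comb r \<alpha> \<beta>" for \<beta>
    using that
  proof (induction rule: pos_root_induct)
    case (simple j)
    then have "j \<in> S \<or> j \<in> T" using ST by blast
    then show ?case using simple ST(2) simple_root[OF simple]
      by (auto simp: A_def B_def cf_simple)
  next
    case (step \<beta> j)
    let ?g = "refl (\<alpha> j) \<beta>"
    have g: "?g \<in> \<Phi>" using refl_root simple_root step by blast
    have ng: "\<alpha> j \<bullet> ?g \<noteq> 0" using step(4) by (metis inner_refl_left neg_equal_0_iff_equal
      inner_minus_left less_irrefl refl_self)
    have jj: "j \<in> S \<or> j \<in> T" using ST step by blast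
    have jsT: "\<forall>l \<in> T. cf l (\<alpha> j) = 0" if "j \<in> S" using that ST(2) step by (auto simp: cf_simple)
    have jsS: "\<forall>l \<in> S. cf l (\<alpha> j) = 0" if "j \<in> T" using that ST(2) step by (auto simp: cf_simple)
    have b: "cf l \<beta> = cf l ?g" if "l \<in> {1..r}" "l \<noteq> j" for l
      using refl_simple_cf[OF that(1) step(3) that(2)] by simp
    from step(6) consider "?g \<in> A" | "?g \<in> B" by blast
    then show ?case
    proof cases
      case 1
      then have "j \<in> S"
        using jj jsS inner0[OF g simple_root[OF step(3)]] ng by (auto simp: A_def inner_commute)
      have "cf l \<beta> = 0" if l: "l \<in> T" for l
      proof -
        have "l \<in> {1..r}" "l \<noteq> j" using l ST \<open>j \<in> S\<close> by auto
        then show ?thesis using b[of l] l 1 by (simp add: A_def)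
      qed
      then have "\<beta> \<in> A" using step(1) unfolding A_def by blast
      then show ?thesis by blast
    next
      case 2
      then have "j \<in> T"
        using jj jsT inner0[OF simple_root[OF step(3)] g] ng by (auto simp: B_def)
      have "cf l \<beta> = 0" if l: "l \<in> S" for l
      proof -
        have "l \<in> {1..r}" "l \<noteq> j" using l ST \<open>j \<in> T\<close> by auto
        then show ?thesis using b[of l] l 2 by (simp add: B_def)
      qed
      then have "\<beta> \<in> B" using step(1) unfolding B_def by blast
      then show ?thesis by blast
    qed
  qed
  have "\<Phi> \<subseteq> A \<union> B"
  proof
    fix \<beta> assume b: "\<beta> \<in> \<Phi>"
    show "\<beta> \<in> A \<union> B"
    proof (cases "nonneg_comb r \<alpha> \<beta>")
      case False
      then have "- \<beta> \<in> A \<union> B" using pos root_neg b pos_or_neg by blast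
      then show ?thesis using b by (auto simp: A_def B_def cf_neg)
    qed (use pos b in blast)
  qed
  moreover have "A \<inter> B = {}"
  proof -
    have "\<beta> \<bullet> \<beta> = 0" if "\<beta> \<in> A" "\<beta> \<in> B" for \<beta> using that inner0[of \<beta> \<beta>] by (auto simp: A_def B_def)
    then show ?thesis using root_nz by (force simp: A_def)
  qed
  moreover have "\<phi> \<in> A" using phi zero by (auto simp: A_def)
  moreover have "i \<in> T" using ni i by (auto simp: T_def)
  then have "\<alpha> i \<in> B" using i ST(2) simple_root by (auto simp: B_def cf_simple)
  moreover have "\<forall>\<beta> \<in> A. \<forall>\<gamma> \<in> B. \<beta> \<bullet> \<gamma> = 0" using inner0 by (auto simp: A_def B_def)
  moreover have "A \<union> B \<subseteq> \<Phi>" by (auto simp: A_def B_def)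
  ultimately show False using irreducible unfolding irreducible_rs_def by blast
qed

end

lemma maximal_unique:
  assumes p: "\<phi> \<in> \<Phi>" "\<And>\<gamma>. \<gamma> \<in> \<Phi> \<Longrightarrow> nonneg_comb r \<alpha> (\<gamma> - \<phi>) \<Longrightarrow> \<gamma> = \<phi>"
    and s: "\<psi> \<in> \<Phi>" "\<And>\<gamma>. \<gamma> \<in> \<Phi> \<Longrightarrow> nonneg_comb r \<alpha> (\<gamma> - \<psi>) \<Longrightarrow> \<gamma> = \<psi>"
  shows "\<phi> = \<psi>"
proof (rule ccontr)
  assume ne: "\<phi> \<noteq> \<psi>"
  have "\<exists>i \<in> {1..r}. \<alpha> i \<bullet> \<psi> \<noteq> 0"
  proof (rule ccontr)
    assume "\<not> ?thesis"
    then have "\<psi> \<bullet> \<psi> = 0" using inner_comb[OF root_comb[OF s(1)], of \<psi>] by simp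
    then show False using root_nz s by auto
  qed
  then obtain i where i: "i \<in> {1..r}" "\<alpha> i \<bullet> \<psi> \<noteq> 0" by blast
  have "0 < (\<Sum>l = 1..r. cf l \<phi> * (\<alpha> l \<bullet> \<psi>))"
  proof (rule sum_pos2[where i = i])
    show "0 < cf i \<phi> * (\<alpha> i \<bullet> \<psi>)"
      using maximal_full_support[OF p i(1)] maximal_dominant[OF s i(1)] i(2)
      by (simp add: inner_commute order_le_less)
    show "0 \<le> cf l \<phi> * (\<alpha> l \<bullet> \<psi>)" if "l \<in> {1..r}" for l
      using maximal_full_support[OF p that] maximal_dominant[OF s that] by (simp add: inner_commute)
  qed (use i in auto)
  then have "0 < \<phi> \<bullet> \<psi>" using inner_comb[OF root_comb[OF p(1)]] by simp
  then have d: "\<phi> - \<psi> \<in> \<Phi>" using root_diff p s ne by blast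
  then have "nonneg_comb r \<alpha> (\<phi> - \<psi>) \<or> nonneg_comb r \<alpha> (\<psi> - \<phi>)" using pos_or_neg by fastforce
  then show False using p s ne by metis
qed

lemma highest_root_unique_ex: "\<exists>!\<phi>. \<phi> \<in> \<Phi> \<and> (\<forall>\<beta> \<in> \<Phi>. nonneg_comb r \<alpha> (\<phi> - \<beta>))"
proof -
  obtain \<beta> where "\<beta> \<in> \<Phi>" using irreducible by (auto simp: irreducible_rs_def)
  then obtain \<phi> where p: "\<phi> \<in> \<Phi>" "\<And>\<gamma>. \<gamma> \<in> \<Phi> \<Longrightarrow> nonneg_comb r \<alpha> (\<gamma> - \<phi>) \<Longrightarrow> \<gamma> = \<phi>"
    using exists_maximal_above by metis
  have "nonneg_comb r \<alpha> (\<phi> - \<beta>)" if "\<beta> \<in> \<Phi>" for \<beta>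
    using exists_maximal_above[OF that] maximal_unique[OF p] by metis
  then show ?thesis using p by blast
qed

lemma highest_root: "highest_root \<in> \<Phi>"
  and highest_root_above: "\<And>\<beta>. \<beta> \<in> \<Phi> \<Longrightarrow> nonneg_comb r \<alpha> (highest_root - \<beta>)"
  using theI'[OF highest_root_unique_ex] unfolding highest_root_def by auto

lemma highest_root_maximal: "\<gamma> \<in> \<Phi> \<Longrightarrow> nonneg_comb r \<alpha> (\<gamma> - highest_root) \<Longrightarrow> \<gamma> = highest_root"
proof -
  assume g: "\<gamma> \<in> \<Phi>" "nonneg_comb r \<alpha> (\<gamma> - highest_root)"
  note n = g(2) and n' = highest_root_above[OF g(1)]
  have "cf i (\<gamma> - highest_root) = 0" if "i \<in> {1..r}" for i
    using nonneg_comb_cf[OF n that] nonneg_comb_cf[OF n' that] by (simp add: cf_diff)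
  moreover have "\<gamma> - highest_root = (\<Sum>i = 1..r. cf i (\<gamma> - highest_root) *\<^sub>R \<alpha> i)"
    using n nonneg_comb_iff by blast
  ultimately show ?thesis by simp
qed

lemmas highest_root_dominant = maximal_dominant[OF highest_root highest_root_maximal]
  and highest_root_pos = maximal_pos[OF highest_root highest_root_maximal]

lemma highest_root_inner_pos: "\<beta> \<in> \<Phi> \<Longrightarrow> nonneg_comb r \<alpha> \<beta> \<Longrightarrow> 0 \<le> highest_root \<bullet> \<beta>"
proof -
  assume b: "\<beta> \<in> \<Phi>" "nonneg_comb r \<alpha> \<beta>"
  have "0 \<le> (\<Sum>i = 1..r. cf i \<beta> * (\<alpha> i \<bullet> highest_root))"
    using nonneg_comb_cf[OF b(2)] highest_root_dominant
    by (intro sum_nonneg mult_nonneg_nonneg) (auto simp: inner_commute)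
  then show ?thesis using inner_comb[OF root_comb[OF b(1)], of highest_root]
    by (simp add: inner_commute)
qed

text \<open>Among the roots of a given norm, one of greatest height is dominant.\<close>

lemma conj_dominant:
  assumes b: "\<beta> \<in> \<Phi>"
  obtains \<gamma> where "\<gamma> \<in> \<Phi>" "norm \<gamma> = norm \<beta>" "\<And>j. j \<in> {1..r} \<Longrightarrow> 0 \<le> \<gamma> \<bullet> \<alpha> j"
proof -
  let ?A = "{\<gamma> \<in> \<Phi>. norm \<gamma> = norm \<beta>}"
  have fin: "finite ?A" and ne: "?A \<noteq> {}" using finite_roots b by auto
  then have "Max (ht ` ?A) \<in> ht ` ?A" by (intro Max_in) auto
  then obtain \<gamma> where p: "\<gamma> \<in> ?A" and ph: "ht \<gamma> = Max (ht ` ?A)" by auto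
  then have mx: "ht \<delta> \<le> ht \<gamma>" if "\<delta> \<in> ?A" for \<delta> using fin that by simp
  have "0 \<le> \<gamma> \<bullet> \<alpha> j" if j: "j \<in> {1..r}" for j
  proof (rule ccontr)
    assume "\<not> ?thesis"
    then have "0 < - (2 * (\<alpha> j \<bullet> \<gamma>) / (norm (\<alpha> j))\<^sup>2)"
      using root_nz[OF simple_root[OF j]] by (simp add: inner_commute zero_less_divide_iff
        divide_less_0_iff)
    moreover have "refl (\<alpha> j) \<gamma> \<in> ?A" using refl_root simple_root j p by simp
    then have "ht (refl (\<alpha> j) \<gamma>) \<le> ht \<gamma>" using mx by blast
    then have "- (2 * (\<alpha> j \<bullet> \<gamma>) / (norm (\<alpha> j))\<^sup>2) \<le> 0"
      by (simp add: refl_eq ht_diff ht_scale ht_simple[OF j])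
    ultimately show False by linarith
  qed
  then show thesis using that p by blast
qed

lemma highest_root_inner_dominant:
  assumes g: "\<gamma> \<in> \<Phi>" "\<And>j. j \<in> {1..r} \<Longrightarrow> 0 \<le> \<gamma> \<bullet> \<alpha> j"
  shows "\<gamma> \<bullet> \<gamma> \<le> highest_root \<bullet> \<gamma>"
proof -
  let ?d = "highest_root - \<gamma>"
  have n: "nonneg_comb r \<alpha> ?d" using highest_root_above g by blast
  have "0 \<le> (\<Sum>i = 1..r. cf i ?d * (\<alpha> i \<bullet> \<gamma>))"
    using nonneg_comb_cf[OF n] g(2) by (intro sum_nonneg mult_nonneg_nonneg) (auto simp: inner_commute)
  moreover have "?d \<bullet> \<gamma> = (\<Sum>i = 1..r. cf i ?d * (\<alpha> i \<bullet> \<gamma>))"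
    using inner_comb n nonneg_comb_iff by blast
  ultimately have "0 \<le> ?d \<bullet> \<gamma>" by simp
  then show ?thesis by (simp add: inner_diff_left)
qed

lemma highest_root_long: "\<beta> \<in> \<Phi> \<Longrightarrow> norm \<beta> \<le> norm highest_root"
proof -
  assume "\<beta> \<in> \<Phi>"
  then obtain \<gamma> where g: "\<gamma> \<in> \<Phi>" "norm \<gamma> = norm \<beta>" "\<And>j. j \<in> {1..r} \<Longrightarrow> 0 \<le> \<gamma> \<bullet> \<alpha> j"
    using conj_dominant by metis
  have "norm \<gamma> * norm \<gamma> \<le> highest_root \<bullet> \<gamma>"
    using highest_root_inner_dominant[OF g(1,3)] by (simp add: dot_square_norm power2_eq_square)
  also have "\<dots> \<le> norm highest_root * norm \<gamma>" by (rule norm_cauchy_schwarz)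
  finally show ?thesis using root_nz[OF g(1)] g(2)
    by (metis mult_right_le_imp_le zero_less_norm_iff)
qed

lemma highest_root_norm: "\<exists>m :: nat. 0 < m \<and> 2 / (norm highest_root)\<^sup>2 = real (m\<^sup>2)"
proof -
  have "long_root \<Phi> highest_root" using highest_root highest_root_long by (auto simp: long_root_def)
  then obtain m :: nat where "m > 0" "(norm highest_root)\<^sup>2 = 2 / (real m)\<^sup>2" using normalised by blast
  then show ?thesis using root_nz[OF highest_root]
    by (intro exI[of _ m]) (simp add: divide_eq_eq eq_divide_eq mult.commute)
qed

text \<open>
  The Cartan integer of a root against the highest root is at most one in absolute value unless the
  two are proportional, because the highest root is long.
\<close>

lemma highest_root_cartan:
  assumes b: "\<beta> \<in> \<Phi>" "\<beta> \<noteq> highest_root" "\<beta> \<noteq> - highest_root"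
  shows "\<beta> \<bullet> coroot highest_root \<in> {-1, 0, 1}"
proof -
  let ?p = highest_root
  obtain m where m: "\<beta> \<bullet> coroot ?p = of_int m" using cartan_int b highest_root Ints_cases by metis
  have nz: "0 < norm ?p" using root_nz[OF highest_root] by simp
  have "\<bar>\<beta> \<bullet> ?p\<bar> < norm \<beta> * norm ?p"
    using inner_roots_bound[OF b(1) highest_root] b by (metis minus_minus)
  also have "\<dots> \<le> norm ?p * norm ?p" using highest_root_long[OF b(1)] by (intro mult_right_mono) auto
  finally have "\<bar>\<beta> \<bullet> coroot ?p\<bar> < 2"
    using nz by (simp add: inner_coroot abs_mult power2_eq_square field_simps)
  then have "\<bar>m\<bar> < 2" using m by linarith
  then have "m = -1 \<or> m = 0 \<or> m = 1" by linarith
  then show ?thesis using m by auto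
qed

text \<open>
  The squared norm of the highest root is an integral multiple of that of any other root, so the
  normalisation of the long roots makes all numbers \<open>2 / \<parallel>\<beta>\<parallel>\<^sup>2\<close> integral.
\<close>

lemma root_norm_integral: "\<beta> \<in> \<Phi> \<Longrightarrow> 2 / (norm \<beta>)\<^sup>2 \<in> \<int>"
proof -
  let ?p = highest_root
  assume "\<beta> \<in> \<Phi>"
  then obtain \<gamma> where g: "\<gamma> \<in> \<Phi>" "norm \<gamma> = norm \<beta>" "\<And>j. j \<in> {1..r} \<Longrightarrow> 0 \<le> \<gamma> \<bullet> \<alpha> j"
    using conj_dominant by metis
  obtain m :: nat where m: "2 / (norm ?p)\<^sup>2 = real (m\<^sup>2)" using highest_root_norm by blast
  show ?thesis
  proof (cases "\<gamma> = ?p")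
    case True
    then show ?thesis using m g by (metis Ints_of_nat)
  next
    case False
    have pos: "0 < \<gamma> \<bullet> ?p"
      using highest_root_inner_dominant[OF g(1,3)] root_nz[OF g(1)]
      by (metis inner_commute inner_gt_zero_iff order_less_le_trans)
    then have "\<gamma> \<noteq> - ?p" by (metis inner_ge_zero inner_minus_left less_minus_iff minus_zero not_less)
    then have "\<gamma> \<bullet> coroot ?p = 1"
      using highest_root_cartan[OF g(1) False] pos root_nz[OF highest_root]
      by (auto simp: inner_coroot divide_eq_eq simp flip: power2_eq_square) (smt (verit) zero_le_power2)
    then have "2 * (\<gamma> \<bullet> ?p) = (norm ?p)\<^sup>2" using root_nz[OF highest_root] by (simp add: inner_coroot)
    moreover have "?p \<bullet> coroot \<gamma> \<in> \<int>" using cartan_int highest_root g by blast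
    ultimately have "(norm ?p)\<^sup>2 / (norm \<gamma>)\<^sup>2 \<in> \<int>" by (simp add: inner_coroot inner_commute[of _ \<gamma>])
    then have "real (m\<^sup>2) * ((norm ?p)\<^sup>2 / (norm \<gamma>)\<^sup>2) \<in> \<int>" by (intro Ints_mult Ints_of_nat)
    moreover have "real (m\<^sup>2) * ((norm ?p)\<^sup>2 / (norm \<gamma>)\<^sup>2) = 2 / (norm \<beta>)\<^sup>2"
      using m[symmetric] root_nz[OF highest_root] g(2) by simp
    ultimately show ?thesis by simp
  qed
qed

end

section \<open>The affine Weyl group\<close>

lemma weyl_linear: "v \<in> weyl_group \<Phi> \<Longrightarrow> linear v"
proof (induction rule: weyl_group.induct)
  case weyl_id
  then show ?case by (simp add: linear_iff)
next
  case (weyl_refl \<beta> v)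
  then show ?case using linear_compose linear_refl by blast
qed

lemma weyl_inner: "v \<in> weyl_group \<Phi> \<Longrightarrow> v x \<bullet> v y = x \<bullet> y"
  by (induction rule: weyl_group.induct) auto

lemma weyl_norm: "v \<in> weyl_group \<Phi> \<Longrightarrow> norm (v x) = norm x"
  by (simp add: norm_eq_sqrt_inner weyl_inner)

lemma weyl_coroot: "v \<in> weyl_group \<Phi> \<Longrightarrow> coroot (v \<beta>) = v (coroot \<beta>)"
  by (simp add: coroot_def weyl_norm linear_scale[OF weyl_linear])

lemma weyl_comp: "v \<in> weyl_group \<Phi> \<Longrightarrow> u \<in> weyl_group \<Phi> \<Longrightarrow> v \<circ> u \<in> weyl_group \<Phi>"
  by (induction rule: weyl_group.induct) (auto simp: comp_assoc intro: weyl_group.intros)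

lemma weyl_refl_mem: "\<beta> \<in> \<Phi> \<Longrightarrow> refl \<beta> \<in> weyl_group \<Phi>"
  using weyl_refl[OF _ weyl_id, of \<beta> \<Phi>] by simp

lemma weyl_inverse:
  assumes "v \<in> weyl_group \<Phi>"
  shows "\<exists>u \<in> weyl_group \<Phi>. u \<circ> v = id \<and> v \<circ> u = id"
  using assms
proof (induction rule: weyl_group.induct)
  case weyl_id
  then show ?case by (intro bexI[of _ id]) (auto intro: weyl_group.weyl_id)
next
  case (weyl_refl \<beta> v)
  then obtain u where u: "u \<in> weyl_group \<Phi>" "u \<circ> v = id" "v \<circ> u = id" by blast
  have "(u \<circ> refl \<beta>) \<circ> (refl \<beta> \<circ> v) = id" using u(2) by (auto simp: fun_eq_iff)
  moreover have "(refl \<beta> \<circ> v) \<circ> (u \<circ> refl \<beta>) = id" using u(3) by (auto simp: fun_eq_iff)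
  ultimately show ?case using weyl_comp[OF u(1) weyl_refl_mem[OF weyl_refl(1)]] by blast
qed

context root_datum
begin

lemma weyl_root: "v \<in> weyl_group \<Phi> \<Longrightarrow> \<beta> \<in> \<Phi> \<Longrightarrow> v \<beta> \<in> \<Phi>"
  by (induction rule: weyl_group.induct) (auto intro: refl_root)

lemma lattice_zero: "0 \<in> coroot_lattice \<Phi>"
  unfolding coroot_lattice_def by (rule CollectI, intro exI[of _ "\<lambda>_. 0"]) simp

lemma lattice_add: "\<mu> \<in> coroot_lattice \<Phi> \<Longrightarrow> \<nu> \<in> coroot_lattice \<Phi> \<Longrightarrow> \<mu> + \<nu> \<in> coroot_lattice \<Phi>"
proof -
  assume "\<mu> \<in> coroot_lattice \<Phi>" "\<nu> \<in> coroot_lattice \<Phi>"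
  then obtain m n where "\<mu> = (\<Sum>\<beta> \<in> \<Phi>. real_of_int (m \<beta>) *\<^sub>R coroot \<beta>)"
    "\<nu> = (\<Sum>\<beta> \<in> \<Phi>. real_of_int (n \<beta>) *\<^sub>R coroot \<beta>)"
    by (auto simp: coroot_lattice_def)
  then have "\<mu> + \<nu> = (\<Sum>\<beta> \<in> \<Phi>. real_of_int (m \<beta> + n \<beta>) *\<^sub>R coroot \<beta>)"
    by (simp add: sum.distrib scaleR_add_left)
  then show ?thesis unfolding coroot_lattice_def
    by (intro CollectI exI[where x = "\<lambda>\<beta>. m \<beta> + n \<beta>"]) simp
qed

lemma lattice_scale: "\<mu> \<in> coroot_lattice \<Phi> \<Longrightarrow> real_of_int k *\<^sub>R \<mu> \<in> coroot_lattice \<Phi>"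
proof -
  assume "\<mu> \<in> coroot_lattice \<Phi>"
  then obtain m where "\<mu> = (\<Sum>\<beta> \<in> \<Phi>. real_of_int (m \<beta>) *\<^sub>R coroot \<beta>)"
    by (auto simp: coroot_lattice_def)
  then have "real_of_int k *\<^sub>R \<mu> = (\<Sum>\<beta> \<in> \<Phi>. real_of_int (k * m \<beta>) *\<^sub>R coroot \<beta>)"
    by (simp add: scaleR_sum_right)
  then show ?thesis unfolding coroot_lattice_def
    by (intro CollectI exI[where x = "\<lambda>\<beta>. k * m \<beta>"]) simp
qed

lemma lattice_neg: "\<mu> \<in> coroot_lattice \<Phi> \<Longrightarrow> - \<mu> \<in> coroot_lattice \<Phi>"
  using lattice_scale[of \<mu> "- 1"] by simp

lemma lattice_diff: "\<mu> \<in> coroot_lattice \<Phi> \<Longrightarrow> \<nu> \<in> coroot_lattice \<Phi> \<Longrightarrow> \<mu> - \<nu> \<in> coroot_lattice \<Phi>"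
  using lattice_add[OF _ lattice_neg, of \<mu> \<nu>] by simp

lemma lattice_coroot: "\<beta> \<in> \<Phi> \<Longrightarrow> coroot \<beta> \<in> coroot_lattice \<Phi>"
proof -
  assume b: "\<beta> \<in> \<Phi>"
  have "(\<Sum>\<gamma> \<in> \<Phi>. real_of_int (if \<gamma> = \<beta> then 1 else 0) *\<^sub>R coroot \<gamma>) = coroot \<beta>"
    using b finite_roots by (simp add: if_distrib[of real_of_int] if_distrib[of
      "\<lambda>x. x *\<^sub>R _"] cong: if_cong)
  then show ?thesis unfolding coroot_lattice_def
    by (intro CollectI exI[where x = "\<lambda>\<gamma>. if \<gamma> = \<beta> then 1 else 0"]) simp
qed

lemma lattice_induct [consumes 1, case_names zero add]:
  assumes mu: "\<mu> \<in> coroot_lattice \<Phi>"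
    and zero: "P 0"
    and add: "\<And>\<mu> \<beta> k. \<mu> \<in> coroot_lattice \<Phi> \<Longrightarrow> P \<mu> \<Longrightarrow> \<beta> \<in> \<Phi> \<Longrightarrow> P (\<mu> + of_int k *\<^sub>R coroot \<beta>)"
  shows "P \<mu>"
proof -
  obtain m where m: "\<mu> = (\<Sum>\<beta> \<in> \<Phi>. real_of_int (m \<beta>) *\<^sub>R coroot \<beta>)"
    using mu by (auto simp: coroot_lattice_def)
  have "finite A \<Longrightarrow> A \<subseteq> \<Phi> \<Longrightarrow> (\<Sum>\<beta> \<in> A. real_of_int (m \<beta>) *\<^sub>R coroot \<beta>) \<in> coroot_lattice \<Phi> \<and>
      P (\<Sum>\<beta> \<in> A. real_of_int (m \<beta>) *\<^sub>R coroot \<beta>)" for A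
  proof (induction A rule: finite_induct)
    case empty
    then show ?case using zero lattice_zero by simp
  next
    case (insert \<beta> A)
    let ?s = "\<Sum>\<beta> \<in> A. real_of_int (m \<beta>) *\<^sub>R coroot \<beta>"
    have s: "?s \<in> coroot_lattice \<Phi>" "P ?s" and b: "\<beta> \<in> \<Phi>" using insert by auto
    have "?s + of_int (m \<beta>) *\<^sub>R coroot \<beta> \<in> coroot_lattice \<Phi>"
      using lattice_add[OF s(1) lattice_scale[OF lattice_coroot[OF b]]] .
    then show ?case using add[OF s b] insert(1,2) by (simp add: add.commute)
  qed
  then show ?thesis using m finite_roots by blast
qed

lemma lattice_root_int: "\<mu> \<in> coroot_lattice \<Phi> \<Longrightarrow> \<beta> \<in> \<Phi> \<Longrightarrow> \<beta> \<bullet> \<mu> \<in> \<int>"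
  by (induction rule: lattice_induct) (auto simp: inner_add_right intro!: Ints_add Ints_mult cartan_int)

lemma lattice_inner_int: "\<mu> \<in> coroot_lattice \<Phi> \<Longrightarrow> \<nu> \<in> coroot_lattice \<Phi> \<Longrightarrow> \<mu> \<bullet> \<nu> \<in> \<int>"
proof (induction rule: lattice_induct)
  case (add \<mu> \<beta> k)
  have "coroot \<beta> \<bullet> \<nu> = (2 / (norm \<beta>)\<^sup>2) * (\<beta> \<bullet> \<nu>)" by (simp add: coroot_inner)
  then have "coroot \<beta> \<bullet> \<nu> \<in> \<int>"
    using root_norm_integral add lattice_root_int by (metis Ints_mult)
  then show ?case using add by (auto simp: inner_add_left)
qed simp

lemma lattice_refl: "\<mu> \<in> coroot_lattice \<Phi> \<Longrightarrow> \<beta> \<in> \<Phi> \<Longrightarrow> refl \<beta> \<mu> \<in> coroot_lattice \<Phi>"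
  using lattice_diff[OF _ lattice_scale[OF lattice_coroot]] lattice_root_int
  by (metis Ints_cases refl_def)

lemma lattice_weyl: "v \<in> weyl_group \<Phi> \<Longrightarrow> \<mu> \<in> coroot_lattice \<Phi> \<Longrightarrow> v \<mu> \<in> coroot_lattice \<Phi>"
  by (induction rule: weyl_group.induct) (auto intro: lattice_refl)

lemma affine_weylI: "v \<in> weyl_group \<Phi> \<Longrightarrow> \<mu> \<in> coroot_lattice \<Phi> \<Longrightarrow> (\<lambda>y. v y + \<mu>) \<in> affine_weyl \<Phi>"
  by (auto simp: affine_weyl_def)

lemma affine_weylE:
  assumes "w \<in> affine_weyl \<Phi>"
  obtains v \<mu> where "v \<in> weyl_group \<Phi>" "\<mu> \<in> coroot_lattice \<Phi>" "w = (\<lambda>y. v y + \<mu>)"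
    "lin_part w = v" "w 0 = \<mu>"
proof -
  obtain v \<mu> where v: "v \<in> weyl_group \<Phi>" "\<mu> \<in> coroot_lattice \<Phi>" "w = (\<lambda>y. v y + \<mu>)"
    using assms by (auto simp: affine_weyl_def)
  then have "w 0 = \<mu>" "lin_part w = v"
    using linear_0[OF weyl_linear[OF v(1)]] by (auto simp: lin_part_def)
  then show thesis using that v by blast
qed

lemma affine_weyl_id: "id \<in> affine_weyl \<Phi>"
  using affine_weylI[OF weyl_id lattice_zero] by (simp add: id_def)

lemma affine_weyl_comp: "w \<in> affine_weyl \<Phi> \<Longrightarrow> u \<in> affine_weyl \<Phi> \<Longrightarrow> w \<circ> u \<in> affine_weyl \<Phi>"
proof -
  assume "w \<in> affine_weyl \<Phi>" "u \<in> affine_weyl \<Phi>"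
  then obtain v \<mu> v' \<mu>' where v: "v \<in> weyl_group \<Phi>" "\<mu> \<in> coroot_lattice \<Phi>" "w = (\<lambda>y. v y + \<mu>)"
    "v' \<in> weyl_group \<Phi>" "\<mu>' \<in> coroot_lattice \<Phi>" "u = (\<lambda>y. v' y + \<mu>')"
    by (auto simp: affine_weyl_def)
  have "w \<circ> u = (\<lambda>y. (v \<circ> v') y + (v \<mu>' + \<mu>))"
    using v by (auto simp: linear_add[OF weyl_linear])
  moreover have "\<dots> \<in> affine_weyl \<Phi>"
    by (rule affine_weylI[OF weyl_comp lattice_add[OF lattice_weyl]]) (use v in auto)
  ultimately show ?thesis by metis
qed

lemma affine_weyl_inverse:
  assumes "w \<in> affine_weyl \<Phi>"
  shows "\<exists>u \<in> affine_weyl \<Phi>. u \<circ> w = id \<and> w \<circ> u = id"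
proof -
  obtain v \<mu> where v: "v \<in> weyl_group \<Phi>" "\<mu> \<in> coroot_lattice \<Phi>" "w = (\<lambda>y. v y + \<mu>)"
    using assms by (auto simp: affine_weyl_def)
  obtain v' where v': "v' \<in> weyl_group \<Phi>" "v' \<circ> v = id" "v \<circ> v' = id"
    using weyl_inverse v by blast
  let ?u = "\<lambda>y. v' y + - v' \<mu>"
  have "?u \<in> affine_weyl \<Phi>" by (rule affine_weylI[OF v'(1) lattice_neg[OF lattice_weyl]]) (use v
    v' in auto)
  moreover have "?u \<circ> w = id" "w \<circ> ?u = id"
    using v v'(2,3) linear_add[OF weyl_linear[OF v'(1)]] linear_diff[OF weyl_linear[OF v(1)]]
    by (auto simp: fun_eq_iff)
  ultimately show ?thesis by blast
qed

lemma orbit_mem: "w \<in> affine_weyl \<Phi> \<Longrightarrow> y \<in> orbit \<Phi> c \<Longrightarrow> w y \<in> orbit \<Phi> c"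
proof -
  assume w: "w \<in> affine_weyl \<Phi>" and "y \<in> orbit \<Phi> c"
  then obtain u where "u \<in> affine_weyl \<Phi>" "y = u c" by (auto simp: orbit_def)
  then show ?thesis using affine_weyl_comp[OF w] unfolding orbit_def by (metis comp_apply image_eqI)
qed

lemma orbit_refl: "\<beta> \<in> \<Phi> \<Longrightarrow> y \<in> orbit \<Phi> c \<Longrightarrow> refl \<beta> y \<in> orbit \<Phi> c"
  using orbit_mem[OF affine_weylI[OF weyl_refl_mem lattice_zero]] by simp

lemma orbit_add: "\<mu> \<in> coroot_lattice \<Phi> \<Longrightarrow> y \<in> orbit \<Phi> c \<Longrightarrow> y + \<mu> \<in> orbit \<Phi> c"
  using orbit_mem[OF affine_weylI[OF weyl_id]] by simp

section \<open>Positive affine roots\<close>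

text \<open>
  The affine root \<open>\<beta> + n\<close> is positive, i.e. a nonnegative combination of the simple affine roots.
\<close>

definition pos_aff :: "'a \<Rightarrow> int \<Rightarrow> bool" where
  "pos_aff \<beta> n \<longleftrightarrow> 0 < n \<or> n = 0 \<and> nonneg_comb r \<alpha> \<beta>"

text \<open>The reflection in the zero set of the affine root \<open>\<beta> + n\<close>.\<close>

definition aff_refl :: "'a \<Rightarrow> int \<Rightarrow> 'a \<Rightarrow> 'a" where
  "aff_refl \<beta> n y = y - (\<beta> \<bullet> y + of_int n) *\<^sub>R coroot \<beta>"

text \<open>The constant term of the simple affine root \<open>\<alpha>\<^sub>j\<close>.\<close>

definition shift :: "nat \<Rightarrow> int" where
  "shift j = (if j = 0 then 1 else 0)"

lemma shift_simps [simp]: "shift 0 = 1" "j \<noteq> 0 \<Longrightarrow> shift j = 0" by (auto simp: shift_def)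

lemma grad_root: "j \<in> {0..r} \<Longrightarrow> grad j \<in> \<Phi>"
  by (auto simp: grad_def intro: root_neg highest_root simple_root)

lemma aff_root_eq: "aff_root j y = grad j \<bullet> y + of_int (shift j)"
  by (simp add: aff_root_def shift_def)

lemma simple_refl_eq: "simple_refl j y = y - aff_root j y *\<^sub>R coroot (grad j)"
  by (simp add: simple_refl_def aff_root_def grad_def refl_def algebra_simps)

lemma simple_refl_eq_refl: "simple_refl j y = refl (grad j) y - of_int (shift j) *\<^sub>R coroot (grad j)"
  by (simp add: simple_refl_eq aff_root_eq refl_def algebra_simps)

lemma simple_refl_is_aff_refl: "simple_refl j = aff_refl (grad j) (shift j)"
  by (rule ext) (simp add: simple_refl_eq aff_root_eq aff_refl_def)

lemma aff_root_simple_refl: "j \<in> {0..r} \<Longrightarrow> aff_root j (simple_refl j y) = - aff_root j y"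
  using self_inner_coroot[OF root_nz[OF grad_root]]
  by (simp add: simple_refl_eq aff_root_eq inner_diff_right)

lemma simple_refl_simple_refl: "j \<in> {0..r} \<Longrightarrow> simple_refl j (simple_refl j y) = y"
  using aff_root_simple_refl by (simp add: simple_refl_eq[of j
    "simple_refl j y"]) (simp add: simple_refl_eq)

lemma simple_refl_affine: "j \<in> {0..r} \<Longrightarrow> simple_refl j \<in> affine_weyl \<Phi>"
proof -
  assume j: "j \<in> {0..r}"
  have "simple_refl j = (\<lambda>y. refl (grad j) y + - (of_int (shift j) *\<^sub>R coroot (grad j)))"
    by (rule ext) (simp add: simple_refl_eq_refl)
  moreover have "\<dots> \<in> affine_weyl \<Phi>"
    by (rule affine_weylI[OF weyl_refl_mem lattice_neg[OF lattice_scale[OF lattice_coroot]]])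
       (use grad_root j in auto)
  ultimately show ?thesis by metis
qed

lemma root_highest_comb: "\<beta> \<in> \<Phi> \<Longrightarrow> 0 < n \<Longrightarrow> nonneg_comb r \<alpha> (of_int n *\<^sub>R highest_root + \<beta>)"
proof -
  assume b: "\<beta> \<in> \<Phi>" and n: "0 < n"
  have "nonneg_comb r \<alpha> (highest_root + \<beta>)"
    using highest_root_above[OF root_neg[OF b]] by simp
  moreover have "nonneg_comb r \<alpha> (real m *\<^sub>R highest_root)" for m
    by (induction m) (auto simp: nonneg_comb_zero algebra_simps intro: nonneg_comb_add highest_root_pos)
  ultimately have "nonneg_comb r \<alpha> (real (nat (n - 1)) *\<^sub>R highest_root + (highest_root + \<beta>))"
    using nonneg_comb_add by blast
  moreover have "real (nat (n - 1)) *\<^sub>R highest_root + (highest_root + \<beta>) = of_int n *\<^sub>R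
    highest_root + \<beta>"
    using n by (simp add: algebra_simps)
  ultimately show ?thesis by simp
qed

lemma pos_aff_comb: "\<beta> \<in> \<Phi> \<Longrightarrow> pos_aff \<beta> n \<Longrightarrow> nonneg_comb r \<alpha> (of_int n *\<^sub>R highest_root + \<beta>)"
  using root_highest_comb by (auto simp: pos_aff_def)

lemma pos_aff_or_neg: "\<beta> \<in> \<Phi> \<Longrightarrow> pos_aff \<beta> n \<or> pos_aff (- \<beta>) (- n)"
  using pos_or_neg[of \<beta>] by (auto simp: pos_aff_def)

lemma pos_aff_simple: "j \<in> {0..r} \<Longrightarrow> pos_aff (grad j) (shift j)"
  by (cases "j = 0") (auto simp: pos_aff_def grad_def intro: simple_pos)

text \<open>The simple reflection \<open>s\<^sub>j\<close> permutes the positive affine roots other than \<open>\<alpha>\<^sub>j\<close>.\<close>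

lemma simple_refl_pos_aff:
  assumes b: "\<beta> \<in> \<Phi>" "pos_aff \<beta> n" and j: "j \<in> {0..r}"
    and ne: "\<not> (\<beta> = grad j \<and> n = shift j)" and m: "\<beta> \<bullet> coroot (grad j) = of_int m"
  shows "pos_aff (refl (grad j) \<beta>) (n - shift j * m)"
proof (cases "j = 0")
  case False
  then show ?thesis using b simple_refl_pos[of \<beta> j] ne j by (auto simp: pos_aff_def grad_def)
next
  case True
  let ?p = highest_root
  have g: "grad j = - ?p" using True by (simp add: grad_def)
  have k: "\<beta> \<bullet> coroot ?p = - of_int m" using m g by simp
  have r: "refl (grad j) \<beta> = \<beta> + of_int m *\<^sub>R ?p"
    using k g by (simp add: refl_eq inner_coroot inner_commute)
  have pp: "?p \<bullet> coroot ?p = 2" using self_inner_coroot root_nz highest_root by blast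
  have nn: "0 \<le> n" using b by (auto simp: pos_aff_def)
  consider "\<beta> = ?p" | "\<beta> = - ?p" | "\<beta> \<bullet> coroot ?p \<in> {-1, 0, 1}"
    using highest_root_cartan b by blast
  then show ?thesis
  proof cases
    case 1
    then have "m = - 2" using k pp by simp
    then show ?thesis using nn True by (simp add: pos_aff_def)
  next
    case 2
    then have m2: "m = 2" using k pp by simp
    have "n \<noteq> 0" using b(2) not_pos_neg[OF highest_root highest_root_pos] 2 by (auto simp: pos_aff_def)
    moreover have "n \<noteq> 1" using ne 2 g True by auto
    ultimately have "n = 2 \<or> 2 < n" using nn by linarith
    then show ?thesis using m2 True 2 highest_root_pos g by (auto simp: pos_aff_def refl_neg)
  next
    case 3
    then have "m = - 1 \<or> m = 0 \<or> m = 1" using k by auto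
    then show ?thesis
    proof (elim disjE)
      assume "m = - 1"
      then show ?thesis using nn True by (simp add: pos_aff_def)
    next
      assume "m = 0"
      then show ?thesis using r True b by simp
    next
      assume m1: "m = 1"
      have "n \<noteq> 0"
      proof
        assume "n = 0"
        then have "0 \<le> ?p \<bullet> \<beta>" using b highest_root_inner_pos by (auto simp: pos_aff_def)
        then have "0 \<le> \<beta> \<bullet> coroot ?p" by (simp add: inner_coroot inner_commute)
        then show False using k m1 by simp
      qed
      then have "n = 1 \<or> 1 < n" using nn by linarith
      moreover have "nonneg_comb r \<alpha> (\<beta> + ?p)"
        using highest_root_above[OF root_neg[OF b(1)]] by (simp add: add.commute)
      ultimately show ?thesis using True m1 r by (auto simp: pos_aff_def)
    qed
  qed
qed

lemma alcove_simple_nonneg: "y \<in> alcove \<Longrightarrow> j \<in> {0..r} \<Longrightarrow> 0 \<le> aff_root j y"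
  using highest_root highest_root_pos simple_root simple_pos
  by (cases "j = 0") (auto simp: alcove_def pos_roots_def aff_root_def grad_def)

lemma alcove_pos_aff_nonneg:
  assumes y: "y \<in> alcove" and b: "\<beta> \<in> \<Phi>" "pos_aff \<beta> n"
  shows "0 \<le> \<beta> \<bullet> y + of_int n"
proof -
  have "0 \<le> \<beta> \<bullet> y \<and> \<beta> \<bullet> y \<le> 1" if "nonneg_comb r \<alpha> \<beta>"
    using that b y by (auto simp: alcove_def pos_roots_def)
  moreover have "0 \<le> - \<beta> \<bullet> y \<and> - \<beta> \<bullet> y \<le> 1" if "nonneg_comb r \<alpha> (- \<beta>)"
    using that root_neg[OF b(1)] y unfolding alcove_def pos_roots_def by blast
  moreover have "n = 0 \<and> nonneg_comb r \<alpha> \<beta> \<or> 1 \<le> n" using b(2) by (auto simp: pos_aff_def)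
  ultimately show ?thesis using pos_or_neg[OF b(1)] by fastforce
qed

text \<open>
  Induction over the positive affine roots: a positive affine root that is not simple is made
  smaller, but stays positive, under some simple reflection \<open>s\<^sub>j\<close> such that \<open>\<alpha>\<^sub>j\<close> occurs in it. In
  particular \<open>\<alpha>\<^sub>j\<close> vanishes wherever the affine root vanishes in the closed fundamental alcove.
\<close>

lemma pos_aff_induct [consumes 2, case_names simple step]:
  assumes "\<beta> \<in> \<Phi>" "pos_aff \<beta> n"
    and simple: "\<And>j. j \<in> {0..r} \<Longrightarrow> P (grad j) (shift j)"
    and step: "\<And>\<beta> n j m. \<beta> \<in> \<Phi> \<Longrightarrow> pos_aff \<beta> n \<Longrightarrow> j \<in> {0..r} \<Longrightarrow>
       \<beta> \<bullet> coroot (grad j) = of_int m \<Longrightarrow>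
       (\<And>y. y \<in> alcove \<Longrightarrow> \<beta> \<bullet> y + of_int n = 0 \<Longrightarrow> aff_root j y = 0) \<Longrightarrow>
       P (refl (grad j) \<beta>) (n - shift j * m) \<Longrightarrow> P \<beta> n"
  shows "P \<beta> n"
  using assms(1,2)
proof (induction "nat \<lfloor>of_int n * (1 + ht highest_root) + ht \<beta>\<rfloor>" arbitrary: \<beta> n rule: less_induct)
  case less
  let ?p = highest_root
  let ?v = "of_int n *\<^sub>R ?p + \<beta>"
  \<comment> \<open>The coefficients of the affine root in terms of the simple affine roots. In \<open>val\<close> below, \<open>e = 1\<close>
    evaluates the affine root and \<open>e = 0\<close> its gradient.\<close>
  define c where "c j = (if j = 0 then of_int n else cf j ?v)" for j
  have comb: "nonneg_comb r \<alpha> ?v" using pos_aff_comb less.prems by blast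
  have c0: "0 \<le> c j" if "j \<in> {0..r}" for j
    using that nonneg_comb_cf[OF comb] less.prems(2) by (auto simp: c_def pos_aff_def)
  have vc: "?v = (\<Sum>i = 1..r. cf i ?v *\<^sub>R \<alpha> i)" using comb nonneg_comb_iff by blast
  have val: "\<beta> \<bullet> y + of_int n * e = (\<Sum>j = 0..r. c j * (grad j \<bullet> y + of_int (shift j) * e))"
    for y and e :: real
  proof -
    have "(\<Sum>j = 0..r. c j * (grad j \<bullet> y + of_int (shift j) * e)) =
        of_int n * (e - ?p \<bullet> y) + (\<Sum>i = 1..r. cf i ?v * (\<alpha> i \<bullet> y))"
      by (simp add: sum.atLeast_Suc_atMost[of 0] c_def grad_def One_nat_def[symmetric])
    then show ?thesis using inner_comb[OF vc, of y] by (simp add: inner_add_left algebra_simps)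
  qed
  show ?case
  proof (cases "\<exists>j \<in> {0..r}. \<beta> = grad j \<and> n = shift j")
    case True
    then show ?thesis using simple by blast
  next
    case False
    have "\<exists>j \<in> {0..r}. 0 < c j \<and> 0 < grad j \<bullet> \<beta>"
    proof (rule ccontr)
      assume neg: "\<not> ?thesis"
      have "(\<Sum>j = 0..r. c j * (grad j \<bullet> \<beta>)) \<le> 0"
      proof (rule sum_nonpos)
        fix j assume "j \<in> {0..r}"
        then show "c j * (grad j \<bullet> \<beta>) \<le> 0"
          using neg c0[of j] by (cases "0 < c j") (force simp: mult_nonneg_nonpos not_less)+
      qed
      then have "\<beta> \<bullet> \<beta> \<le> 0" using val[of \<beta> 0] by simp
      then show False using root_nz[OF less.prems(1)] by (metis inner_gt_zero_iff not_less)
    qed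
    then obtain j where j: "j \<in> {0..r}" "0 < c j" "0 < grad j \<bullet> \<beta>" by blast
    have g: "grad j \<in> \<Phi>" using grad_root j by blast
    obtain m :: int where m: "0 < m" "\<beta> \<bullet> coroot (grad j) = of_int m"
      using cartan_pos_int[OF less.prems(1) g] j by (auto simp: inner_commute)
    have rt: "refl (grad j) \<beta> \<in> \<Phi>" using refl_root g less.prems by blast
    have p: "pos_aff (refl (grad j) \<beta>) (n - shift j * m)"
      using simple_refl_pos_aff[OF less.prems j(1) _ m(2)] False j by blast
    have pos_ht: "0 < of_int k * (1 + ht ?p) + ht \<gamma>" if "\<gamma> \<in> \<Phi>" "pos_aff \<gamma> k" for \<gamma> k
    proof -
      have "0 \<le> ht (of_int k *\<^sub>R ?p + \<gamma>)"
        using nonneg_comb_ht[OF pos_aff_comb[OF that]] by (auto elim: Nats_cases)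
      then have "0 \<le> of_int k * ht ?p + ht \<gamma>" by (simp add: ht_add ht_scale)
      moreover have "0 < k \<or> k = 0 \<and> 0 < ht \<gamma>" using that ht_pos_root by (auto simp: pos_aff_def)
      ultimately show ?thesis by (auto simp: algebra_simps)
    qed
    have rb: "refl (grad j) \<beta> = \<beta> - of_int m *\<^sub>R grad j"
      using m(2) by (simp add: refl_eq inner_coroot inner_commute)
    have "of_int (n - shift j * m) * (1 + ht ?p) + ht (refl (grad j) \<beta>) =
        of_int n * (1 + ht ?p) + ht \<beta> - of_int m"
    proof (cases "j = 0")
      case True
      then show ?thesis using rb by (simp add: grad_def ht_add ht_diff ht_scale ht_neg algebra_simps)
    next
      case False
      then have "ht (grad j) = 1" using j ht_simple[of j] by (simp add: grad_def)
      then show ?thesis using rb False by (simp add: ht_diff ht_scale)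
    qed
    then have lt: "nat \<lfloor>of_int (n - shift j * m) * (1 + ht ?p) + ht (refl (grad j) \<beta>)\<rfloor> <
        nat \<lfloor>of_int n * (1 + ht ?p) + ht \<beta>\<rfloor>"
      using m(1) pos_ht[OF rt p] by linarith
    have "aff_root j y = 0" if y: "y \<in> alcove" and z: "\<beta> \<bullet> y + of_int n = 0" for y
    proof -
      have "(\<Sum>j = 0..r. c j * aff_root j y) = 0" using val[of y 1] z by (simp add: aff_root_eq)
      then have "c j * aff_root j y = 0"
        using sum_nonneg_eq_0_iff[of "{0..r}" "\<lambda>j. c j * aff_root j y"] c0 alcove_simple_nonneg[OF
          y] j(1)
        by (metis (no_types, lifting) finite_atLeastAtMost mult_nonneg_nonneg)
      then show ?thesis using j by simp
    qed
    then show ?thesis using less.hyps[OF lt rt p] step[OF less.prems j(1) m(2)] by blast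
  qed
qed

section \<open>Words in the simple affine reflections\<close>

lemma word_prod_simps [simp]:
  "word_prod [] = id" "word_prod (j # js) = simple_refl j \<circ> word_prod js"
  by (simp_all add: word_prod_def)

lemma word_prod_append: "word_prod (js @ ks) = word_prod js \<circ> word_prod ks"
  by (induction js) (auto simp: comp_assoc)

lemma word_prod_affine: "set js \<subseteq> {0..r} \<Longrightarrow> word_prod js \<in> affine_weyl \<Phi>"
  by (induction js) (auto intro!: affine_weyl_id affine_weyl_comp simple_refl_affine)

text \<open>
  The group generated by the simple affine reflections; it turns out to be the whole affine Weyl
  group.
\<close>

definition words :: "('a \<Rightarrow> 'a) set" where
  "words = word_prod ` {js. set js \<subseteq> {0..r}}"

lemma words_comp: "w \<in> words \<Longrightarrow> u \<in> words \<Longrightarrow> w \<circ> u \<in> words"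
  unfolding words_def using word_prod_append
  by (smt (verit) Un_subset_iff image_iff mem_Collect_eq set_append)

lemma words_id: "id \<in> words"
  unfolding words_def by (rule image_eqI[of _ _ "[]"]) auto

lemma words_simple: "j \<in> {0..r} \<Longrightarrow> simple_refl j \<in> words"
  unfolding words_def by (rule image_eqI[of _ _ "[j]"]) auto

lemma aff_refl_conj:
  assumes j: "j \<in> {0..r}" and m: "\<beta> \<bullet> coroot (grad j) = of_int m"
  shows "simple_refl j \<circ> aff_refl (refl (grad j) \<beta>) (n - shift j * m) \<circ> simple_refl j = aff_refl \<beta> n"
proof
  fix y
  let ?g = "grad j"
  have v: "refl ?g \<beta> \<bullet> simple_refl j y + of_int (n - shift j * m) = \<beta> \<bullet> y + of_int n"
  proof -
    have "refl ?g \<beta> \<bullet> coroot ?g = - of_int m" using m by (simp add: inner_refl_left)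
    then show ?thesis by (simp add: simple_refl_eq_refl inner_diff_right)
  qed
  have lin: "simple_refl j (a - x *\<^sub>R b) = simple_refl j a - x *\<^sub>R refl ?g b" for a b x
    by (simp add: simple_refl_eq_refl refl_diff refl_scale)
  have "(simple_refl j \<circ> aff_refl (refl ?g \<beta>) (n - shift j * m) \<circ> simple_refl j) y =
      simple_refl j (simple_refl j y - (\<beta> \<bullet> y + of_int n) *\<^sub>R coroot (refl ?g \<beta>))"
    by (simp only: comp_apply aff_refl_def v)
  also have "\<dots> = aff_refl \<beta> n y"
    by (simp add: lin coroot_refl simple_refl_simple_refl[OF j] aff_refl_def)
  finally show "(simple_refl j \<circ> aff_refl (refl ?g \<beta>) (n - shift j * m) \<circ> simple_refl j) y =
      aff_refl \<beta> n y" .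
qed

lemma aff_refl_minus: "aff_refl (- \<beta>) (- n) = aff_refl \<beta> n"
  by (rule ext) (simp add: aff_refl_def algebra_simps)

lemma aff_refl_words: "\<beta> \<in> \<Phi> \<Longrightarrow> aff_refl \<beta> n \<in> words"
proof -
  have pos: "aff_refl \<beta> n \<in> words" if "\<beta> \<in> \<Phi>" "pos_aff \<beta> n" for \<beta> n
    using that
  proof (induction rule: pos_aff_induct)
    case (simple j)
    then show ?case using words_simple simple_refl_is_aff_refl by metis
  next
    case (step \<beta> n j m)
    then show ?case using aff_refl_conj[OF step(3,4), of n] words_comp words_simple by metis
  qed
  assume "\<beta> \<in> \<Phi>"
  then show ?thesis using pos pos_aff_or_neg root_neg aff_refl_minus by metis
qed

lemma affine_weyl_words: "w \<in> affine_weyl \<Phi> \<Longrightarrow> w \<in> words"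
proof -
  have lin: "v \<in> words" if "v \<in> weyl_group \<Phi>" for v
    using that
  proof (induction rule: weyl_group.induct)
    case (weyl_refl \<beta> v)
    have "refl \<beta> = aff_refl \<beta> 0" by (rule ext) (simp add: refl_def aff_refl_def)
    then show ?case using weyl_refl aff_refl_words words_comp by metis
  qed (rule words_id)
  have tr1: "(\<lambda>y. y + coroot \<beta>) \<in> words" if b: "\<beta> \<in> \<Phi>" for \<beta>
  proof -
    have "(\<lambda>y. y + coroot \<beta>) = aff_refl \<beta> (- 1) \<circ> aff_refl \<beta> 0"
      using self_inner_coroot[OF root_nz[OF b]]
      by (auto simp: fun_eq_iff aff_refl_def inner_diff_right algebra_simps)
    then show ?thesis using aff_refl_words b words_comp by metis
  qed
  have tr2: "(\<lambda>y. y + real n *\<^sub>R coroot \<beta>) \<in> words" if b: "\<beta> \<in> \<Phi>" for \<beta> n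
  proof (induction n)
    case 0
    then show ?case using words_id by (simp add: id_def)
  next
    case (Suc n)
    have "(\<lambda>y. y + real (Suc n) *\<^sub>R coroot \<beta>) = (\<lambda>y. y + coroot \<beta>) \<circ> (\<lambda>y. y + real n *\<^sub>R coroot \<beta>)"
      by (auto simp: fun_eq_iff algebra_simps)
    then show ?case using Suc tr1 b words_comp by metis
  qed
  have tr3: "(\<lambda>y. y + of_int n *\<^sub>R coroot \<beta>) \<in> words" if b: "\<beta> \<in> \<Phi>" for \<beta> n
    using tr2[OF b, of "nat n"] tr2[OF root_neg[OF b], of "nat (- n)"] by (cases "0 \<le> n") auto
  have tr: "(\<lambda>y. y + \<mu>) \<in> words" if "\<mu> \<in> coroot_lattice \<Phi>" for \<mu>
    using that
  proof (induction rule: lattice_induct)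
    case zero
    then show ?case using words_id by (simp add: id_def)
  next
    case (add \<mu> \<beta> k)
    have "(\<lambda>y. y + (\<mu> + of_int k *\<^sub>R coroot \<beta>)) = (\<lambda>y. y + of_int k *\<^sub>R coroot \<beta>) \<circ> (\<lambda>y. y + \<mu>)"
      by (auto simp: fun_eq_iff)
    then show ?case using add tr3 words_comp by metis
  qed
  assume "w \<in> affine_weyl \<Phi>"
  then obtain v \<mu> where v: "v \<in> weyl_group \<Phi>" "\<mu> \<in> coroot_lattice \<Phi>" "w = (\<lambda>y. v y + \<mu>)"
    by (auto simp: affine_weyl_def)
  then have "w = (\<lambda>y. y + \<mu>) \<circ> v" by auto
  then show ?thesis using words_comp tr lin v by metis
qed

lemma affine_conj_simple:
  assumes p: "p \<in> affine_weyl \<Phi>" and jl: "j \<in> {0..r}" "l \<in> {0..r}"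
    and eq: "\<And>y. aff_root j (p y) = aff_root l y"
  shows "simple_refl j \<circ> p = p \<circ> simple_refl l"
proof
  fix y
  obtain v \<mu> where v: "v \<in> weyl_group \<Phi>" "p = (\<lambda>y. v y + \<mu>)"
    using affine_weylE[OF p] by metis
  have e: "grad j \<bullet> v y = grad l \<bullet> y" for y
  proof -
    have "aff_root j (p y) - aff_root j (p 0) = aff_root l y - aff_root l 0" using eq by simp
    then show ?thesis using v linear_0[OF weyl_linear[OF v(1)]]
      by (simp add: aff_root_eq inner_add_right)
  qed
  have "grad j = v (grad l)"
  proof -
    obtain u where u: "v \<circ> u = id" using weyl_inverse v by blast
    have "(grad j - v (grad l)) \<bullet> v y = 0" for y
      using e weyl_inner[OF v(1)] by (simp add: inner_diff_left)
    then have "(grad j - v (grad l)) \<bullet> (grad j - v (grad l)) = 0"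
      using u by (metis comp_apply id_apply)
    then show ?thesis by simp
  qed
  then have c: "coroot (grad j) = v (coroot (grad l))" using weyl_coroot v by metis
  show "(simple_refl j \<circ> p) y = (p \<circ> simple_refl l) y"
    using v c linear_diff[OF weyl_linear[OF v(1)]] linear_scale[OF weyl_linear[OF v(1)]] eq[of y]
    by (simp add: simple_refl_eq)
qed

text \<open>The exchange condition, phrased through the sign of an affine root along the word.\<close>

lemma exchange:
  assumes "set js \<subseteq> {0..r}" and j: "j \<in> {0..r}"
  shows "(\<exists>\<beta> n. \<beta> \<in> \<Phi> \<and> pos_aff \<beta> n \<and> (\<forall>y. aff_root j (word_prod js y) = \<beta> \<bullet> y + of_int n)) \<or>
    (\<exists>ks. set ks \<subseteq> {0..r} \<and> length ks < length js \<and> simple_refl j \<circ> word_prod js = word_prod ks)"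
  using assms(1)
proof (induction js rule: rev_induct)
  case Nil
  have "\<forall>y. aff_root j (word_prod [] y) = grad j \<bullet> y + of_int (shift j)"
    by (simp add: aff_root_eq)
  then show ?case using pos_aff_simple[OF j] grad_root[OF j] by blast
next
  case (snoc l js)
  have l: "l \<in> {0..r}" and js: "set js \<subseteq> {0..r}" using snoc.prems by auto
  from snoc.IH[OF js] show ?case
  proof
    assume "\<exists>ks. set ks \<subseteq> {0..r} \<and> length ks < length js \<and> simple_refl j \<circ> word_prod js = word_prod ks"
    then obtain ks where ks: "set ks \<subseteq> {0..r}" "length ks < length js"
      "simple_refl j \<circ> word_prod js = word_prod ks" by blast
    have "simple_refl j \<circ> word_prod (js @ [l]) = word_prod (ks @ [l])"
      using ks(3) by (simp only: word_prod_append flip: comp_assoc)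
    then show ?thesis using ks l by (intro disjI2 exI[of _ "ks @ [l]"]) simp
  next
    assume "\<exists>\<beta> n. \<beta> \<in> \<Phi> \<and> pos_aff \<beta> n \<and> (\<forall>y. aff_root j (word_prod js y) = \<beta> \<bullet> y + of_int n)"
    then obtain \<beta> n where b: "\<beta> \<in> \<Phi>" "pos_aff \<beta> n"
      "\<And>y. aff_root j (word_prod js y) = \<beta> \<bullet> y + of_int n" by blast
    show ?thesis
    proof (cases "\<beta> = grad l \<and> n = shift l")
      case True
      have "simple_refl j \<circ> word_prod js = word_prod js \<circ> simple_refl l"
        by (rule affine_conj_simple[OF word_prod_affine[OF js] j l]) (use True b(3) in \<open>simp add:
          aff_root_eq\<close>)
      then have "simple_refl j \<circ> word_prod (js @ [l]) = word_prod js"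
        by (simp add: word_prod_append fun_eq_iff simple_refl_simple_refl[OF l])
      then show ?thesis using js by (intro disjI2 exI[of _ js]) simp
    next
      case False
      obtain m where m: "\<beta> \<bullet> coroot (grad l) = of_int m"
        using cartan_int[OF b(1) grad_root[OF l]] Ints_cases by metis
      have "refl (grad l) \<beta> \<bullet> y + of_int (n - shift l * m) = \<beta> \<bullet> simple_refl l y + of_int n" for y
        using m by (simp add: simple_refl_eq_refl inner_diff_right inner_refl_left)
      then have "aff_root j (word_prod (js @ [l]) y) = refl (grad l) \<beta> \<bullet> y + of_int (n - shift l *
        m)" for y
        using b(3) by (simp add: word_prod_append)
      then show ?thesis
        using simple_refl_pos_aff[OF b(1,2) l False m] refl_root[OF grad_root[OF l] b(1)] by blast
    qed
  qed
qed

text \<open>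
  The closed fundamental alcove is a strict fundamental domain, and stabilisers of its points are
  generated by the simple reflections they contain.
\<close>

lemma word_alcove:
  assumes "set js \<subseteq> {0..r}" "c \<in> alcove" "word_prod js c \<in> alcove"
  shows "word_prod js c = c \<and>
    (\<exists>ks. set ks \<subseteq> {j \<in> {0..r}. aff_root j c = 0} \<and> word_prod ks = word_prod js)"
  using assms
proof (induction "length js" arbitrary: js rule: less_induct)
  case less
  show ?case
  proof (cases js)
    case Nil
    then show ?thesis by (intro conjI exI[of _ "[]"]) auto
  next
    case (Cons j is')
    have j: "j \<in> {0..r}" and iss: "set is' \<subseteq> {0..r}" using less.prems Cons by auto
    from exchange[OF iss j] show ?thesis
    proof
      assume "\<exists>ks. set ks \<subseteq> {0..r} \<and> length ks < length is' \<and>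
        simple_refl j \<circ> word_prod is' = word_prod ks"
      then obtain ks where ks: "set ks \<subseteq> {0..r}" "length ks < length js"
        "word_prod js = word_prod ks" using Cons by auto
      then show ?thesis using less.hyps[of ks] less.prems by simp
    next
      assume "\<exists>\<beta> n. \<beta> \<in> \<Phi> \<and> pos_aff \<beta> n \<and> (\<forall>y. aff_root j (word_prod is' y) = \<beta> \<bullet> y + of_int n)"
      then have "0 \<le> aff_root j (word_prod is' c)"
        using alcove_pos_aff_nonneg less.prems(2) by metis
      moreover have e: "word_prod js c = simple_refl j (word_prod is' c)" using Cons by simp
      then have "aff_root j (word_prod js c) = - aff_root j (word_prod is' c)"
        using aff_root_simple_refl[OF j] by simp
      ultimately have z: "aff_root j (word_prod is' c) = 0" "aff_root j (word_prod js c) = 0"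
        using alcove_simple_nonneg[OF less.prems(3) j] by linarith+
      then have e': "word_prod js c = word_prod is' c" using e by (simp add: simple_refl_eq)
      then obtain ks where ks: "word_prod is' c = c" "set ks \<subseteq> {j \<in> {0..r}. aff_root j c = 0}"
        "word_prod ks = word_prod is'"
        using less.hyps[of "is'"] less.prems iss Cons by auto
      then have "set (j # ks) \<subseteq> {j \<in> {0..r}. aff_root j c = 0}" using z j by simp
      moreover have "word_prod (j # ks) = word_prod js" using ks Cons by simp
      ultimately show ?thesis using ks(1) e' by metis
    qed
  qed
qed

lemma affine_stabilizer:
  assumes "w \<in> affine_weyl \<Phi>" "c \<in> alcove" "w c = c"
  shows "\<exists>ks. set ks \<subseteq> {j \<in> {0..r}. aff_root j c = 0} \<and> word_prod ks = w"
  using affine_weyl_words[OF assms(1)] word_alcove[OF _ assms(2)] assms(2,3)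
  by (auto simp: words_def)

end

section \<open>The twisting characters\<close>

lemma ipow_of_int [simp]: "ipow a (of_int n) = a powi n"
  by (simp add: ipow_def)

lemma ipow_zero [simp]: "ipow a 0 = 1"
  by (simp add: ipow_def)

lemma ipow_add: "a \<noteq> 0 \<Longrightarrow> x \<in> \<int> \<Longrightarrow> y \<in> \<int> \<Longrightarrow> ipow a (x + y) = ipow a x * ipow a y"
  by (elim Ints_cases) (simp add: power_int_add flip: of_int_add)

lemma ipow_nonzero: "a \<noteq> 0 \<Longrightarrow> ipow a x \<noteq> 0"
  by (simp add: ipow_def)

context daha_datum
begin

lemma q_root_nonzero: "q_root \<beta> \<noteq> 0"
  by (simp add: q_root_def ipow_nonzero q_nonzero)

lemma q_root_powi: "\<beta> \<in> \<Phi> \<Longrightarrow> q_root \<beta> powi n = ipow q (of_int n * (2 / (norm \<beta>)\<^sup>2))"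
proof -
  assume "\<beta> \<in> \<Phi>"
  then obtain m where "2 / (norm \<beta>)\<^sup>2 = of_int m" using root_norm_integral Ints_cases by metis
  then show ?thesis by (simp add: q_root_def mult.commute power_int_mult flip: of_int_mult)
qed

lemma torus_nonzero: "t \<in> torus \<Longrightarrow> \<mu> \<in> coroot_lattice \<Phi> \<Longrightarrow> t \<mu> \<noteq> 0"
  by (simp add: torus_def)

lemma torus_add: "t \<in> torus \<Longrightarrow> \<mu> \<in> coroot_lattice \<Phi> \<Longrightarrow> \<nu> \<in> coroot_lattice \<Phi> \<Longrightarrow> t (\<mu> + \<nu>) = t \<mu> * t \<nu>"
  by (simp add: torus_def)

lemma torus_zero: "t \<in> torus \<Longrightarrow> t 0 = 1"
  using torus_add[OF _ lattice_zero lattice_zero] torus_nonzero[OF _ lattice_zero] by force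

lemma torus_minus: "t \<in> torus \<Longrightarrow> \<mu> \<in> coroot_lattice \<Phi> \<Longrightarrow> t (- \<mu>) = inverse (t \<mu>)"
  using torus_add[OF _ _ lattice_neg, of t \<mu> \<mu>] torus_zero
  by (metis add.right_inverse inverse_unique)

lemma torus_scale: "t \<in> torus \<Longrightarrow> \<mu> \<in> coroot_lattice \<Phi> \<Longrightarrow> t (of_int n *\<^sub>R \<mu>) = t \<mu> powi n"
proof -
  assume t: "t \<in> torus" and mu: "\<mu> \<in> coroot_lattice \<Phi>"
  have nat: "t (real m *\<^sub>R \<mu>) = t \<mu> ^ m" for m
  proof (induction m)
    case (Suc m)
    have "real (Suc m) *\<^sub>R \<mu> = \<mu> + of_int (int m) *\<^sub>R \<mu>" by (simp add: algebra_simps)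
    then have "t (real (Suc m) *\<^sub>R \<mu>) = t \<mu> * t (of_int (int m) *\<^sub>R \<mu>)"
      using torus_add[OF t mu lattice_scale[OF mu]] by metis
    then show ?case using Suc by simp
  qed (simp add: torus_zero[OF t])
  show ?thesis
  proof (cases "0 \<le> n")
    case True
    then show ?thesis using nat[of "nat n"] by (simp add: power_int_def)
  next
    case False
    then have "of_int n *\<^sub>R \<mu> = - (real (nat (- n)) *\<^sub>R \<mu>)" by simp
    then have "t (of_int n *\<^sub>R \<mu>) = inverse (t \<mu> ^ nat (- n))"
      using torus_minus[OF t lattice_scale[OF mu, of "int (nat (- n))"]] nat
      by (metis of_int_of_nat_eq)
    then show ?thesis using False by (simp add: power_int_def power_inverse)
  qed
qed

lemma act_torus_eq:
  assumes "v \<in> weyl_group \<Phi>" "u \<circ> v = id" "v \<circ> u = id"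
  shows "act_torus (\<lambda>y. v y + \<nu>) t \<mu> = ipow q (\<nu> \<bullet> \<mu>) * t (u \<mu>)"
proof -
  have "lin_part (\<lambda>y. v y + \<nu>) = v" and "v 0 = 0"
    using linear_0[OF weyl_linear[OF assms(1)]] by (auto simp: lin_part_def)
  moreover have "inv_into UNIV v = u" using assms(2,3) by (metis inv_unique_comp)
  ultimately show ?thesis by (simp add: act_torus_def)
qed

lemma act_torus_cong:
  assumes w: "w \<in> affine_weyl \<Phi>" and mu: "\<mu> \<in> coroot_lattice \<Phi>"
    and eq: "\<And>\<mu>. \<mu> \<in> coroot_lattice \<Phi> \<Longrightarrow> t \<mu> = t' \<mu>"
  shows "act_torus w t \<mu> = act_torus w t' \<mu>"
proof -
  obtain v \<nu> where v: "v \<in> weyl_group \<Phi>" "w = (\<lambda>y. v y + \<nu>)" using affine_weylE[OF w] by metis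
  obtain u where u: "u \<in> weyl_group \<Phi>" "u \<circ> v = id" "v \<circ> u = id" using weyl_inverse v by blast
  show ?thesis using eq[OF lattice_weyl[OF u(1) mu]] by (simp add: v act_torus_eq[OF v(1) u(2,3)])
qed

lemma act_torus_comp:
  assumes w: "w \<in> affine_weyl \<Phi>" "w' \<in> affine_weyl \<Phi>" and mu: "\<mu> \<in> coroot_lattice \<Phi>"
  shows "act_torus (w \<circ> w') t \<mu> = act_torus w (act_torus w' t) \<mu>"
proof -
  obtain v \<nu> where v: "v \<in> weyl_group \<Phi>" "\<nu> \<in> coroot_lattice \<Phi>" "w = (\<lambda>y. v y + \<nu>)"
    using affine_weylE[OF w(1)] by metis
  obtain u where u: "u \<in> weyl_group \<Phi>" "u \<circ> v = id" "v \<circ> u = id" using weyl_inverse v by blast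
  obtain v' \<nu>' where v': "v' \<in> weyl_group \<Phi>" "\<nu>' \<in> coroot_lattice \<Phi>" "w' = (\<lambda>y. v' y + \<nu>')"
    using affine_weylE[OF w(2)] by metis
  obtain u' where u': "u' \<in> weyl_group \<Phi>" "u' \<circ> v' = id" "v' \<circ> u' = id" using weyl_inverse v' by blast
  have c: "w \<circ> w' = (\<lambda>y. (v \<circ> v') y + (v \<nu>' + \<nu>))"
    using v v' linear_add[OF weyl_linear[OF v(1)]] by auto
  have i: "(u' \<circ> u) \<circ> (v \<circ> v') = id" "(v \<circ> v') \<circ> (u' \<circ> u) = id"
    using u(2,3) u'(2,3) by (auto simp: fun_eq_iff)
  have n: "v \<nu>' \<bullet> \<mu> = \<nu>' \<bullet> u \<mu>"
    using weyl_inner[OF v(1), of \<nu>' "u \<mu>"] u(3) by (metis comp_apply id_apply)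
  have int: "v \<nu>' \<bullet> \<mu> \<in> \<int>" "\<nu> \<bullet> \<mu> \<in> \<int>"
    using lattice_inner_int lattice_weyl v v' mu by blast+
  show ?thesis
    unfolding c act_torus_eq[OF weyl_comp[OF v(1) v'(1)] i]
    unfolding v(3) v'(3) act_torus_eq[OF v(1) u(2,3)] act_torus_eq[OF v'(1) u'(2,3)]
    using int by (simp add: inner_add_left ipow_add[OF q_nonzero] flip: n)
qed

lemma act_torus_simple:
  assumes j: "j \<in> {0..r}" and t: "t \<in> torus" "torus_coroot t j = 1" and mu: "\<mu> \<in> coroot_lattice \<Phi>"
  shows "act_torus (simple_refl j) t \<mu> = t \<mu>"
proof -
  let ?g = "grad j"
  have g: "?g \<in> \<Phi>" using grad_root j by blast
  obtain n where n: "?g \<bullet> \<mu> = of_int n" using lattice_root_int[OF mu g] Ints_cases by metis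
  have s: "simple_refl j = (\<lambda>y. refl ?g y + - (of_int (shift j) *\<^sub>R coroot ?g))"
    by (rule ext) (simp add: simple_refl_eq_refl)
  have rr: "refl ?g \<circ> refl ?g = id" by (simp add: fun_eq_iff)
  have "refl ?g \<mu> = \<mu> + of_int (- n) *\<^sub>R coroot ?g" by (simp add: refl_def n)
  then have tr: "t (refl ?g \<mu>) = t \<mu> * t (coroot ?g) powi (- n)"
    using torus_add[OF t(1) mu lattice_scale[OF lattice_coroot[OF g]]]
      torus_scale[OF t(1) lattice_coroot[OF g]] by metis
  have a: "act_torus (simple_refl j) t \<mu> = ipow q (- of_int (shift j) * (coroot ?g \<bullet> \<mu>)) * t (refl
    ?g \<mu>)"
    unfolding s act_torus_eq[OF weyl_refl_mem[OF g] rr rr] by simp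
  show ?thesis
  proof (cases "j = 0")
    case False
    then have "t (coroot ?g) = 1" using t(2) by (simp add: torus_coroot_def grad_def)
    then show ?thesis using a tr False by simp
  next
    case True
    let ?p = highest_root
    have gp: "?g = - ?p" using True by (simp add: grad_def)
    have "t (- coroot ?p) = inverse (q_root ?p)"
      using t(2) True q_root_nonzero by (simp add: torus_coroot_def inverse_unique)
    then have c: "t (coroot ?g) powi (- n) = q_root ?p powi n"
      using gp by (simp add: power_int_minus power_int_inverse)
    have "- of_int (shift j) * (coroot ?g \<bullet> \<mu>) = of_int (- n) * (2 / (norm ?p)\<^sup>2)"
      using n True gp by (simp add: coroot_inner flip: n)
    then have "ipow q (- of_int (shift j) * (coroot ?g \<bullet> \<mu>)) = q_root ?p powi (- n)"
      using q_root_powi[OF highest_root, of "- n"] by metis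
    then show ?thesis using a tr c q_root_nonzero by (simp add: power_int_minus)
  qed
qed

end

text \<open>
  The data that determine one of the representations: a base point \<open>c\<close> in the face \<open>C\<^sup>J\<close> and a character
  \<open>t\<close> in \<open>T\<^sub>J\<close>.
\<close>

locale quasi_poly_datum = daha_datum \<Phi> r \<alpha> q k
  for \<Phi> :: "'a::euclidean_space set" and r :: nat and \<alpha> :: "nat \<Rightarrow> 'a"
    and q :: "'f::field_char_0" and k :: "'a \<Rightarrow> 'f" +
  fixes J :: "nat set" and c :: 'a and t :: "'a \<Rightarrow> 'f"
  assumes face: "c \<in> face J" and torus_face: "t \<in> torus_face J"
begin

lemma base_alcove: "c \<in> alcove"
  using face by (simp add: face_def)

lemma base_torus: "t \<in> torus"
  using torus_face by (simp add: torus_face_def)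

lemma base_simple: "j \<in> {0..r} \<Longrightarrow> aff_root j c = 0 \<Longrightarrow> torus_coroot t j = 1"
  using face torus_face by (auto simp: face_def torus_face_def)

lemma base_stabilizer:
  assumes w: "w \<in> affine_weyl \<Phi>" "w c = c" and mu: "\<mu> \<in> coroot_lattice \<Phi>"
  shows "act_torus w t \<mu> = t \<mu>"
proof -
  have "set js \<subseteq> {j \<in> {0..r}. aff_root j c = 0} \<Longrightarrow> \<mu> \<in> coroot_lattice \<Phi> \<Longrightarrow>
      act_torus (word_prod js) t \<mu> = t \<mu>" for js \<mu>
  proof (induction js arbitrary: \<mu>)
    case Nil
    have "act_torus (\<lambda>y. id y + 0) t \<mu> = t \<mu>" by (subst act_torus_eq[OF weyl_id]) auto
    then show ?case by (simp add: id_def)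
  next
    case (Cons j js)
    then have j: "j \<in> {0..r}" "aff_root j c = 0" and js: "set js \<subseteq> {0..r}" by auto
    have "act_torus (word_prod (j # js)) t \<mu> = act_torus (simple_refl j) (act_torus (word_prod js) t) \<mu>"
      using act_torus_comp[OF simple_refl_affine[OF j(1)] word_prod_affine[OF js] Cons.prems(2)] by simp
    also have "\<dots> = act_torus (simple_refl j) t \<mu>"
      by (rule act_torus_cong[OF simple_refl_affine[OF j(1)] Cons.prems(2)]) (use Cons in auto)
    also have "\<dots> = t \<mu>"
      by (rule act_torus_simple[OF j(1) base_torus base_simple[OF j] Cons.prems(2)])
    finally show ?case .
  qed
  then show ?thesis using affine_stabilizer[OF w(1) base_alcove w(2)] mu by metis
qed

text \<open>
  The character at a point of the orbit may be computed with any affine Weyl group element that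
  carries the base point there, not only with the shortest one.
\<close>

lemma torus_at_eq:
  assumes w: "w \<in> affine_weyl \<Phi>" and mu: "\<mu> \<in> coroot_lattice \<Phi>"
  shows "torus_at c t (w c) \<mu> = act_torus w t \<mu>"
proof -
  let ?u = "min_elt c (w c)"
  have "?u \<in> affine_weyl \<Phi> \<and> ?u c = w c"
    unfolding min_elt_def by (rule arg_min_natI[where k = w]) (use w in simp)
  then have u: "?u \<in> affine_weyl \<Phi>" "?u c = w c" by auto
  obtain w' where w': "w' \<in> affine_weyl \<Phi>" "w' \<circ> w = id" "w \<circ> w' = id"
    using affine_weyl_inverse w by blast
  let ?z = "w' \<circ> ?u"
  have z: "?z \<in> affine_weyl \<Phi>" using affine_weyl_comp w' u by blast
  have "?z c = c" using u(2) w'(2) by (metis comp_apply id_apply)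
  then have "act_torus ?z t \<nu> = t \<nu>" if "\<nu> \<in> coroot_lattice \<Phi>" for \<nu>
    using base_stabilizer[OF z] that by blast
  then have "act_torus w (act_torus ?z t) \<mu> = act_torus w t \<mu>"
    by (intro act_torus_cong[OF w mu])
  moreover have "w \<circ> ?z = ?u" using w'(3) by (simp add: fun_eq_iff)
  ultimately show ?thesis
    unfolding torus_at_def using act_torus_comp[OF w z mu] by metis
qed

lemma torus_at_act:
  assumes y: "y \<in> orbit \<Phi> c" and w: "w \<in> affine_weyl \<Phi>" and mu: "\<mu> \<in> coroot_lattice \<Phi>"
  shows "torus_at c t (w y) \<mu> = act_torus w (torus_at c t y) \<mu>"
proof -
  obtain u where u: "u \<in> affine_weyl \<Phi>" "y = u c" using y by (auto simp: orbit_def)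
  have "torus_at c t (w y) \<mu> = act_torus (w \<circ> u) t \<mu>"
    using torus_at_eq[OF affine_weyl_comp[OF w u(1)] mu] u by simp
  also have "\<dots> = act_torus w (act_torus u t) \<mu>" by (rule act_torus_comp[OF w u(1) mu])
  also have "\<dots> = act_torus w (torus_at c t y) \<mu>"
    by (rule act_torus_cong[OF w mu]) (use torus_at_eq[OF u(1)] u in simp)
  finally show ?thesis .
qed

lemma torus_at_add:
  assumes "y \<in> orbit \<Phi> c" "\<nu> \<in> coroot_lattice \<Phi>" "\<mu> \<in> coroot_lattice \<Phi>"
  shows "torus_at c t (y + \<nu>) \<mu> = ipow q (\<nu> \<bullet> \<mu>) * torus_at c t y \<mu>"
  using torus_at_act[OF assms(1) affine_weylI[OF weyl_id assms(2)] assms(3)]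
    act_torus_eq[OF weyl_id, of id]
  by simp

lemma torus_at_weyl:
  assumes "y \<in> orbit \<Phi> c" "v \<in> weyl_group \<Phi>" "\<mu> \<in> coroot_lattice \<Phi>"
  shows "torus_at c t (v y) (v \<mu>) = torus_at c t y \<mu>"
proof -
  obtain u where u: "u \<circ> v = id" "v \<circ> u = id" using weyl_inverse assms by blast
  then have "u (v \<mu>) = \<mu>" by (metis comp_apply id_apply)
  then show ?thesis
    using torus_at_act[OF assms(1) affine_weylI[OF assms(2) lattice_zero] lattice_weyl[OF assms(2,3)]]
      act_torus_eq[OF assms(2) u, of 0]
    by simp
qed

lemma torus_at_torus: "y \<in> orbit \<Phi> c \<Longrightarrow> torus_at c t y \<in> torus"
proof -
  assume "y \<in> orbit \<Phi> c"
  then obtain w where w: "w \<in> affine_weyl \<Phi>" "y = w c" by (auto simp: orbit_def)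
  obtain v \<nu> where v: "v \<in> weyl_group \<Phi>" "\<nu> \<in> coroot_lattice \<Phi>" "w = (\<lambda>y. v y + \<nu>)"
    using affine_weylE[OF w(1)] by metis
  obtain u where u: "u \<in> weyl_group \<Phi>" "u \<circ> v = id" "v \<circ> u = id" using weyl_inverse v by blast
  have e: "torus_at c t y \<mu> = ipow q (\<nu> \<bullet> \<mu>) * t (u \<mu>)" if "\<mu> \<in> coroot_lattice \<Phi>" for \<mu>
    using torus_at_eq[OF w(1) that] act_torus_eq[OF v(1) u(2,3)] w v by simp
  show ?thesis unfolding torus_def
    using e lattice_add lattice_inner_int[OF v(2)] lattice_weyl[OF u(1)] base_torus
    by (simp add: ipow_nonzero q_nonzero torus_nonzero torus_add inner_add_right ipow_add
        linear_add[OF weyl_linear[OF u(1)]])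
qed

text \<open>
  At the base point, an affine root \<open>\<beta> + n\<close> with \<open>\<beta>\<close> as long as the highest root that vanishes there
  has an affine coroot on which \<open>t\<close> takes the value \<open>1\<close>.
\<close>

lemma base_root_value:
  assumes "\<beta> \<in> \<Phi>" "norm \<beta> = norm highest_root" "\<beta> \<bullet> c + of_int n = 0"
  shows "q_root highest_root powi n * t (coroot \<beta>) = 1"
proof -
  let ?q = "q_root highest_root"
  have pos: "norm \<beta> = norm highest_root \<Longrightarrow> \<beta> \<bullet> c + of_int n = 0 \<Longrightarrow>
      ?q powi n * t (coroot \<beta>) = 1" if "\<beta> \<in> \<Phi>" "pos_aff \<beta> n" for \<beta> n
    using that
  proof (induction rule: pos_aff_induct)
    case (simple j)
    then have "torus_coroot t j = 1" using base_simple by (simp add: aff_root_eq)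
    then show ?case by (cases "j = 0") (auto simp: torus_coroot_def grad_def)
  next
    case (step \<beta> n j m)
    let ?g = "grad j"
    have g: "?g \<in> \<Phi>" using grad_root step by blast
    have z: "aff_root j c = 0" using step(5)[OF base_alcove] step.prems by blast
    then have tc: "torus_coroot t j = 1" using base_simple step by blast
    have "refl ?g \<beta> \<bullet> c + of_int (n - shift j * m) = \<beta> \<bullet> c + of_int n"
    proof -
      have "simple_refl j c = c" using z by (simp add: simple_refl_eq)
      then have "refl ?g c = c + of_int (shift j) *\<^sub>R coroot ?g"
        by (simp add: simple_refl_eq_refl diff_eq_eq)
      then show ?thesis using step(4) by (simp add: inner_refl_left inner_add_right)
    qed
    then have IH: "?q powi (n - shift j * m) * t (coroot (refl ?g \<beta>)) = 1"
      using step by simp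
    obtain l where l: "?g \<bullet> coroot \<beta> = of_int l" using cartan_int g step(1) Ints_cases by metis
    have "coroot (refl ?g \<beta>) = coroot \<beta> + of_int (- l) *\<^sub>R coroot ?g"
      by (simp add: coroot_refl) (simp add: refl_def l)
    then have tr: "t (coroot (refl ?g \<beta>)) = t (coroot \<beta>) * t (coroot ?g) powi (- l)"
      using torus_add[OF base_torus lattice_coroot[OF step(1)] lattice_scale[OF lattice_coroot[OF g]]]
        torus_scale[OF base_torus lattice_coroot[OF g]] by metis
    show ?case
    proof (cases "j = 0")
      case False
      then have "t (coroot ?g) = 1" using tc by (simp add: torus_coroot_def grad_def)
      then show ?thesis using IH tr False by simp
    next
      case True
      have gp: "?g = - highest_root" using True by (simp add: grad_def)
      have "l = m"
      proof -
        have "of_int l = (of_int m :: real)"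
          using l step(4) step.prems(1) gp by (simp add: inner_coroot inner_commute[of \<beta>])
        then show ?thesis by simp
      qed
      have "t (coroot ?g) = inverse ?q"
        using tc True gp by (simp add: torus_coroot_def inverse_unique)
      then have "t (coroot ?g) powi (- l) = ?q powi m"
        using \<open>l = m\<close> by (simp add: power_int_minus power_int_inverse)
      then have "?q powi (n - m) * (t (coroot \<beta>) * ?q powi m) = 1" using IH tr True by simp
      moreover have "?q powi (n - m) * ?q powi m = ?q powi n"
        using q_root_nonzero by (simp flip: power_int_add)
      ultimately show ?thesis by (simp add: mult_ac)
    qed
  qed
  show ?thesis
  proof (cases "pos_aff \<beta> n")
    case True
    then show ?thesis using pos assms by blast
  next
    case False
    then have "pos_aff (- \<beta>) (- n)" using pos_aff_or_neg[OF assms(1)] by blast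
    then have "?q powi (- n) * t (coroot (- \<beta>)) = 1"
      using pos[of "- \<beta>" "- n"] root_neg[OF assms(1)] assms(2,3) by simp
    then show ?thesis
      using torus_minus[OF base_torus lattice_coroot[OF assms(1)]] q_root_nonzero
        torus_nonzero[OF base_torus lattice_coroot[OF assms(1)]]
      by (simp add: power_int_minus field_simps)
  qed
qed

text \<open>
  The consistency of the twist: where the highest root takes an integral value, the character is
  determined. Equivariance under the reflection determines it only up to sign; membership of \<open>t\<close> in
  \<open>T\<^sub>J\<close> fixes the sign.
\<close>

lemma torus_at_highest_root:
  assumes y: "y \<in> orbit \<Phi> c" and n: "highest_root \<bullet> y = of_int n"
  shows "torus_at c t y (coroot highest_root) = q_root highest_root powi n"
proof -
  let ?p = highest_root and ?q = "q_root highest_root"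
  obtain w where w: "w \<in> affine_weyl \<Phi>" "y = w c" using y by (auto simp: orbit_def)
  obtain v \<nu> where v: "v \<in> weyl_group \<Phi>" "\<nu> \<in> coroot_lattice \<Phi>" "w = (\<lambda>y. v y + \<nu>)"
    using affine_weylE[OF w(1)] by metis
  obtain u where u: "u \<in> weyl_group \<Phi>" "u \<circ> v = id" "v \<circ> u = id" using weyl_inverse v by blast
  obtain l where l: "?p \<bullet> \<nu> = of_int l" using lattice_root_int[OF v(2) highest_root] Ints_cases by metis
  have e: "torus_at c t y (coroot ?p) = ipow q (\<nu> \<bullet> coroot ?p) * t (u (coroot ?p))"
    using torus_at_eq[OF w(1) lattice_coroot[OF highest_root]] act_torus_eq[OF v(1) u(2,3)] w v by simp
  have "\<nu> \<bullet> coroot ?p = of_int l * (2 / (norm ?p)\<^sup>2)"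
    using l by (simp add: inner_coroot inner_commute)
  then have q: "ipow q (\<nu> \<bullet> coroot ?p) = ?q powi l"
    using q_root_powi[OF highest_root, of l] by metis
  have "u ?p \<bullet> c = ?p \<bullet> v c"
    using weyl_inner[OF u(1), of ?p "v c"] u(2) by (metis comp_apply id_apply)
  then have "u ?p \<bullet> c + of_int (l - n) = 0"
    using n w v l by (simp add: inner_add_right)
  then have "?q powi (l - n) * t (coroot (u ?p)) = 1"
    using base_root_value weyl_root[OF u(1) highest_root] weyl_norm[OF u(1)] by blast
  then have "?q powi l * t (u (coroot ?p)) = ?q powi n"
    using q_root_nonzero weyl_coroot[OF u(1)] by (simp add: power_int_diff field_simps)
  then show ?thesis using e q by simp
qed

end

section \<open>Linear operators on a monoid algebra\<close>

lemma scal_mult: "scal a * scal b = scal (a * b)"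
  by (simp add: scal_def mult_single)

lemma scal_one [simp]: "scal 1 = 1" by (simp add: scal_def)
lemma scal_zero [simp]: "scal 0 = 0" by (simp add: scal_def)
lemma scal_add: "scal (a + b) = scal a + scal b" by (simp add: scal_def single_add)
lemma scal_diff: "scal (a - b) = scal a - scal b" by (simp add: scal_def single_diff)

lemma scal_single: "scal a * Poly_Mapping.single y b = Poly_Mapping.single y (a * b)"
  by (simp add: scal_def mult_single)

lemma poly_mapping_expansion:
  fixes p :: "'m \<Rightarrow>\<^sub>0 'f::comm_monoid_add"
  shows "p = (\<Sum>y \<in> Poly_Mapping.keys p. Poly_Mapping.single y (Poly_Mapping.lookup p y))"
proof (rule poly_mapping_eqI)
  fix z
  show "Poly_Mapping.lookup p z =
      Poly_Mapping.lookup (\<Sum>y \<in> Poly_Mapping.keys p. Poly_Mapping.single y (Poly_Mapping.lookup p y)) z"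
    by (simp add: lookup_sum lookup_single when_def in_keys_iff)
qed

lemma poly_mapping_induct [consumes 1, case_names zero single add]:
  fixes p :: "'m \<Rightarrow>\<^sub>0 'f::comm_monoid_add"
  assumes "Poly_Mapping.keys p \<subseteq> A" and "P 0"
    and "\<And>y b. y \<in> A \<Longrightarrow> P (Poly_Mapping.single y b)"
    and "\<And>u v. P u \<Longrightarrow> P v \<Longrightarrow> P (u + v)"
  shows "P p"
proof -
  have "finite B \<Longrightarrow> B \<subseteq> A \<Longrightarrow> P (\<Sum>y \<in> B. Poly_Mapping.single y (Poly_Mapping.lookup p y))" for B
    by (induction B rule: finite_induct) (auto intro: assms)
  then show ?thesis using poly_mapping_expansion[of p] assms(1) by (metis finite_keys)
qed

text \<open>The linear extension of a map on the basis of monomials.\<close>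

definition lin_ext :: "('m \<Rightarrow> ('n::monoid_add \<Rightarrow>\<^sub>0 'f)) \<Rightarrow> ('m \<Rightarrow>\<^sub>0 'f::comm_ring_1) \<Rightarrow> ('n \<Rightarrow>\<^sub>0 'f)" where
  "lin_ext g p = (\<Sum>y \<in> Poly_Mapping.keys p. scal (Poly_Mapping.lookup p y) * g y)"

lemma lin_ext_superset:
  assumes "finite A" "Poly_Mapping.keys p \<subseteq> A"
  shows "lin_ext g p = (\<Sum>y \<in> A. scal (Poly_Mapping.lookup p y) * g y)"
  unfolding lin_ext_def
  by (rule sum.mono_neutral_left) (use assms in \<open>auto simp: in_keys_iff\<close>)

lemma lin_ext_add: "lin_ext g (p + p') = lin_ext g p + lin_ext g p'"
proof -
  let ?A = "Poly_Mapping.keys p \<union> Poly_Mapping.keys p'"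
  have "lin_ext g (p + p') = (\<Sum>y \<in> ?A. scal (Poly_Mapping.lookup (p + p') y) * g y)"
    by (rule lin_ext_superset) (simp, rule keys_add)
  also have "\<dots> = lin_ext g p + lin_ext g p'"
    by (simp add: lin_ext_superset[of ?A] lookup_add scal_add distrib_right sum.distrib)
  finally show ?thesis .
qed

lemma lin_ext_zero [simp]: "lin_ext g 0 = 0" by (simp add: lin_ext_def)

lemma lin_ext_single: "lin_ext g (Poly_Mapping.single y b) = scal b * g y"
  by (simp add: lin_ext_def)

lemma lin_ext_scal: "lin_ext g (scal a * p) = scal a * lin_ext g p"
proof (induction p rule: poly_mapping_induct[OF subset_UNIV])
  case (2 y b)
  then show ?case by (simp add: scal_single lin_ext_single mult.assoc flip: scal_mult)
qed (simp_all add: distrib_left lin_ext_add)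

lemma lin_ext_minus: "lin_ext g (- p) = - lin_ext g p"
  using lin_ext_add[of g p "- p"] by (simp add: eq_neg_iff_add_eq_0 add.commute)

lemma lin_ext_diff: "lin_ext g (p - p') = lin_ext g p - lin_ext g p'"
  using lin_ext_add[of g p "- p'"] by (simp add: lin_ext_minus)

lemma mono_x_add: "mono_x (y + z) = mono_x y * mono_x z"
  by (simp add: mono_x_def mult_single)

lemma mono_x_zero [simp]: "mono_x 0 = 1"
  by (simp add: mono_x_def)

lemma single_mono_x: "Poly_Mapping.single y b = scal b * mono_x y"
  by (simp add: mono_x_def scal_single)

lemma lin_ext_mono_x [simp]: "lin_ext g (mono_x y) = g y"
  by (simp add: mono_x_def lin_ext_single)

lemma keys_scal_mult: "Poly_Mapping.keys (scal a * p) \<subseteq> Poly_Mapping.keys p"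
  using keys_mult[of "scal a" p] by (auto simp: scal_def split: if_splits)

lemma keys_mono_x: "Poly_Mapping.keys (mono_x y :: 'a::euclidean_space \<Rightarrow>\<^sub>0 'f::field) = {y}"
  by (simp add: mono_x_def)

lemma poly_space_induct [consumes 1, case_names mono add scal]:
  assumes "p \<in> poly_space \<Phi> c"
    and "\<And>y. y \<in> orbit \<Phi> c \<Longrightarrow> P (mono_x y)"
    and "\<And>u v. P u \<Longrightarrow> P v \<Longrightarrow> P (u + v)"
    and "\<And>a u. P u \<Longrightarrow> P (scal a * u)"
  shows "P p"
proof -
  have "orbit \<Phi> c \<noteq> {}" 
  proof -
    have "0 \<in> coroot_lattice \<Phi>"
      unfolding coroot_lattice_def by (rule CollectI, intro exI[of _ "\<lambda>_. 0"]) simp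
    then have "(\<lambda>y. id y + 0) \<in> affine_weyl \<Phi>"
      unfolding affine_weyl_def using weyl_id by blast
    then show ?thesis by (auto simp: orbit_def)
  qed
  then have "P (scal 0 * mono_x (SOME y. y \<in> orbit \<Phi> c))"
    by (intro assms(2,4)) (simp add: some_in_eq)
  then have "P 0" by simp
  moreover have "Poly_Mapping.keys p \<subseteq> orbit \<Phi> c" using assms(1) by (simp add: poly_space_def)
  ultimately show ?thesis
    using poly_mapping_induct[of p "orbit \<Phi> c" P] assms(2-4) by (simp add: single_mono_x)
qed

lemma poly_space_add: "u \<in> poly_space \<Phi> c \<Longrightarrow> v \<in> poly_space \<Phi> c \<Longrightarrow> u + v \<in> poly_space \<Phi> c"
  using keys_add[of u v] by (auto simp: poly_space_def)

lemma poly_space_scal: "u \<in> poly_space \<Phi> c \<Longrightarrow> scal a * u \<in> poly_space \<Phi> c"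
  using keys_scal_mult[of a u] by (auto simp: poly_space_def)

lemma poly_space_minus: "u \<in> poly_space \<Phi> c \<Longrightarrow> - u \<in> poly_space \<Phi> c"
  by (simp add: poly_space_def)

lemma poly_space_diff: "u \<in> poly_space \<Phi> c \<Longrightarrow> v \<in> poly_space \<Phi> c \<Longrightarrow> u - v \<in> poly_space \<Phi> c"
  using poly_space_add[OF _ poly_space_minus, of u \<Phi> c v] by simp

lemma poly_space_zero: "0 \<in> poly_space \<Phi> c"
  by (simp add: poly_space_def)

lemma poly_space_mono: "y \<in> orbit \<Phi> c \<Longrightarrow> mono_x y \<in> poly_space \<Phi> c"
  by (simp add: poly_space_def keys_mono_x)

lemma (in root_datum) poly_space_mult:
  assumes "Poly_Mapping.keys f \<subseteq> coroot_lattice \<Phi>" "p \<in> poly_space \<Phi> c"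
  shows "f * p \<in> poly_space \<Phi> c"
proof -
  have "x + y \<in> orbit \<Phi> c" if "x \<in> coroot_lattice \<Phi>" "y \<in> orbit \<Phi> c" for x y
    using orbit_add[OF that] by (simp add: add.commute)
  then show ?thesis using keys_mult[of f p] assms by (fastforce simp: poly_space_def)
qed

lemma lin_ext_poly_space:
  assumes "p \<in> poly_space \<Phi> c" "\<And>y. y \<in> orbit \<Phi> c \<Longrightarrow> g y \<in> poly_space \<Phi> c"
  shows "lin_ext g p \<in> poly_space \<Phi> c"
  using assms(1)
  by (induction rule: poly_space_induct)
     (auto simp: lin_ext_add lin_ext_scal intro: poly_space_add poly_space_scal assms)

section \<open>Exact division\<close>

lemma mono_binomial_cancel:
  fixes h :: "'a::euclidean_space \<Rightarrow>\<^sub>0 'f::field"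
  assumes v: "v \<noteq> 0" and h: "h * (1 - scal a * mono_x v) = 0"
  shows "h = 0"
proof (rule ccontr)
  assume "h \<noteq> 0"
  then obtain y where y: "Poly_Mapping.lookup h y \<noteq> 0"
    by (metis lookup_zero poly_mapping_eqI)
  have sh: "Poly_Mapping.lookup (mono_x v * p) (v + z) = Poly_Mapping.lookup p z" for p ::
    "'a \<Rightarrow>\<^sub>0 'f" and z
    by (induction p rule: poly_mapping_induct[OF subset_UNIV])
       (simp_all add: mono_x_def mult_single lookup_single distrib_left lookup_add)
  have sc: "Poly_Mapping.lookup (scal a * p) z = a * Poly_Mapping.lookup p z" for p :: "'a \<Rightarrow>\<^sub>0 'f" and z
    by (induction p rule: poly_mapping_induct[OF subset_UNIV])
       (simp_all add: scal_single lookup_single distrib_left lookup_add when_def)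
  have "h = scal a * (mono_x v * h)" using h by (simp add: algebra_simps)
  then have rec: "Poly_Mapping.lookup h (v + z) = a * Poly_Mapping.lookup h z" for z
    using sc sh by metis
  have "Poly_Mapping.lookup h (y - real n *\<^sub>R v) \<noteq> 0" for n
  proof (induction n)
    case (Suc n)
    have e: "v + (y - real (Suc n) *\<^sub>R v) = y - real n *\<^sub>R v" by (simp add: algebra_simps)
    show ?case using Suc rec[of "y - real (Suc n) *\<^sub>R v"] unfolding e by auto
  qed (use y in simp)
  then have "range (\<lambda>n. y - real n *\<^sub>R v) \<subseteq> Poly_Mapping.keys h" by (auto simp: in_keys_iff)
  moreover have "inj (\<lambda>n. y - real n *\<^sub>R v)" using v by (auto simp: inj_def)
  ultimately show False by (meson finite_imageD finite_keys finite_subset infinite_UNIV_nat)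
qed

context daha_datum
begin

lemma x_coroot_eq:
  "x_coroot j n = scal ((if j = 0 then q_root highest_root else 1) powi n) *
     mono_x (of_int n *\<^sub>R coroot (grad j))"
  by (simp add: x_coroot_def grad_def)

lemma x_coroot_add: "x_coroot j (m + n) = x_coroot j m * x_coroot j n"
  using q_root_nonzero[of highest_root]
  by (simp add: x_coroot_eq power_int_add scaleR_add_left mono_x_add mult_ac flip: scal_mult)

lemma x_coroot_zero [simp]: "x_coroot j 0 = 1"
  by (simp add: x_coroot_eq)

lemma x_coroot_inverse [simp]: "x_coroot j n * x_coroot j (- n) = 1"
  "x_coroot j (- n) * x_coroot j n = 1"
  by (simp_all flip: x_coroot_add)

lemma x_coroot_keys: "j \<in> {0..r} \<Longrightarrow> Poly_Mapping.keys (x_coroot j n) \<subseteq> coroot_lattice \<Phi>"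
  using keys_scal_mult[of _ "mono_x (of_int n *\<^sub>R coroot (grad j))"]
    lattice_scale[OF lattice_coroot[OF grad_root], of j n]
  unfolding x_coroot_eq keys_mono_x by blast

lemma coroot_nz: "\<beta> \<in> \<Phi> \<Longrightarrow> coroot \<beta> \<noteq> 0"
  using root_nz by (simp add: coroot_def)

lemma x_coroot_cancel:
  assumes j: "j \<in> {0..r}" and "h * (1 - x_coroot j 1) = h' * (1 - x_coroot j 1)"
  shows "h = h'"
proof -
  have "coroot (grad j) \<noteq> 0" using coroot_nz grad_root j by blast
  moreover have "(h - h') * (1 - x_coroot j 1) = 0" using assms by (simp add: algebra_simps)
  moreover have "x_coroot j 1 = scal (if j = 0 then q_root highest_root else 1) * mono_x (coroot
    (grad j))"
    by (simp add: x_coroot_eq)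
  ultimately have "h - h' = 0" using mono_binomial_cancel[of "coroot (grad j)" "h - h'"] by metis
  then show ?thesis by simp
qed

lemma exact_div_eq: "j \<in> {0..r} \<Longrightarrow> h * (1 - x_coroot j 1) = f \<Longrightarrow> exact_div f (1 - x_coroot j 1) = h"
  unfolding exact_div_def by (rule the_equality) (auto intro: x_coroot_cancel)

text \<open>The geometric sum \<open>(1 - x\<^bsup>n \<alpha>\<^sub>j\<^sup>\<or>\<^esup>) / (1 - x\<^bsup>\<alpha>\<^sub>j\<^sup>\<or>\<^esup>)\<close>.\<close>

definition geom :: "nat \<Rightarrow> int \<Rightarrow> ('a \<Rightarrow>\<^sub>0 'f)" where
  "geom j n = exact_div (1 - x_coroot j n) (1 - x_coroot j 1)"

lemma geom_exists:
  assumes j: "j \<in> {0..r}"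
  shows "\<exists>h. h * (1 - x_coroot j 1) = 1 - x_coroot j n \<and> Poly_Mapping.keys h \<subseteq> coroot_lattice \<Phi>"
proof (induction n rule: int_induct[where k = 0])
  case base
  show ?case by (intro exI[of _ 0]) simp
next
  case (step1 i)
  then obtain h where h: "h * (1 - x_coroot j 1) = 1 - x_coroot j i"
    "Poly_Mapping.keys h \<subseteq> coroot_lattice \<Phi>"
    by blast
  have "(h + x_coroot j i) * (1 - x_coroot j 1) = 1 - x_coroot j (i + 1)"
    using h(1) by (simp only: distrib_right right_diff_distrib x_coroot_add) (simp add: algebra_simps)
  moreover have "Poly_Mapping.keys (h + x_coroot j i) \<subseteq> coroot_lattice \<Phi>"
    using h x_coroot_keys[OF j] keys_add[of h "x_coroot j i"] by blast
  ultimately show ?case by blast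
next
  case (step2 i)
  then obtain h where h: "h * (1 - x_coroot j 1) = 1 - x_coroot j i"
    "Poly_Mapping.keys h \<subseteq> coroot_lattice \<Phi>"
    by blast
  have "x_coroot j (i - 1) * x_coroot j 1 = x_coroot j i" by (simp flip: x_coroot_add)
  then have "(h - x_coroot j (i - 1)) * (1 - x_coroot j 1) = 1 - x_coroot j (i - 1)"
    using h by (simp add: algebra_simps)
  moreover have "Poly_Mapping.keys (h - x_coroot j (i - 1)) \<subseteq> coroot_lattice \<Phi>"
    using h x_coroot_keys[OF j] keys_diff[of h "x_coroot j (i - 1)"] by blast
  ultimately show ?case by blast
qed

lemma geom_mult: "j \<in> {0..r} \<Longrightarrow> geom j n * (1 - x_coroot j 1) = 1 - x_coroot j n"
  using geom_exists[of j n] exact_div_eq unfolding geom_def by blast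

lemma geom_keys: "j \<in> {0..r} \<Longrightarrow> Poly_Mapping.keys (geom j n) \<subseteq> coroot_lattice \<Phi>"
  using geom_exists[of j n] exact_div_eq unfolding geom_def by blast

lemma geom_eq: "j \<in> {0..r} \<Longrightarrow> h * (1 - x_coroot j 1) = 1 - x_coroot j n \<Longrightarrow> geom j n = h"
  unfolding geom_def by (rule exact_div_eq)

lemma geom_values:
  assumes j: "j \<in> {0..r}"
  shows "geom j 0 = 0" "geom j 1 = 1" "geom j (- 1) = - x_coroot j (- 1)"
    "geom j (- 2) = - x_coroot j (- 1) - x_coroot j (- 2)" "geom j 2 = 1 + x_coroot j 1"
proof -
  have e: "x_coroot j 1 * x_coroot j 1 = x_coroot j 2"
    "x_coroot j (- 2) * x_coroot j 1 = x_coroot j (- 1)"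
    by (simp_all flip: x_coroot_add)
  show "geom j 0 = 0" "geom j 1 = 1" "geom j (- 1) = - x_coroot j (- 1)"
    "geom j (- 2) = - x_coroot j (- 1) - x_coroot j (- 2)" "geom j 2 = 1 + x_coroot j 1"
    by (rule geom_eq[OF j], simp add: distrib_right left_diff_distrib right_diff_distrib e)+
qed

lemma geom_add: "j \<in> {0..r} \<Longrightarrow> geom j (m + n) = geom j m + x_coroot j m * geom j n"
  by (rule geom_eq) (simp_all only: distrib_right geom_mult mult.assoc x_coroot_add, simp add:
    algebra_simps)

lemma nabla_eq: "nabla j y = geom j (- \<lfloor>grad j \<bullet> y\<rfloor>) * mono_x y"
  by (simp add: nabla_def geom_def)

lemma act_mono_eq:
  assumes j: "j \<in> {0..r}" and mu: "\<mu> \<in> coroot_lattice \<Phi>" and n: "grad j \<bullet> \<mu> = of_int n"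
  shows "act_mono (simple_refl j) \<mu> = x_coroot j (- n) * mono_x \<mu>"
proof -
  let ?g = "grad j"
  have lin: "lin_part (simple_refl j) \<mu> = refl ?g \<mu>"
    by (simp add: lin_part_def simple_refl_eq_refl)
  have s0: "simple_refl j 0 = - of_int (shift j) *\<^sub>R coroot ?g"
    by (simp add: simple_refl_eq_refl)
  have m: "mono_x (refl ?g \<mu>) = mono_x (of_int (- n) *\<^sub>R coroot ?g) * (mono_x \<mu> :: 'a \<Rightarrow>\<^sub>0 'f)"
    using n by (simp add: refl_def flip: mono_x_add)
  have "coroot ?g \<bullet> refl ?g \<mu> = - (coroot ?g \<bullet> \<mu>)"
    by (simp flip: inner_refl_left)
  then have ip: "- (simple_refl j 0 \<bullet> refl ?g \<mu>) = - of_int (shift j) * (coroot ?g \<bullet> \<mu>)"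
    by (simp add: s0)
  have q: "ipow q (- (simple_refl j 0 \<bullet> refl ?g \<mu>)) = (if j = 0 then q_root highest_root else 1)
    powi (- n)"
  proof (cases "j = 0")
    case True
    then have "- of_int (shift j) * (coroot ?g \<bullet> \<mu>) = of_int (- n) * (2 / (norm highest_root)\<^sup>2)"
      using n by (simp add: coroot_inner grad_def flip: n)
    then show ?thesis using q_root_powi[OF highest_root, of "- n"] True ip by metis
  qed (simp add: ip)
  show ?thesis unfolding act_mono_def lin q m x_coroot_eq by (simp add: mult.assoc)
qed

text \<open>The sum \<open>k\<^sub>j - k\<^sub>j\<^sup>-\<^sup>1\<close> of the two roots of the quadratic relation of \<open>T\<^sub>j\<close>.\<close>

definition kap :: "nat \<Rightarrow> 'f" where
  "kap j = k_simple j - inverse (k_simple j)"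

lemma k_simple_nonzero: "j \<in> {0..r} \<Longrightarrow> k_simple j \<noteq> 0"
  using k_nonzero highest_root simple_root by (auto simp: k_simple_def)

end

section \<open>The operators of the representation\<close>

context quasi_poly_datum
begin

abbreviation V :: "('a \<Rightarrow>\<^sub>0 'f) set" where "V \<equiv> poly_space \<Phi> c"
abbreviation Orb :: "'a set" where "Orb \<equiv> orbit \<Phi> c"

text \<open>
  The image of \<open>x\<^sup>y\<close> under the twisted action of an affine Weyl group element \<open>w = \<tau>(\<nu>) v\<close>: the
  monomial \<open>x\<^bsup>v y\<^esup>\<close> times the value of the character at \<open>v y\<close> in \<open>-\<nu>\<close>.
\<close>

definition weyl_mono :: "('a \<Rightarrow> 'a) \<Rightarrow> 'a \<Rightarrow> ('a \<Rightarrow>\<^sub>0 'f)" where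
  "weyl_mono w y = scal (torus_at c t (lin_part w y) (- w 0)) * mono_x (lin_part w y)"

lemma orbit_lin_part: "w \<in> affine_weyl \<Phi> \<Longrightarrow> y \<in> Orb \<Longrightarrow> lin_part w y \<in> Orb"
  by (elim affine_weylE) (use orbit_mem[OF affine_weylI[OF _ lattice_zero]] in auto)

lemma weyl_mono_comp:
  assumes w: "w \<in> affine_weyl \<Phi>" "w' \<in> affine_weyl \<Phi>" and y: "y \<in> Orb"
  shows "lin_ext (weyl_mono w) (weyl_mono w' y) = weyl_mono (w \<circ> w') y"
proof -
  obtain v \<nu> where v: "v \<in> weyl_group \<Phi>" "\<nu> \<in> coroot_lattice \<Phi>" "w = (\<lambda>y. v y + \<nu>)"
    "lin_part w = v" "w 0 = \<nu>" using affine_weylE[OF w(1)] by metis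
  obtain v' \<nu>' where v': "v' \<in> weyl_group \<Phi>" "\<nu>' \<in> coroot_lattice \<Phi>" "w' = (\<lambda>y. v' y + \<nu>')"
    "lin_part w' = v'" "w' 0 = \<nu>'" using affine_weylE[OF w(2)] by metis
  have c0: "(w \<circ> w') 0 = v \<nu>' + \<nu>" using v v' by auto
  have cl: "lin_part (w \<circ> w') = v \<circ> v'"
    using v v' by (auto simp: lin_part_def fun_eq_iff linear_add[OF weyl_linear[OF v(1)]]
        linear_0[OF weyl_linear[OF v'(1)]] linear_0[OF weyl_linear[OF v(1)]])
  have y': "v' y \<in> Orb" using orbit_lin_part[OF w(2) y] v' by simp
  have y'': "v (v' y) \<in> Orb" using orbit_lin_part[OF w(1) y'] v by simp
  have "torus_at c t (v (v' y)) (- (v \<nu>' + \<nu>)) =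
      torus_at c t (v (v' y)) (v (- \<nu>')) * torus_at c t (v (v' y)) (- \<nu>)"
    using torus_add[OF torus_at_torus[OF y''] lattice_weyl[OF v(1) lattice_neg[OF v'(2)]]
      lattice_neg[OF v(2)]]
    by (simp add: linear_neg[OF weyl_linear[OF v(1)]])
  also have "torus_at c t (v (v' y)) (v (- \<nu>')) = torus_at c t (v' y) (- \<nu>')"
    by (rule torus_at_weyl[OF y' v(1) lattice_neg[OF v'(2)]])
  finally show ?thesis
    unfolding weyl_mono_def c0 cl v(4,5) v'(4,5) lin_ext_scal lin_ext_mono_x
    by (simp add: mult.assoc flip: scal_mult)
qed

lemma weyl_mono_id: "y \<in> Orb \<Longrightarrow> weyl_mono id y = mono_x y"
  using torus_zero[OF torus_at_torus] by (simp add: weyl_mono_def lin_part_def)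

lemma s_op_eq: "j \<in> {0..r} \<Longrightarrow> y \<in> Orb \<Longrightarrow> s_op c t j y = weyl_mono (simple_refl j) y"
proof (cases "j = 0")
  assume j: "j \<in> {0..r}" and y: "y \<in> Orb"
  have lin: "lin_part (simple_refl j) y = refl (grad j) y"
    by (simp add: lin_part_def simple_refl_eq_refl)
  have ry: "refl (grad j) y \<in> Orb" by (rule orbit_refl[OF grad_root[OF j] y])
  {
    case False
    then show ?thesis
      using torus_zero[OF torus_at_torus[OF ry]] lin
      by (simp add: s_op_def weyl_mono_def simple_refl_eq_refl grad_def)
  next
    case True
    have "torus_at c t (refl highest_root y) (refl highest_root (coroot highest_root)) =
        torus_at c t y (coroot highest_root)"
      by (rule torus_at_weyl[OF y weyl_refl_mem[OF highest_root] lattice_coroot[OF highest_root]])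
    then show ?thesis using lin True
      by (simp add: s_op_def weyl_mono_def simple_refl_eq_refl grad_def)
  }
qed

text \<open>
  The operators \<open>s\<^bsub>j,t\<^esub>\<close> and the prospective action of \<open>T\<^sub>j\<close>, on monomials and extended linearly. Only
  their values on the span \<open>V\<close> of the orbit matter.
\<close>

definition S :: "nat \<Rightarrow> ('a \<Rightarrow>\<^sub>0 'f) \<Rightarrow> ('a \<Rightarrow>\<^sub>0 'f)" where
  "S j = lin_ext (s_op c t j)"

definition T_mono :: "nat \<Rightarrow> 'a \<Rightarrow> ('a \<Rightarrow>\<^sub>0 'f)" where
  "T_mono j y = scal (k_simple j ^ indicator \<int> (aff_root j y)) * s_op c t j y +
     scal (k_simple j - inverse (k_simple j)) * nabla j y"

definition T :: "nat \<Rightarrow> ('a \<Rightarrow>\<^sub>0 'f) \<Rightarrow> ('a \<Rightarrow>\<^sub>0 'f)" where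
  "T j = lin_ext (T_mono j)"

lemma T_linear:
  "T j (p + p') = T j p + T j p'" "T j (p - p') = T j p - T j p'" "T j (- p) = - T j p"
  "T j (scal a * p) = scal a * T j p" "T j 0 = 0"
  by (simp_all add: T_def lin_ext_add lin_ext_diff lin_ext_minus lin_ext_scal)

lemma S_linear:
  "S j (p + p') = S j p + S j p'" "S j (p - p') = S j p - S j p'" "S j (- p) = - S j p"
  "S j (scal a * p) = scal a * S j p" "S j 0 = 0"
  by (simp_all add: S_def lin_ext_add lin_ext_diff lin_ext_minus lin_ext_scal)

lemma S_mono: "S j (mono_x y) = s_op c t j y" by (simp add: S_def)
lemma T_mono_x: "T j (mono_x y) = T_mono j y" by (simp add: T_def)

lemma T_scal_mono: "T j (scal a * mono_x y) = scal a * T_mono j y"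
  by (simp add: T_linear T_mono_x)

lemma s_op_scal:
  assumes "j \<in> {0..r}"
  obtains a where "s_op c t j y = scal a * mono_x (refl (grad j) y)"
  by (rule that[of "if j = 0 then torus_at c t y (coroot highest_root) else 1"])
     (simp add: s_op_def grad_def)

lemma s_op_space: "j \<in> {0..r} \<Longrightarrow> y \<in> Orb \<Longrightarrow> s_op c t j y \<in> V"
  using orbit_refl[OF grad_root] by (metis poly_space_mono poly_space_scal s_op_scal)

lemma nabla_space: "j \<in> {0..r} \<Longrightarrow> y \<in> Orb \<Longrightarrow> nabla j y \<in> V"
  unfolding nabla_eq by (intro poly_space_mult geom_keys poly_space_mono)

lemma T_mono_space: "j \<in> {0..r} \<Longrightarrow> y \<in> Orb \<Longrightarrow> T_mono j y \<in> V"
  unfolding T_mono_def by (intro poly_space_add poly_space_scal s_op_space nabla_space)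

lemma T_space: "j \<in> {0..r} \<Longrightarrow> p \<in> V \<Longrightarrow> T j p \<in> V"
  unfolding T_def using lin_ext_poly_space T_mono_space by blast

lemma mono_mult_space: "\<mu> \<in> coroot_lattice \<Phi> \<Longrightarrow> p \<in> V \<Longrightarrow> mono_x \<mu> * p \<in> V"
  by (intro poly_space_mult) (simp_all add: keys_mono_x)

lemma s_op_add:
  assumes j: "j \<in> {0..r}" and y: "y \<in> Orb" and mu: "\<mu> \<in> coroot_lattice \<Phi>" and n: "grad j \<bullet> \<mu> = of_int n"
  shows "s_op c t j (\<mu> + y) = x_coroot j (- n) * mono_x \<mu> * s_op c t j y"
proof (cases "j = 0")
  case False
  then have "refl (\<alpha> j) (\<mu> + y) = of_int (- n) *\<^sub>R coroot (grad j) + \<mu> + refl (\<alpha> j) y"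
    using n by (simp add: refl_def[of _ "\<mu> + y"] refl_def grad_def inner_add_right algebra_simps)
  then have "mono_x (refl (\<alpha> j) (\<mu> + y)) =
      mono_x (of_int (- n) *\<^sub>R coroot (grad j)) * mono_x \<mu> * (mono_x (refl (\<alpha> j) y) :: 'a \<Rightarrow>\<^sub>0 'f)"
    by (simp only: mono_x_add)
  then show ?thesis using False by (simp add: s_op_def x_coroot_eq)
next
  case True
  let ?p = highest_root
  have g: "grad j = - ?p" using True by (simp add: grad_def)
  have "refl ?p (\<mu> + y) = of_int (- n) *\<^sub>R coroot (grad j) + \<mu> + refl ?p y"
    using n g by (simp add: refl_def[of _ "\<mu> + y"] refl_def inner_add_right algebra_simps flip: n)
  then have m: "mono_x (refl ?p (\<mu> + y)) =
      mono_x (of_int (- n) *\<^sub>R coroot (grad j)) * mono_x \<mu> * (mono_x (refl ?p y) :: 'a \<Rightarrow>\<^sub>0 'f)"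
    by (simp only: mono_x_add)
  have "\<mu> \<bullet> coroot ?p = of_int (- n) * (2 / (norm ?p)\<^sup>2)"
    using g by (simp add: inner_coroot inner_commute flip: n)
  then have "ipow q (\<mu> \<bullet> coroot ?p) = q_root ?p powi (- n)"
    using q_root_powi[OF highest_root, of "- n"] by metis
  then have "torus_at c t (y + \<mu>) (coroot ?p) = q_root ?p powi (- n) * torus_at c t y (coroot ?p)"
    using torus_at_add[OF y mu lattice_coroot[OF highest_root]] by simp
  then show ?thesis using True m
    by (simp add: s_op_def x_coroot_eq mult_ac add.commute flip: scal_mult)
qed

text \<open>Where \<open>\<alpha>\<^sub>j\<close> is integral, \<open>s\<^sub>j\<close> shifts by a multiple of the coroot.\<close>

lemma s_op_int:
  assumes j: "j \<in> {0..r}" and y: "y \<in> Orb" and n: "grad j \<bullet> y = of_int n"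
  shows "s_op c t j y = x_coroot j (- n) * mono_x y"
proof -
  have e: "refl (grad j) y = of_int (- n) *\<^sub>R coroot (grad j) + y"
    using n by (simp add: refl_def)
  show ?thesis
  proof (cases "j = 0")
    case False
    then show ?thesis using e by (simp add: s_op_def x_coroot_eq grad_def flip: mono_x_add)
  next
    case True
    then have "torus_at c t y (coroot highest_root) = q_root highest_root powi (- n)"
      using torus_at_highest_root[OF y, of "- n"] n by (simp add: grad_def)
    moreover have "refl (grad j) y = refl highest_root y" using True by (simp add: grad_def)
    ultimately show ?thesis using e True
      by (simp add: s_op_def x_coroot_eq mult.assoc flip: mono_x_add)
  qed
qed

lemma S_S: "j \<in> {0..r} \<Longrightarrow> p \<in> V \<Longrightarrow> S j (S j p) = p"
proof -
  assume j: "j \<in> {0..r}" and "p \<in> V"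
  from this(2) show ?thesis
  proof (induction rule: poly_space_induct)
    case (mono y)
    have lin: "lin_part (simple_refl j) y = refl (grad j) y"
      by (simp add: lin_part_def simple_refl_eq_refl)
    obtain a where a: "weyl_mono (simple_refl j) y = scal a * mono_x (refl (grad j) y)"
      using lin by (auto simp: weyl_mono_def)
    have "S j (S j (mono_x y)) = scal a * s_op c t j (refl (grad j) y)"
      using a s_op_eq[OF j mono] by (simp add: S_mono S_linear)
    also have "\<dots> = lin_ext (weyl_mono (simple_refl j)) (weyl_mono (simple_refl j) y)"
      using a s_op_eq[OF j orbit_refl[OF grad_root[OF j] mono]] by (simp add: lin_ext_scal)
    also have "\<dots> = weyl_mono (simple_refl j \<circ> simple_refl j) y"
      using weyl_mono_comp simple_refl_affine[OF j] mono by blast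
    also have "simple_refl j \<circ> simple_refl j = id" using simple_refl_simple_refl[OF j]
      by (simp add: fun_eq_iff)
    finally show ?case using weyl_mono_id[OF mono] by metis
  qed (simp_all add: S_linear)
qed

lemma indicator_aff: "(indicator \<int> (aff_root j y) :: nat) = (if grad j \<bullet> y \<in> \<int> then 1 else 0)"
proof -
  have "aff_root j y \<in> \<int> \<longleftrightarrow> grad j \<bullet> y \<in> \<int>"
    using Ints_diff[of "grad j \<bullet> y + of_int (shift j)" "of_int (shift j)"]
    by (auto simp: aff_root_eq)
  then show ?thesis by (simp add: indicator_def)
qed

lemma T_mono_eq:
  "T_mono j y = (if grad j \<bullet> y \<in> \<int> then scal (k_simple j) * s_op c t j y else s_op c t j y) +
     scal (kap j) * geom j (- \<lfloor>grad j \<bullet> y\<rfloor>) * mono_x y"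
  by (simp add: T_mono_def indicator_aff nabla_eq kap_def mult.assoc)

text \<open>The scalar by which \<open>T\<^sub>j\<close> differs from \<open>s\<^sub>j\<close> on \<open>x\<^sup>y\<close> if \<open>0 \<le> D\<alpha>\<^sub>j(y) \<le> 1\<close>.\<close>

definition gfac :: "nat \<Rightarrow> real \<Rightarrow> 'f" where
  "gfac j x = (if x = 0 then k_simple j else if x = 1 then inverse (k_simple j) else 1)"

lemma T_small_pos:
  assumes j: "j \<in> {0..r}" and y: "y \<in> Orb" and x: "0 \<le> grad j \<bullet> y" "grad j \<bullet> y \<le> 1"
  shows "T_mono j y = scal (gfac j (grad j \<bullet> y)) * s_op c t j y"
proof -
  consider "grad j \<bullet> y = 0" | "grad j \<bullet> y = 1" | "0 < grad j \<bullet> y" "grad j \<bullet> y < 1" using x by linarith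
  then show ?thesis
  proof cases
    case 1
    then show ?thesis using geom_values[OF j] by (simp add: T_mono_eq gfac_def)
  next
    case 2
    have s: "s_op c t j y = x_coroot j (- 1) * mono_x y" using s_op_int[OF j y, of 1] 2 by simp
    have "scal (k_simple j) - scal (kap j) = (scal (inverse (k_simple j)) :: 'a \<Rightarrow>\<^sub>0 'f)"
      by (simp add: kap_def flip: scal_diff)
    then show ?thesis using 2 geom_values[OF j] s
      by (simp add: T_mono_eq gfac_def algebra_simps flip: s)
  next
    case 3
    then have "grad j \<bullet> y \<notin> \<int>" by (auto elim!: Ints_cases)
    moreover have "\<lfloor>grad j \<bullet> y\<rfloor> = 0" using 3 by linarith
    ultimately show ?thesis using 3 geom_values[OF j] by (simp add: T_mono_eq gfac_def)
  qed
qed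

lemma T_small_neg:
  assumes j: "j \<in> {0..r}" and x: "- 1 \<le> grad j \<bullet> y" "grad j \<bullet> y < 0"
  shows "T_mono j y = scal (if grad j \<bullet> y = - 1 then k_simple j else 1) * s_op c t j y +
    scal (kap j) * mono_x y"
proof -
  have f: "\<lfloor>grad j \<bullet> y\<rfloor> = - 1" using x by linarith
  have "grad j \<bullet> y \<in> \<int> \<longleftrightarrow> grad j \<bullet> y = - 1"
  proof
    assume "grad j \<bullet> y \<in> \<int>"
    then have "grad j \<bullet> y = of_int \<lfloor>grad j \<bullet> y\<rfloor>" by (metis Ints_cases floor_of_int)
    then show "grad j \<bullet> y = - 1" using f by simp
  qed simp
  then show ?thesis using f geom_values[OF j] by (simp add: T_mono_eq)
qed

text \<open>
  The cross relation, on monomials and then on the whole space. The action of \<open>s\<^sub>j\<close> on \<open>x\<^sup>\<mu>\<close> is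
  multiplication by \<open>x\<^bsup>-n \<alpha>\<^sub>j\<^sup>\<or>\<^esup>\<close> where \<open>n = D\<alpha>\<^sub>j(\<mu>)\<close>.
\<close>

lemma T_mono_add:
  assumes j: "j \<in> {0..r}" and y: "y \<in> Orb" and mu: "\<mu> \<in> coroot_lattice \<Phi>" and n: "grad j \<bullet> \<mu> = of_int n"
  shows "T_mono j (\<mu> + y) = x_coroot j (- n) * mono_x \<mu> * T_mono j y +
    scal (kap j) * (geom j (- n) * mono_x \<mu>) * mono_x y"
proof -
  let ?f = "\<lfloor>grad j \<bullet> y\<rfloor>"
  have f: "\<lfloor>grad j \<bullet> (\<mu> + y)\<rfloor> = n + ?f" using n by (simp add: inner_add_right)
  have i: "grad j \<bullet> (\<mu> + y) \<in> \<int> \<longleftrightarrow> grad j \<bullet> y \<in> \<int>" using n by (simp add: inner_add_right)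
  have g: "geom j (- (n + ?f)) = geom j (- n) + x_coroot j (- n) * geom j (- ?f)"
    using geom_add[OF j, of "- n" "- ?f"] by simp
  show ?thesis unfolding T_mono_eq f i g s_op_add[OF assms]
    by (simp add: mono_x_add algebra_simps)
qed

lemma T_mult_mono:
  assumes j: "j \<in> {0..r}" and mu: "\<mu> \<in> coroot_lattice \<Phi>" and n: "grad j \<bullet> \<mu> = of_int n" and p: "p \<in> V"
  shows "T j (mono_x \<mu> * p) = x_coroot j (- n) * mono_x \<mu> * T j p +
    scal (kap j) * (geom j (- n) * mono_x \<mu>) * p"
  using p
proof (induction rule: poly_space_induct)
  case (mono y)
  show ?case using T_mono_add[OF j mono mu n] by (simp add: T_mono_x flip: mono_x_add)
next
  case (scal a u)
  have "T j (mono_x \<mu> * (scal a * u)) = scal a * T j (mono_x \<mu> * u)"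
    by (metis T_linear(4) mult.left_commute)
  then show ?case unfolding scal T_linear(4) by (simp add: algebra_simps)
qed (simp add: T_linear distrib_left)

lemma T_mult_scal_mono:
  assumes j: "j \<in> {0..r}" and mu: "\<mu> \<in> coroot_lattice \<Phi>" and n: "grad j \<bullet> \<mu> = of_int n" and p: "p \<in> V"
    and M: "M = scal a * mono_x \<mu>"
  shows "T j (M * p) = x_coroot j (- n) * M * T j p + scal (kap j) * (geom j (- n) * M) * p"
proof -
  have "T j (M * p) = scal a * T j (mono_x \<mu> * p)"
    unfolding M mult.assoc T_linear ..
  then show ?thesis unfolding T_mult_mono[OF j mu n p] M by (simp add: algebra_simps)
qed

lemma T_cross:
  assumes j: "j \<in> {0..r}" and mu: "\<mu> \<in> coroot_lattice \<Phi>" and p: "p \<in> V"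
  shows "T j (mono_x \<mu> * p) = act_mono (simple_refl j) \<mu> * T j p +
    scal (k_simple j - inverse (k_simple j)) *
      exact_div (mono_x \<mu> - act_mono (simple_refl j) \<mu>) (1 - x_coroot j 1) * p"
    "Poly_Mapping.keys (act_mono (simple_refl j) \<mu>) \<subseteq> coroot_lattice \<Phi>"
    "Poly_Mapping.keys (exact_div (mono_x \<mu> - act_mono (simple_refl j) \<mu>) (1 - x_coroot j 1))
       \<subseteq> coroot_lattice \<Phi>"
proof -
  obtain n where n: "grad j \<bullet> \<mu> = of_int n" using lattice_root_int[OF mu grad_root[OF j]]
    Ints_cases by metis
  have kk: "Poly_Mapping.keys (f * mono_x \<mu>) \<subseteq> coroot_lattice \<Phi>"
    if "Poly_Mapping.keys f \<subseteq> coroot_lattice \<Phi>" for f :: "'a \<Rightarrow>\<^sub>0 'f"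
    using keys_mult[of f "mono_x \<mu>"] that lattice_add[OF _ mu] by (fastforce simp: keys_mono_x)
  have d: "exact_div (mono_x \<mu> - act_mono (simple_refl j) \<mu>) (1 - x_coroot j 1) = geom j (- n) *
    mono_x \<mu>"
  proof (rule exact_div_eq[OF j])
    have "geom j (- n) * mono_x \<mu> * (1 - x_coroot j 1) = geom j (- n) * (1 - x_coroot j 1) * mono_x \<mu>"
      by (simp add: mult_ac)
    then show "geom j (- n) * mono_x \<mu> * (1 - x_coroot j 1) = mono_x \<mu> - act_mono (simple_refl j) \<mu>"
      by (simp only: act_mono_eq[OF j mu n] geom_mult[OF j]) (simp add: algebra_simps)
  qed
  show "T j (mono_x \<mu> * p) = act_mono (simple_refl j) \<mu> * T j p +
    scal (k_simple j - inverse (k_simple j)) *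
      exact_div (mono_x \<mu> - act_mono (simple_refl j) \<mu>) (1 - x_coroot j 1) * p"
    unfolding d unfolding act_mono_eq[OF j mu n] using T_mult_mono[OF j mu n p] by (simp add: kap_def)
  show "Poly_Mapping.keys (act_mono (simple_refl j) \<mu>) \<subseteq> coroot_lattice \<Phi>"
    unfolding act_mono_eq[OF j mu n] by (rule kk[OF x_coroot_keys[OF j]])
  show "Poly_Mapping.keys (exact_div (mono_x \<mu> - act_mono (simple_refl j) \<mu>) (1 - x_coroot j 1))
       \<subseteq> coroot_lattice \<Phi>"
    unfolding d by (rule kk[OF geom_keys[OF j]])
qed

section \<open>The quadratic relation\<close>

lemma T_x_coroot:
  assumes j: "j \<in> {0..r}" and p: "p \<in> V"
  shows "T j (x_coroot j 1 * p) = x_coroot j (- 1) * (T j p - scal (kap j) * p) - scal (kap j) * p"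
    "T j (x_coroot j (- 1) * p) = x_coroot j 1 * T j p + scal (kap j) * (1 + x_coroot j (- 1)) * p"
proof -
  have g2: "grad j \<bullet> (of_int n *\<^sub>R coroot (grad j)) = of_int (2 * n)" for n
    using self_inner_coroot[OF root_nz[OF grad_root[OF j]]] by simp
  note L = lattice_scale[OF lattice_coroot[OF grad_root[OF j]]]
  have e: "x_coroot j (- 2) * x_coroot j 1 = x_coroot j (- 1)"
    "x_coroot j 2 * x_coroot j (- 1) = x_coroot j 1"
    by (simp_all flip: x_coroot_add)
  have e': "x_coroot j (- 2) * (x_coroot j 1 * u) = x_coroot j (- 1) * u"
    "x_coroot j 2 * (x_coroot j (- 1) * u) = x_coroot j 1 * u"
    "x_coroot j (- 1) * (x_coroot j 1 * u) = u" "x_coroot j 1 * (x_coroot j (- 1) * u) = u" for u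
    by (simp_all add: e flip: mult.assoc)
  show "T j (x_coroot j 1 * p) = x_coroot j (- 1) * (T j p - scal (kap j) * p) - scal (kap j) * p"
    unfolding T_mult_scal_mono[OF j L g2[of 1] p x_coroot_eq]
    by (simp add: geom_values[OF j] left_diff_distrib right_diff_distrib mult.assoc e e')
       (simp add: mult_ac e)?
  show "T j (x_coroot j (- 1) * p) = x_coroot j 1 * T j p + scal (kap j) * (1 + x_coroot j (- 1)) * p"
    unfolding T_mult_scal_mono[OF j L g2[of "- 1"] p x_coroot_eq]
    by (simp add: geom_values[OF j] distrib_right distrib_left mult.assoc e e')
       (simp add: mult_ac e)?
qed

text \<open>
  The defect of the quadratic relation commutes with multiplication by \<open>x\<^bsup>\<alpha>\<^sub>j\<^sup>\<or>\<^esup>\<close>, so it only has to be checked on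
  the exponents with \<open>-1 \<le> D\<alpha>\<^sub>j(y) < 1\<close>.
\<close>

lemma T_quadratic_shift:
  assumes j: "j \<in> {0..r}" and p: "p \<in> V"
  shows "T j (T j (x_coroot j 1 * p)) - scal (kap j) * T j (x_coroot j 1 * p) - x_coroot j 1 * p =
    x_coroot j 1 * (T j (T j p) - scal (kap j) * T j p - p)"
proof -
  have Tp: "T j p \<in> V" and d: "T j p - scal (kap j) * p \<in> V"
    using T_space[OF j p] p by (auto intro: poly_space_diff poly_space_scal)
  have e: "x_coroot j (- 1) * (x_coroot j 1 * u) = u" "x_coroot j 1 * (x_coroot j (- 1) * u) = u" for u
    by (simp_all flip: mult.assoc)
  show ?thesis
    unfolding T_x_coroot[OF j p] T_linear T_x_coroot[OF j d]
    by (simp add: distrib_right right_diff_distrib left_diff_distrib distrib_left e mult.assoc)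
       (simp add: mult_ac e)?
qed

lemma T_quadratic_small:
  assumes j: "j \<in> {0..r}" and y: "y \<in> Orb" and x: "- 1 \<le> grad j \<bullet> y" "grad j \<bullet> y < 1"
  shows "T j (T j (mono_x y)) - scal (kap j) * T j (mono_x y) - mono_x y = 0"
proof -
  let ?k = "k_simple j" and ?z = "refl (grad j) y"
  have k0: "?k \<noteq> 0" by (rule k_simple_nonzero[OF j])
  obtain a where a: "s_op c t j y = scal a * mono_x ?z" using s_op_scal[OF j] by metis
  have z: "?z \<in> Orb" by (rule orbit_refl[OF grad_root[OF j] y])
  have gz: "grad j \<bullet> ?z = - (grad j \<bullet> y)" by (metis inner_minus_left inner_refl_left refl_self)
  have ss: "scal a * s_op c t j ?z = mono_x y"
    using S_S[OF j poly_space_mono[OF y]] a by (simp add: S_mono S_linear)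
  have ss': "scal b * (scal a * s_op c t j ?z) = scal b * mono_x y" for b using ss by simp
  have kk: "scal ?k * (scal ?k * u) = scal (kap j) * (scal ?k * u) + (u :: 'a \<Rightarrow>\<^sub>0 'f)" for u
  proof -
    have "?k * ?k = kap j * ?k + 1" using k0 by (simp add: kap_def algebra_simps)
    then have "scal (?k * ?k) * u = scal (kap j * ?k + 1) * u" by simp
    then show ?thesis by (simp add: scal_add distrib_right mult.assoc flip: scal_mult)
  qed
  have ki: "scal ?k * (scal (inverse ?k) * u) = (u :: 'a \<Rightarrow>\<^sub>0 'f)" for u
    using k0 by (simp add: scal_mult flip: mult.assoc)
  consider "grad j \<bullet> y = 0" | "grad j \<bullet> y = - 1" | "0 < grad j \<bullet> y" | "- 1 < grad j \<bullet> y"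
    "grad j \<bullet> y < 0"
    using x by linarith
  then show ?thesis
  proof cases
    case 1
    then have s: "s_op c t j y = mono_x y" using s_op_int[OF j y, of 0] by simp
    then have "T j (mono_x y) = scal ?k * mono_x y"
      using T_small_pos[OF j y] 1 by (simp add: T_mono_x gfac_def)
    then show ?thesis using kk[of "mono_x y"] by (simp add: T_linear)
  next
    case 2
    have Ty: "T j (mono_x y) = scal ?k * s_op c t j y + scal (kap j) * mono_x y"
      using T_small_neg[OF j] 2 by (simp add: T_mono_x)
    have "T_mono j ?z = scal (inverse ?k) * s_op c t j ?z"
      using T_small_pos[OF j z] gz 2 by (simp add: gfac_def)
    then have "T j (s_op c t j y) = scal (inverse ?k) * mono_x y"
      using ss'[of "inverse ?k"] by (simp add: a T_scal_mono mult.left_commute)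
    then have "T j (T j (mono_x y)) = mono_x y + scal (kap j) * T j (mono_x y)"
      using ki by (simp add: Ty T_linear)
    then show ?thesis by simp
  next
    case 3
    then have Ty: "T j (mono_x y) = s_op c t j y"
      using T_small_pos[OF j y] x by (simp add: T_mono_x gfac_def)
    have "T_mono j ?z = s_op c t j ?z + scal (kap j) * mono_x ?z"
      using T_small_neg[OF j, of ?z] gz 3 x by simp
    then have "T j (s_op c t j y) = mono_x y + scal (kap j) * s_op c t j y"
      using ss by (simp add: a T_scal_mono algebra_simps)
    then show ?thesis by (simp add: Ty)
  next
    case 4
    then have Ty: "T j (mono_x y) = s_op c t j y + scal (kap j) * mono_x y"
      using T_small_neg[OF j] by (simp add: T_mono_x)
    have "T_mono j ?z = s_op c t j ?z"
      using T_small_pos[OF j z] gz 4 by (simp add: gfac_def)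
    then have "T j (s_op c t j y) = mono_x y"
      using ss by (simp add: a T_scal_mono)
    then have "T j (T j (mono_x y)) = mono_x y + scal (kap j) * T j (mono_x y)"
      by (simp add: Ty T_linear)
    then show ?thesis by simp
  qed
qed

lemma T_quadratic:
  assumes j: "j \<in> {0..r}" and p: "p \<in> V"
  shows "T j (T j p) = scal (kap j) * T j p + p"
proof -
  define Q where "Q p = T j (T j p) - scal (kap j) * T j p - p" for p
  have Q_shift: "Q (x_coroot j 1 * p) = x_coroot j 1 * Q p" if "p \<in> V" for p
    unfolding Q_def by (rule T_quadratic_shift[OF j that])
  have Q_lin: "Q (u + v) = Q u + Q v" "Q (scal a * u) = scal a * Q u" for u v a
    by (simp_all add: Q_def T_linear right_diff_distrib distrib_left mult.left_commute)
  have xx: "x_coroot j n * mono_x y = scal ((if j = 0 then q_root highest_root else 1) powi n) *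
      mono_x (y + of_int n *\<^sub>R coroot (grad j))" for n y
    by (simp add: x_coroot_eq mono_x_add mult_ac)
  have gen: "Q (x_coroot j n * mono_x y) = 0" if y: "y \<in> Orb" and x: "- 1 \<le> grad j \<bullet> y"
    "grad j \<bullet> y < 1" for y n
  proof -
    have sp: "x_coroot j n * mono_x y \<in> V" for n
      by (intro poly_space_mult x_coroot_keys[OF j] poly_space_mono y)
    have step: "x_coroot j (i + 1) * mono_x y = x_coroot j 1 * (x_coroot j i * mono_x y)" for i
      by (simp add: x_coroot_add mult_ac)
    show ?thesis
    proof (induction n rule: int_induct[where k = 0])
      case base
      then show ?case using T_quadratic_small[OF j y x] by (simp add: Q_def)
    next
      case (step1 i)
      then show ?case using Q_shift[OF sp, of i] step by simp
    next
      case (step2 i)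
      have "x_coroot j 1 * Q (x_coroot j (i - 1) * mono_x y) = 0"
        using Q_shift[OF sp, of "i - 1"] step[of "i - 1"] step2 by simp
      then have "x_coroot j (- 1) * (x_coroot j 1 * Q (x_coroot j (i - 1) * mono_x y)) = 0" by simp
      then show ?case by (simp flip: mult.assoc)
    qed
  qed
  have "Q p = 0"
    using p
  proof (induction rule: poly_space_induct)
    case (mono y)
    \<comment> \<open>Subtracting \<open>n\<close> times the coroot moves the value of \<open>D\<alpha>\<^sub>j\<close> into \<open>[-1, 1)\<close>.\<close>
    define n where "n = \<lfloor>(grad j \<bullet> y + 1) / 2\<rfloor>"
    let ?g = "coroot (grad j)" and ?q = "(if j = 0 then q_root highest_root else 1) powi n"
    let ?z = "y - of_int n *\<^sub>R ?g"
    have gz: "grad j \<bullet> ?z = grad j \<bullet> y - 2 * of_int n"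
      using self_inner_coroot[OF root_nz[OF grad_root[OF j]]] by (simp add: inner_diff_right)
    have n: "of_int n \<le> (grad j \<bullet> y + 1) / 2" "(grad j \<bullet> y + 1) / 2 < of_int n + 1"
      unfolding n_def by linarith+
    have "?z \<in> Orb"
      using orbit_add[OF lattice_neg[OF lattice_scale[OF lattice_coroot[OF grad_root[OF j]]]]
        mono] by simp
    then have "Q (x_coroot j n * mono_x ?z) = 0"
    proof (rule gen)
      show "- 1 \<le> grad j \<bullet> ?z" unfolding gz using n by simp
      show "grad j \<bullet> ?z < 1" unfolding gz using n by simp
    qed
    then have "scal ?q * Q (mono_x y) = 0" by (simp add: xx Q_lin)
    moreover have "?q \<noteq> 0" using q_root_nonzero by simp
    then have "scal (inverse ?q) * scal ?q = (1 :: 'a \<Rightarrow>\<^sub>0 'f)"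
      by (simp only: scal_mult left_inverse scal_one not_False_eq_True)
    then have "Q (mono_x y) = scal (inverse ?q) * (scal ?q * Q (mono_x y))"
      by (simp only: mult_1 flip: mult.assoc)
    ultimately show ?case by (simp only: mult_zero_right)
  qed (simp_all add: Q_lin)
  then show ?thesis by (simp add: Q_def algebra_simps)
qed

end

section \<open>Pairs of operators with quadratic relations\<close>

text \<open>
  Two linear operators \<open>A\<close>, \<open>B\<close> on a subspace \<open>V\<close> satisfying quadratic relations with
  \<open>A - A\<^sup>-\<^sup>1 = x\<close> and \<open>B - B\<^sup>-\<^sup>1 = y\<close>. The scalars are elements of the ring that contains \<open>V\<close>.
\<close>

locale quadratic_pair =
  fixes V :: "'v::comm_ring_1 set" and A B :: "'v \<Rightarrow> 'v" and x y :: 'v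
  assumes A_add: "A (u + v) = A u + A v" and B_add: "B (u + v) = B u + B v"
    and A_x: "A (x * u) = x * A u" and A_y: "A (y * u) = y * A u"
    and B_x: "B (x * u) = x * B u" and B_y: "B (y * u) = y * B u"
    and A_V: "u \<in> V \<Longrightarrow> A u \<in> V" and B_V: "u \<in> V \<Longrightarrow> B u \<in> V"
    and V_diff: "u \<in> V \<Longrightarrow> v \<in> V \<Longrightarrow> u - v \<in> V"
    and V_x: "u \<in> V \<Longrightarrow> x * u \<in> V" and V_y: "u \<in> V \<Longrightarrow> y * u \<in> V"
    and A_quadratic: "u \<in> V \<Longrightarrow> A (A u) = x * A u + u"
    and B_quadratic: "u \<in> V \<Longrightarrow> B (B u) = y * B u + u"
begin

lemma A_diff: "A (u - v) = A u - A v"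
  using A_add[of "u - v" v] by (simp add: algebra_simps)

lemma B_diff: "B (u - v) = B u - B v"
  using B_add[of "u - v" v] by (simp add: algebra_simps)

text \<open>The inverses of the two operators.\<close>

definition Ai :: "'v \<Rightarrow> 'v" where "Ai u = A u - x * u"
definition Bi :: "'v \<Rightarrow> 'v" where "Bi u = B u - y * u"

lemma Ai_V: "u \<in> V \<Longrightarrow> Ai u \<in> V" by (simp add: Ai_def V_diff A_V V_x)
lemma Bi_V: "u \<in> V \<Longrightarrow> Bi u \<in> V" by (simp add: Bi_def V_diff B_V V_y)

lemma A_Ai: "u \<in> V \<Longrightarrow> A (Ai u) = u" "u \<in> V \<Longrightarrow> Ai (A u) = u"
  by (simp_all add: Ai_def A_diff A_x A_quadratic)

lemma B_Bi: "u \<in> V \<Longrightarrow> B (Bi u) = u" "u \<in> V \<Longrightarrow> Bi (B u) = u"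
  by (simp_all add: Bi_def B_diff B_y B_quadratic)

text \<open>
  The alternating product of \<open>m\<close> factors, beginning with \<open>A\<close> if the flag is set and with \<open>B\<close>
  otherwise.
\<close>

fun alt :: "bool \<Rightarrow> nat \<Rightarrow> 'v \<Rightarrow> 'v" where
  "alt s 0 u = u"
| "alt s (Suc m) u = (if s then A (alt (\<not> s) m u) else B (alt (\<not> s) m u))"

text \<open>The subspace on which the braid relation with \<open>m\<close> factors holds.\<close>

definition braid_ker :: "nat \<Rightarrow> 'v set" where
  "braid_ker m = {u \<in> V. alt True m u = alt False m u}"

lemma braid_ker_V: "u \<in> braid_ker m \<Longrightarrow> u \<in> V"
  by (simp add: braid_ker_def)

lemma alt_numerals:
  "alt True 2 u = A (B u)"
  "alt False 2 u = B (A u)"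
  "alt True 3 u = A (B (A u))"
  "alt False 3 u = B (A (B u))"
  "alt True 4 u = A (B (A (B u)))"
  "alt False 4 u = B (A (B (A u)))"
  "alt True 6 u = A (B (A (B (A (B u)))))"
  "alt False 6 u = B (A (B (A (B (A u)))))"
  by (simp_all add: numeral_eq_Suc One_nat_def)

lemmas unfold_ker = braid_ker_def alt_numerals

lemmas V_simps = A_V B_V Ai_V Bi_V

text \<open>Where the braid relation holds, it still holds after applying \<open>A\<close> or \<open>B\<close>.\<close>

lemma braid_ker_A:
  assumes "u \<in> braid_ker m" and "m \<in> {2, 4, 6} \<or> m = 3 \<and> x = y"
  shows "A u \<in> braid_ker m" "B u \<in> braid_ker m"
proof -
  have u: "u \<in> V" using assms braid_ker_V by blast
  note S = A_V B_V u A_quadratic B_quadratic A_add B_add A_x A_y B_x B_y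
  consider "m = 2" | "m = 3" "x = y" | "m = 4" | "m = 6" using assms(2) by blast
  then have "A u \<in> braid_ker m \<and> B u \<in> braid_ker m"
  proof cases
    case 1
    then have e: "A (B u) = B (A u)" using assms(1) by (simp add: unfold_ker)
    have "A (B (A u)) = B (A (A u))"
      using e[symmetric] by (simp add: S)
    moreover have "A (B (B u)) = B (A (B u))"
      using e by (simp add: S)
    ultimately show ?thesis using 1 by (simp add: unfold_ker S)
  next
    case 2
    then have e: "A (B (A u)) = B (A (B u))" using assms(1) by (simp add: unfold_ker)
    have "A (B (A (A u))) = B (A (B (A u)))"
      using e 2 by (simp add: S)
    moreover have "A (B (A (B u))) = B (A (B (B u)))"
      using e[symmetric] 2 by (simp add: S)
    ultimately show ?thesis using 2 by (simp add: unfold_ker S)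
  next
    case 3
    then have e: "A (B (A (B u))) = B (A (B (A u)))" using assms(1) by (simp add: unfold_ker)
    have "A (B (A (B (A u)))) = B (A (B (A (A u))))"
      using e[symmetric] by (simp add: S)
    moreover have "A (B (A (B (B u)))) = B (A (B (A (B u))))"
      using e by (simp add: S)
    ultimately show ?thesis using 3 by (simp add: unfold_ker S)
  next
    case 4
    then have e: "A (B (A (B (A (B u))))) = B (A (B (A (B (A u)))))"
      using assms(1) by (simp add: unfold_ker)
    have "A (B (A (B (A (B (A u)))))) = B (A (B (A (B (A (A u))))))"
      using e[symmetric] by (simp add: S)
    moreover have "A (B (A (B (A (B (B u)))))) = B (A (B (A (B (A (B u))))))"
      using e by (simp add: S)
    ultimately show ?thesis using 4 by (simp add: unfold_ker S)
  qed
  then show "A u \<in> braid_ker m" "B u \<in> braid_ker m" by auto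
qed

lemma alt_add: "alt s m (u + v) = alt s m u + alt s m v"
  by (induction m arbitrary: s) (auto simp: A_add B_add)

lemma alt_diff: "alt s m (u - v) = alt s m u - alt s m v"
  by (induction m arbitrary: s) (auto simp: A_diff B_diff)

lemma braid_ker_diff: "u \<in> braid_ker m \<Longrightarrow> v \<in> braid_ker m \<Longrightarrow> u - v \<in> braid_ker m"
  by (simp add: braid_ker_def alt_diff V_diff)

lemma alt_scalar:
  assumes "\<And>u. A (z * u) = z * A u" "\<And>u. B (z * u) = z * B u"
  shows "alt s m (z * u) = z * alt s m u"
  by (induction m arbitrary: s) (auto simp: assms)

lemma braid_ker_scalar:
  assumes "\<And>u. A (z * u) = z * A u" "\<And>u. B (z * u) = z * B u" "\<And>u. u \<in> V \<Longrightarrow> z * u \<in> V"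
    and "u \<in> braid_ker m"
  shows "z * u \<in> braid_ker m"
  using assms by (simp add: braid_ker_def alt_scalar)

lemma braid_ker_Ai:
  assumes "u \<in> braid_ker m" and "m \<in> {2, 4, 6} \<or> m = 3 \<and> x = y"
  shows "Ai u \<in> braid_ker m" "Bi u \<in> braid_ker m"
  unfolding Ai_def Bi_def
  using braid_ker_A[OF assms] braid_ker_scalar[OF A_x B_x V_x assms(1)]
    braid_ker_scalar[OF A_y B_y V_y assms(1)]
  by (auto intro: braid_ker_diff)

lemma braid_ker_A_iff:
  assumes "u \<in> V" and m: "m \<in> {2, 4, 6} \<or> m = 3 \<and> x = y"
  shows "A u \<in> braid_ker m \<longleftrightarrow> u \<in> braid_ker m" "B u \<in> braid_ker m \<longleftrightarrow> u \<in> braid_ker m"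
  using braid_ker_A[OF _ m] braid_ker_Ai[OF _ m] A_Ai B_Bi assms(1) by metis+

text \<open>
  For even \<open>m\<close> the braid relation says that \<open>A\<close> (or \<open>B\<close>) commutes with the palindrome \<open>C\<close> of length
  \<open>m - 1\<close> in the two operators, equivalently with its inverse.
\<close>

lemma commute_inverse:
  assumes C: "\<And>u. u \<in> V \<Longrightarrow> C u \<in> V" "\<And>u. u \<in> V \<Longrightarrow> Ci u \<in> V"
    and inv: "\<And>u. u \<in> V \<Longrightarrow> C (Ci u) = u" "\<And>u. u \<in> V \<Longrightarrow> Ci (C u) = u"
    and D: "\<And>u. u \<in> V \<Longrightarrow> D u \<in> V"
    and ker: "\<And>u. u \<in> V \<Longrightarrow> C u \<in> braid_ker m \<longleftrightarrow> u \<in> braid_ker m"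
    and comm: "\<And>u. u \<in> V \<Longrightarrow> u \<in> braid_ker m \<longleftrightarrow> D (C u) = C (D u)"
    and u: "u \<in> V"
  shows "u \<in> braid_ker m \<longleftrightarrow> D (Ci u) = Ci (D u)"
proof -
  let ?v = "Ci u"
  have "u \<in> braid_ker m \<longleftrightarrow> ?v \<in> braid_ker m" using ker[OF C(2)[OF u]] inv(1)[OF u] by simp
  also have "\<dots> \<longleftrightarrow> D u = C (D ?v)" using comm[OF C(2)[OF u]] inv(1)[OF u] by simp
  also have "\<dots> \<longleftrightarrow> D ?v = Ci (D u)" using inv C D u by metis
  finally show ?thesis .
qed

text \<open>
  If moreover \<open>C (X u) = X' (C\<^sup>-\<^sup>1 u) - z u\<close> for invertible multiplication operators \<open>X\<close> and \<open>X'\<close>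
  that commute with \<open>D\<close>, then the braid relation holds at \<open>X u\<close> if and only if it holds at \<open>u\<close>.
\<close>

lemma braid_ker_shift:
  assumes C: "\<And>u. u \<in> V \<Longrightarrow> C u \<in> V" "\<And>u. u \<in> V \<Longrightarrow> Ci u \<in> V"
    and inv: "\<And>u. u \<in> V \<Longrightarrow> C (Ci u) = u" "\<And>u. u \<in> V \<Longrightarrow> Ci (C u) = u"
    and D: "\<And>u. u \<in> V \<Longrightarrow> D u \<in> V"
    and ker: "\<And>u. u \<in> V \<Longrightarrow> C u \<in> braid_ker m \<longleftrightarrow> u \<in> braid_ker m"
    and comm: "\<And>u. u \<in> V \<Longrightarrow> u \<in> braid_ker m \<longleftrightarrow> D (C u) = C (D u)"
    and X: "\<And>u. u \<in> V \<Longrightarrow> X * u \<in> V" "X * X' = 1"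
    and CX: "\<And>u. u \<in> V \<Longrightarrow> C (X * u) = X' * Ci u - z * u"
    and DX: "\<And>u. u \<in> V \<Longrightarrow> D (X * u) = X * D u" "\<And>u. u \<in> V \<Longrightarrow> D (X' * u) = X' * D u"
    and Dl: "\<And>u v. D (u - v) = D u - D v" "\<And>u. D (z * u) = z * D u"
    and u: "u \<in> V"
  shows "X * u \<in> braid_ker m \<longleftrightarrow> u \<in> braid_ker m"
proof -
  have "X * u \<in> braid_ker m \<longleftrightarrow> D (C (X * u)) = C (D (X * u))" using comm X u by blast
  also have "D (C (X * u)) = X' * D (Ci u) - z * D u" using CX DX Dl C u by simp
  also have "C (D (X * u)) = X' * Ci (D u) - z * D u" using CX DX D u by simp
  also have "X' * D (Ci u) - z * D u = X' * Ci (D u) - z * D u \<longleftrightarrow> X' * D (Ci u) = X' * Ci (D u)"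
    by simp
  also have "\<dots> \<longleftrightarrow> D (Ci u) = Ci (D u)"
    using X(2) by (metis mult.assoc mult_1)
  also have "\<dots> \<longleftrightarrow> u \<in> braid_ker m"
    using commute_inverse[OF C inv D ker comm u] by simp
  finally show ?thesis .
qed

text \<open>
  The four types of rank two systems. Here \<open>X\<close> and \<open>Y\<close> are the monomials of the two simple coroots, with
  inverses \<open>X'\<close> and \<open>Y'\<close>, and \<open>A\<close> belongs to the longer simple root if the lengths differ. A relation
  \<open>A M = N A\<^sup>-\<^sup>1\<close> holds for a lattice monomial \<open>M\<close> on which the root of \<open>A\<close> takes the value \<open>1\<close>, and
  \<open>A M = M A\<close> if the value is \<open>0\<close>; likewise for \<open>B\<close>. The monomial to which the argument above
  applies is the one of the highest short coroot: \<open>X Y\<close> for \<open>m = 3, 4\<close> and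
  \<open>X X Y\<close> for \<open>m = 6\<close>; the other ones are reached from it by the two operators.
\<close>

lemma braid_ker_shift_2:
  assumes X: "\<And>u. u \<in> V \<Longrightarrow> X * u \<in> V" "X * X' = 1"
    and AX: "\<And>u. u \<in> V \<Longrightarrow> A (X * u) = X' * Ai u - x * u"
    and BX: "\<And>u. u \<in> V \<Longrightarrow> B (X * u) = X * B u" "\<And>u. u \<in> V \<Longrightarrow> B (X' * u) = X' * B u"
    and u: "u \<in> V"
  shows "X * u \<in> braid_ker 2 \<longleftrightarrow> u \<in> braid_ker 2"
proof (rule braid_ker_shift[where C = A and Ci = Ai and D = B and X = X and X' = X' and z = x])
  show "A u \<in> braid_ker 2 \<longleftrightarrow> u \<in> braid_ker 2" if "u \<in> V" for u
    using braid_ker_A_iff[OF that, of 2] by simp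
qed (use assms in \<open>auto simp: A_Ai V_simps B_diff B_x unfold_ker\<close>)

lemma braid_ker_shift_3:
  assumes xy: "x = y"
    and X: "\<And>u. u \<in> V \<Longrightarrow> X * u \<in> V" "\<And>u. u \<in> V \<Longrightarrow> Y * u \<in> V" "X * X' = 1" "Y * Y' = 1"
      "\<And>u. u \<in> V \<Longrightarrow> X' * u \<in> V" "\<And>u. u \<in> V \<Longrightarrow> Y' * u \<in> V"
    and AX: "\<And>u. u \<in> V \<Longrightarrow> A (X * u) = X' * Ai u - x * u"
      "\<And>u. u \<in> V \<Longrightarrow> A (X * Y * u) = Y * Ai u"
      "\<And>u. u \<in> V \<Longrightarrow> A (Y' * u) = X' * Y' * Ai u"
    and BX: "\<And>u. u \<in> V \<Longrightarrow> B (Y * u) = Y' * Bi u - y * u"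
      "\<And>u. u \<in> V \<Longrightarrow> B (X * Y * u) = X * Bi u"
      "\<And>u. u \<in> V \<Longrightarrow> B (X' * u) = X' * Y' * Bi u"
    and u: "u \<in> V"
  shows "X * u \<in> braid_ker 3 \<longleftrightarrow> u \<in> braid_ker 3" "Y * u \<in> braid_ker 3 \<longleftrightarrow> u \<in> braid_ker 3"
proof -
  let ?K = "braid_ker 3"
  have m: "(3::nat) \<in> {2, 4, 6} \<or> (3::nat) = 3 \<and> x = y" using xy by simp
  note iff = braid_ker_A_iff[OF _ m]
  have K: "u \<in> ?K \<longleftrightarrow> u \<in> V \<and> A (B (A u)) = B (A (B u))" for u by (simp add: unfold_ker)
  have Ki: "u \<in> ?K \<longleftrightarrow> Ai (Bi (Ai u)) = Bi (Ai (Bi u))" if u: "u \<in> V" for u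
  proof -
    let ?v = "Ai (Bi (Ai u))"
    have v: "?v \<in> V" using u by (simp add: V_simps)
    have "A (B (A ?v)) = u" using u by (simp add: A_Ai B_Bi V_simps)
    then have "u \<in> ?K \<longleftrightarrow> ?v \<in> ?K" using iff v A_V B_V by metis
    also have "\<dots> \<longleftrightarrow> u = B (A (B ?v))" using K v \<open>A (B (A ?v)) = u\<close> by simp
    also have "\<dots> \<longleftrightarrow> ?v = Bi (Ai (Bi u))" using u v A_Ai B_Bi V_simps by metis
    finally show ?thesis .
  qed
  have XY: "X * Y * u \<in> ?K \<longleftrightarrow> u \<in> ?K" if u: "u \<in> V" for u
  proof -
    have v: "X * Y * u \<in> V" using X u by (simp add: mult.assoc)
    have "A (B (A (X * Y * u))) = X' * Y' * Ai (Bi (Ai u)) - y * u"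
      using AX BX u by (simp add: A_diff V_simps A_y A_Ai B_Bi)
    moreover have "B (A (B (X * Y * u))) = X' * Y' * Bi (Ai (Bi u)) - x * u"
      using AX BX u by (simp add: B_diff V_simps B_x A_Ai B_Bi)
    ultimately have "X * Y * u \<in> ?K \<longleftrightarrow> X' * Y' * Ai (Bi (Ai u)) = X' * Y' * Bi (Ai (Bi u))"
      using K v xy by simp
    also have "\<dots> \<longleftrightarrow> Ai (Bi (Ai u)) = Bi (Ai (Bi u))"
    proof -
      have "X * Y * (X' * Y' * w) = w" for w
      proof -
        have "X * Y * (X' * Y' * w) = (X * X') * (Y * Y') * w" by (simp only: mult_ac)
        then show ?thesis using X by simp
      qed
      then show ?thesis by metis
    qed
    finally show ?thesis using Ki u by simp
  qed
  have "A (X * Y * A u) = Y * u" using AX(2) u by (simp add: V_simps A_Ai)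
  moreover have "X * Y * A u \<in> V" using X u V_simps by (simp add: mult.assoc)
  ultimately show "Y * u \<in> ?K \<longleftrightarrow> u \<in> ?K" using XY iff u A_V by metis
  have "B (X * Y * B u) = X * u" using BX(2) u by (simp add: V_simps B_Bi)
  moreover have "X * Y * B u \<in> V" using X u V_simps by (simp add: mult.assoc)
  ultimately show "X * u \<in> ?K \<longleftrightarrow> u \<in> ?K" using XY iff u B_V by metis
qed

lemma braid_ker_shift_4:
  assumes X: "\<And>u. u \<in> V \<Longrightarrow> X * u \<in> V" "\<And>u. u \<in> V \<Longrightarrow> Y * u \<in> V" "X * X' = 1" "Y * Y' = 1"
      "\<And>u. u \<in> V \<Longrightarrow> X' * u \<in> V" "\<And>u. u \<in> V \<Longrightarrow> Y' * u \<in> V"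
    and AX: "\<And>u. u \<in> V \<Longrightarrow> A (X * u) = X' * Ai u - x * u"
      "\<And>u. u \<in> V \<Longrightarrow> A (X * Y * u) = X * Y * A u"
      "\<And>u. u \<in> V \<Longrightarrow> A (X' * Y' * u) = X' * Y' * A u"
    and BX: "\<And>u. u \<in> V \<Longrightarrow> B (X * Y * u) = X * Bi u"
      "\<And>u. u \<in> V \<Longrightarrow> B (X' * u) = X' * Y' * Bi u"
    and u: "u \<in> V"
  shows "X * u \<in> braid_ker 4 \<longleftrightarrow> u \<in> braid_ker 4" "Y * u \<in> braid_ker 4 \<longleftrightarrow> u \<in> braid_ker 4"
proof -
  let ?K = "braid_ker 4"
  have m: "(4::nat) \<in> {2, 4, 6} \<or> (4::nat) = 3 \<and> x = y" by simp
  note iff = braid_ker_A_iff[OF _ m]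
  have XY: "X * Y * u \<in> ?K \<longleftrightarrow> u \<in> ?K" if u: "u \<in> V" for u
  proof (rule braid_ker_shift[where C = "\<lambda>u. B (A (B u))" and Ci = "\<lambda>u. Bi (Ai (Bi u))" and D = A
        and X = "X * Y" and X' = "X' * Y'" and z = x])
    show "X * Y * (X' * Y') = 1" 
    proof -
      have "X * Y * (X' * Y') = (X * X') * (Y * Y')" by (simp only: mult_ac)
      then show ?thesis using X by simp
    qed
    fix v assume v: "v \<in> V"
    show "X * Y * v \<in> V" using X v by (simp add: mult.assoc)
    show "B (A (B (X * Y * v))) = X' * Y' * Bi (Ai (Bi v)) - x * v"
      using AX BX v by (simp add: B_diff V_simps B_x A_Ai B_Bi)
  qed (use AX u iff in \<open>auto simp: V_simps A_Ai B_Bi A_diff A_x unfold_ker\<close>)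
  have X1: "X * u \<in> ?K \<longleftrightarrow> u \<in> ?K" if u: "u \<in> V" for u
  proof -
    have "B (X * Y * B u) = X * u" using BX(1) u by (simp add: V_simps B_Bi)
    moreover have "X * Y * B u \<in> V" using X u V_simps by (simp add: mult.assoc)
    ultimately show ?thesis using XY iff u B_V by metis
  qed
  then show "X * u \<in> ?K \<longleftrightarrow> u \<in> ?K" using u by blast
  show "Y * u \<in> ?K \<longleftrightarrow> u \<in> ?K" using X1[OF X(2)[OF u]] XY[OF u] by (simp add: mult.assoc)
qed

lemma braid_ker_shift_6:
  assumes X: "\<And>u. u \<in> V \<Longrightarrow> X * u \<in> V" "\<And>u. u \<in> V \<Longrightarrow> Y * u \<in> V" "X * X' = 1" "Y * Y' = 1"
      "\<And>u. u \<in> V \<Longrightarrow> X' * u \<in> V" "\<And>u. u \<in> V \<Longrightarrow> Y' * u \<in> V"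
    and AX: "\<And>u. u \<in> V \<Longrightarrow> A (X * u) = X' * Ai u - x * u"
      "\<And>u. u \<in> V \<Longrightarrow> A (X * X * Y * u) = X * Y * Ai u"
      "\<And>u. u \<in> V \<Longrightarrow> A (X' * Y' * u) = X' * X' * Y' * Ai u"
    and BX: "\<And>u. u \<in> V \<Longrightarrow> B (X * Y * u) = X * Bi u"
      "\<And>u. u \<in> V \<Longrightarrow> B (X' * u) = X' * Y' * Bi u"
      "\<And>u. u \<in> V \<Longrightarrow> B (X * X * Y * u) = X * X * Y * B u"
      "\<And>u. u \<in> V \<Longrightarrow> B (X' * X' * Y' * u) = X' * X' * Y' * B u"
    and u: "u \<in> V"
  shows "X * u \<in> braid_ker 6 \<longleftrightarrow> u \<in> braid_ker 6" "Y * u \<in> braid_ker 6 \<longleftrightarrow> u \<in> braid_ker 6"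
proof -
  let ?K = "braid_ker 6"
  have m: "(6::nat) \<in> {2, 4, 6} \<or> (6::nat) = 3 \<and> x = y" by simp
  note iff = braid_ker_A_iff[OF _ m]
  have XXY: "X * X * Y * u \<in> ?K \<longleftrightarrow> u \<in> ?K" if u: "u \<in> V" for u
  proof (rule braid_ker_shift[where C = "\<lambda>u. A (B (A (B (A u))))" and Ci =
    "\<lambda>u. Ai (Bi (Ai (Bi (Ai u))))"
        and D = B and X = "X * X * Y" and X' = "X' * X' * Y'" and z = x])
    show "X * X * Y * (X' * X' * Y') = 1"
    proof -
      have "X * X * Y * (X' * X' * Y') = (X * X') * (X * X') * (Y * Y')" by (simp only: mult_ac)
      then show ?thesis using X by simp
    qed
    fix v assume v: "v \<in> V"
    show "X * X * Y * v \<in> V" using X v by (simp add: mult.assoc)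
    show "A (B (A (B (A (X * X * Y * v))))) = X' * X' * Y' * Ai (Bi (Ai (Bi (Ai v)))) - x * v"
      using AX BX v by (simp add: A_diff B_diff V_simps A_x B_x A_Ai B_Bi)
  qed (use BX u iff in \<open>auto simp: V_simps A_Ai B_Bi B_diff B_x unfold_ker\<close>)
  have XY: "X * Y * u \<in> ?K \<longleftrightarrow> u \<in> ?K" if u: "u \<in> V" for u
  proof -
    have "A (X * X * Y * A u) = X * Y * u" using AX(2) u by (simp add: V_simps A_Ai)
    moreover have "X * X * Y * A u \<in> V" using X u V_simps by (simp add: mult.assoc)
    ultimately show ?thesis using XXY iff u A_V by metis
  qed
  have X1: "X * u \<in> ?K \<longleftrightarrow> u \<in> ?K" if u: "u \<in> V" for u
  proof -
    let ?w = "X' * Y' * u"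
    have w: "?w \<in> V" using X u by (simp add: mult.assoc)
    have "X * Y * ?w = (X * X') * (Y * Y') * u" by (simp only: mult_ac)
    then have 1: "X * Y * ?w = u" using X by simp
    then have 2: "X * X * Y * ?w = X * u" by (simp only: mult.assoc)
    show ?thesis using XY[OF w] XXY[OF w] 1 2 by simp
  qed
  then show "X * u \<in> ?K \<longleftrightarrow> u \<in> ?K" using u by blast
  show "Y * u \<in> ?K \<longleftrightarrow> u \<in> ?K" using X1[OF X(2)[OF u]] XY[OF u] by (simp add: mult.assoc)
qed

end

section \<open>Rank two: affine reflections\<close>

context root_datum
begin

lemma grad_obtuse:
  assumes "i \<in> {0..r}" "j \<in> {0..r}" "i \<noteq> j"
  shows "grad i \<bullet> grad j \<le> 0"
  using assms simple_obtuse highest_root_dominant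
  by (cases "i = 0"; cases "j = 0") (auto simp: grad_def inner_commute)

text \<open>The possible pairs of Cartan integers of two simple affine roots with independent gradients.\<close>

lemma rank_two_cases:
  assumes ij: "i \<in> {0..r}" "j \<in> {0..r}" "i \<noteq> j" and ne: "grad i \<noteq> - grad j"
  shows "(grad i \<bullet> coroot (grad j), grad j \<bullet> coroot (grad i)) \<in>
    {(0, 0), (- 1, - 1), (- 2, - 1), (- 1, - 2), (- 3, - 1), (- 1, - 3)}"
proof -
  let ?b = "grad i" and ?g = "grad j"
  have r: "?b \<in> \<Phi>" "?g \<in> \<Phi>" using grad_root ij by auto
  have le: "?b \<bullet> ?g \<le> 0" by (rule grad_obtuse[OF ij])
  have ne': "?g \<noteq> ?b"
  proof
    assume "?g = ?b"
    then show False using le root_nz[OF r(1)] by (metis inner_gt_zero_iff not_less)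
  qed
  obtain m n where m: "?b \<bullet> coroot ?g = of_int m" and n: "?g \<bullet> coroot ?b = of_int n"
    using cartan_int r Ints_cases by metis
  have nz: "0 < (norm ?b)\<^sup>2" "0 < (norm ?g)\<^sup>2" using root_nz r by auto
  have "?b \<bullet> coroot ?g \<le> 0" "?g \<bullet> coroot ?b \<le> 0"
    using le nz by (auto simp: inner_coroot inner_commute divide_le_0_iff)
  then have mn: "m \<le> 0" "n \<le> 0" using m n by auto
  have z: "m = 0 \<longleftrightarrow> n = 0"
  proof -
    have "m = 0 \<longleftrightarrow> ?b \<bullet> ?g = 0" using m nz by (auto simp: inner_coroot)
    moreover have "n = 0 \<longleftrightarrow> ?b \<bullet> ?g = 0" using n nz by (auto simp: inner_coroot inner_commute)
    ultimately show ?thesis by simp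
  qed
  have "?g \<noteq> - ?b" using ne by (metis minus_minus)
  then have "of_int m * of_int n < (4 :: real)" using cartan_product[OF r ne'] m n by simp
  then have lt: "m * n < 4" by (metis of_int_less_iff of_int_mult of_int_numeral)
  have "(m, n) \<in> {(0, 0), (- 1, - 1), (- 2, - 1), (- 1, - 2), (- 3, - 1), (- 1, - 3)}"
  proof (cases "m = 0")
    case True
    then show ?thesis using z by simp
  next
    case False
    then have m1: "m \<le> - 1" "n \<le> - 1" using z mn by auto
    have "- m \<le> (- m) * (- n)" "- n \<le> (- m) * (- n)"
      using mult_left_mono[of 1 "- n" "- m"] mult_right_mono[of 1 "- m" "- n"] m1 by auto
    then have "- 3 \<le> m" "- 3 \<le> n" using lt by auto
    then have "m = - 1 \<or> m = - 2 \<or> m = - 3" "n = - 1 \<or> n = - 2 \<or> n = - 3" using m1 by auto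
    then show ?thesis using lt by auto
  qed
  then show ?thesis using m n by auto
qed

lemma cox_order_sym:
  assumes "i \<in> {0..r}" "j \<in> {0..r}" "cox_order i j m"
  shows "cox_order j i m"
proof -
  have e: "((simple_refl j \<circ> simple_refl i) ^^ n) (simple_refl j y) =
      simple_refl j (((simple_refl i \<circ> simple_refl j) ^^ n) y)" for n y
    by (induction n) auto
  have "(simple_refl j \<circ> simple_refl i) ^^ n = id \<longleftrightarrow> (simple_refl i \<circ> simple_refl j) ^^ n = id" for n
  proof
    assume "(simple_refl j \<circ> simple_refl i) ^^ n = id"
    then have "simple_refl j y = simple_refl j (((simple_refl i \<circ> simple_refl j) ^^ n) y)" for y
      using e[of n y] by simp
    then show "(simple_refl i \<circ> simple_refl j) ^^ n = id"
      using simple_refl_simple_refl[OF assms(2)] by (metis eq_id_iff)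
  next
    assume "(simple_refl i \<circ> simple_refl j) ^^ n = id"
    then have "((simple_refl j \<circ> simple_refl i) ^^ n) (simple_refl j y) = simple_refl j y" for y
      using e[of n y] by simp
    then show "(simple_refl j \<circ> simple_refl i) ^^ n = id"
      using simple_refl_simple_refl[OF assms(2)] by (metis eq_id_iff)
  qed
  then show ?thesis using assms(3) by (simp add: cox_order_def)
qed

text \<open>Two simple affine roots with opposite gradients generate an infinite dihedral group.\<close>

lemma cox_order_opposite:
  assumes ij: "i \<in> {0..r}" "j \<in> {0..r}" "i \<noteq> j" and opp: "grad i = - grad j"
  shows "\<not> cox_order i j m"
proof -
  have zero: "\<not> cox_order 0 j m" if j: "j \<in> {0..r}" "j \<noteq> 0" and opp: "grad 0 = - grad j" for j
  proof
    assume c: "cox_order 0 j m"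
    have g: "grad 0 = - highest_root" "grad j = highest_root" using opp by (auto simp: grad_def)
    have "((simple_refl 0 \<circ> simple_refl j) ^^ n) y = y + real n *\<^sub>R coroot highest_root" for n y
      by (induction n) (use j g in \<open>auto simp: simple_refl_eq_refl algebra_simps refl_add refl_scale\<close>)
    then have "real m *\<^sub>R coroot highest_root = 0" "m > 0"
      using c by (auto simp: cox_order_def fun_eq_iff)
    then show False using root_nz[OF highest_root] by (auto simp: coroot_def)
  qed
  show ?thesis
  proof (cases "i = 0 \<or> j = 0")
    case True
    then show ?thesis using zero[of j] zero[of i] ij opp cox_order_sym[OF ij(1,2)] by auto
  next
    case False
    then have "\<alpha> i = - \<alpha> j" "i \<in> {1..r}" "j \<in> {1..r}" using opp ij by (auto simp: grad_def)
    then show ?thesis using not_pos_neg simple_pos simple_root by metis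
  qed
qed

context
  fixes a b :: nat
  assumes ab: "a \<in> {0..r}" "b \<in> {0..r}"
begin

text \<open>The point with coordinates \<open>m\<close>, \<open>n\<close> relative to \<open>y\<close> in the plane of the two coroots.\<close>

definition pt :: "'a \<Rightarrow> real \<Rightarrow> real \<Rightarrow> 'a" where
  "pt y m n = y + m *\<^sub>R coroot (grad a) + n *\<^sub>R coroot (grad b)"

lemma pt_refl:
  "simple_refl a (pt y m n) = pt y (- aff_root a y - m - (grad a \<bullet> coroot (grad b)) * n) n"
  "simple_refl b (pt y m n) = pt y m (- aff_root b y - n - (grad b \<bullet> coroot (grad a)) * m)"
  using self_inner_coroot[OF root_nz[OF grad_root[OF ab(1)]]]
    self_inner_coroot[OF root_nz[OF grad_root[OF ab(2)]]]
  by (simp_all add: simple_refl_eq aff_root_eq pt_def inner_add_right algebra_simps)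
     (simp_all flip: scaleR_add_left)

lemma pt_zero: "pt y 0 0 = y" by (simp add: pt_def)

lemma pt_inj:
  assumes "pt y m n = pt y m' n'" and "(grad a \<bullet> coroot (grad b)) * (grad b \<bullet> coroot (grad a)) < 4"
  shows "m = m' \<and> n = n'"
proof -
  let ?A = "grad a \<bullet> coroot (grad b)" and ?B = "grad b \<bullet> coroot (grad a)"
  define u v where "u = m - m'" and "v = n - n'"
  have z: "u *\<^sub>R coroot (grad a) + v *\<^sub>R coroot (grad b) = 0"
    using assms(1) by (simp add: pt_def u_def v_def algebra_simps)
  have "grad a \<bullet> (u *\<^sub>R coroot (grad a) + v *\<^sub>R coroot (grad b)) = 0"
    "grad b \<bullet> (u *\<^sub>R coroot (grad a) + v *\<^sub>R coroot (grad b)) = 0"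
    unfolding z by simp_all
  then have e: "u * 2 + v * ?A = 0" "u * ?B + v * 2 = 0"
    using self_inner_coroot[OF root_nz[OF grad_root[OF ab(1)]]]
      self_inner_coroot[OF root_nz[OF grad_root[OF ab(2)]]] by (simp_all add: inner_add_right)
  have "u * (4 - ?A * ?B) = 2 * (u * 2 + v * ?A) - ?A * (u * ?B + v * 2)"
    "v * (4 - ?A * ?B) = 2 * (u * ?B + v * 2) - ?B * (u * 2 + v * ?A)"
    by (simp_all add: algebra_simps)
  then have "u = 0" "v = 0" using e assms(2) by auto
  then show ?thesis by (simp add: u_def v_def)
qed

lemma cox_order_eq:
  assumes "cox_order a b m" and "0 < M" and "(simple_refl a \<circ> simple_refl b) ^^ M = id"
    and "\<And>n. 0 < n \<Longrightarrow> n < M \<Longrightarrow> (simple_refl a \<circ> simple_refl b) ^^ n \<noteq> id"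
  shows "m = M"
  using assms unfolding cox_order_def by (metis linorder_neqE_nat)

lemma funpow_numerals:
  "(f :: 'b \<Rightarrow> 'b) ^^ 1 = f" "f ^^ 2 = f \<circ> f" "f ^^ 3 = f \<circ> f \<circ> f" "f ^^ 4 = f \<circ> f \<circ> f \<circ> f"
  "f ^^ 5 = f \<circ> f \<circ> f \<circ> f \<circ> f" "f ^^ 6 = f \<circ> f \<circ> f \<circ> f \<circ> f \<circ> f"
  by (simp_all add: numeral_eq_Suc One_nat_def comp_assoc)

lemma order_rank_two:
  assumes "grad a \<bullet> coroot (grad b) = A" "grad b \<bullet> coroot (grad a) = B"
    and "(A, B, M) \<in> {(0, 0, 2), (- 1, - 1, 3), (- 2, - 1, 4), (- 3, - 1, 6)}"
    and c: "cox_order a b m"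
  shows "m = M"
    "M = 2 \<Longrightarrow> word_prod [a, b] = word_prod [b, a]"
    "M = 3 \<Longrightarrow> word_prod [a, b, a] = word_prod [b, a, b]"
    "M = 4 \<Longrightarrow> word_prod [a, b, a, b] = word_prod [b, a, b, a]"
    "M = 6 \<Longrightarrow> word_prod [a, b, a, b, a, b] = word_prod [b, a, b, a, b, a]"
proof -
  let ?f = "simple_refl a \<circ> simple_refl b"
  have lt: "(grad a \<bullet> coroot (grad b)) * (grad b \<bullet> coroot (grad a)) < 4" using assms by auto
  note inj = pt_inj[OF _ lt]
  note S = pt_refl assms(1,2)
  have all: "f = g" if "\<And>y. f (pt y 0 0) = g (pt y 0 0)" for f g :: "'a \<Rightarrow> 'a"
    using that by (simp add: pt_zero fun_eq_iff)
  \<comment> \<open>An affine map is not the identity if its linear part moves the first coroot.\<close>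
  have nid: "?f ^^ n \<noteq> id"
    if ex: "\<And>y. \<exists>p q p' q'. (?f ^^ n) (pt y 1 0) = pt y p q \<and> (?f ^^ n) (pt y 0 0) = pt y p' q' \<and>
      (p - p' \<noteq> 1 \<or> q \<noteq> q')" for n
  proof
    assume "?f ^^ n = id"
    then obtain p q p' q' where "pt 0 1 0 = pt 0 p q" "pt 0 0 0 = pt 0 p' q'"
      "p - p' \<noteq> 1 \<or> q \<noteq> q'"
      using ex[of 0] by auto
    then show False using inj[of 0 1 0 p q] inj[of 0 0 0 p' q'] by auto
  qed
  consider "A = 0" "B = 0" "M = 2" | "A = - 1" "B = - 1" "M = 3" | "A = - 2" "B = - 1" "M = 4"
    | "A = - 3" "B = - 1" "M = 6" using assms(3) by auto
  then have M: "0 < M \<and> ?f ^^ M = id \<and> (\<forall>n. 0 < n \<and> n < M \<longrightarrow> ?f ^^ n \<noteq> id)"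
  proof cases
    case 1
    have "?f ^^ 2 = id" by (rule all) (simp add: funpow_numerals S 1)
    moreover have "?f ^^ 1 \<noteq> id" by (rule nid, simp only: funpow_numerals comp_apply S 1, intro
      exI conjI, rule HOL.refl, rule HOL.refl, simp)
    moreover have "n = 1" if "0 < n" "n < 2" for n :: nat using that by auto
    ultimately show ?thesis unfolding 1(3) by (metis zero_less_numeral)
  next
    case 2
    have "?f ^^ 3 = id" by (rule all) (simp add: funpow_numerals S 2)
    moreover have "?f ^^ 1 \<noteq> id" by (rule nid, simp only: funpow_numerals comp_apply S 2, intro
      exI conjI, rule HOL.refl, rule HOL.refl, simp)
    moreover have "?f ^^ 2 \<noteq> id" by (rule nid, simp only: funpow_numerals comp_apply S 2, intro
      exI conjI, rule HOL.refl, rule HOL.refl, simp)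
    moreover have "n = 1 \<or> n = 2" if "0 < n" "n < 3" for n :: nat using that by auto
    ultimately show ?thesis unfolding 2(3) by (metis zero_less_numeral)
  next
    case 3
    have "?f ^^ 4 = id" by (rule all) (simp add: funpow_numerals S 3)
    moreover have "?f ^^ 1 \<noteq> id" by (rule nid, simp only: funpow_numerals comp_apply S 3, intro
      exI conjI, rule HOL.refl, rule HOL.refl, simp)
    moreover have "?f ^^ 2 \<noteq> id" by (rule nid, simp only: funpow_numerals comp_apply S 3, intro
      exI conjI, rule HOL.refl, rule HOL.refl, simp)
    moreover have "?f ^^ 3 \<noteq> id" by (rule nid, simp only: funpow_numerals comp_apply S 3, intro
      exI conjI, rule HOL.refl, rule HOL.refl, simp)
    moreover have "n = 1 \<or> n = 2 \<or> n = 3" if "0 < n" "n < 4" for n :: nat using that by auto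
    ultimately show ?thesis unfolding 3(3) by (metis zero_less_numeral)
  next
    case 4
    have "?f ^^ 6 = id" by (rule all) (simp add: funpow_numerals S 4)
    moreover have "?f ^^ 1 \<noteq> id" by (rule nid, simp only: funpow_numerals comp_apply S 4, intro
      exI conjI, rule HOL.refl, rule HOL.refl, simp)
    moreover have "?f ^^ 2 \<noteq> id" by (rule nid, simp only: funpow_numerals comp_apply S 4, intro
      exI conjI, rule HOL.refl, rule HOL.refl, simp)
    moreover have "?f ^^ 3 \<noteq> id" by (rule nid, simp only: funpow_numerals comp_apply S 4, intro
      exI conjI, rule HOL.refl, rule HOL.refl, simp)
    moreover have "?f ^^ 4 \<noteq> id" by (rule nid, simp only: funpow_numerals comp_apply S 4, intro
      exI conjI, rule HOL.refl, rule HOL.refl, simp)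
    moreover have "?f ^^ 5 \<noteq> id" by (rule nid, simp only: funpow_numerals comp_apply S 4, intro
      exI conjI, rule HOL.refl, rule HOL.refl, simp)
    moreover have "n = 1 \<or> n = 2 \<or> n = 3 \<or> n = 4 \<or> n = 5" if "0 < n" "n < 6" for n :: nat
      using that by auto
    ultimately show ?thesis unfolding 4(3) by (metis zero_less_numeral)
  qed
  then show "m = M" using cox_order_eq[OF c] by blast
  show "M = 2 \<Longrightarrow> word_prod [a, b] = word_prod [b, a]"
    using assms(3) by (intro all) (auto simp: S)
  show "M = 3 \<Longrightarrow> word_prod [a, b, a] = word_prod [b, a, b]"
    using assms(3) by (intro all) (auto simp: S)
  show "M = 4 \<Longrightarrow> word_prod [a, b, a, b] = word_prod [b, a, b, a]"
    using assms(3) by (intro all) (auto simp: S algebra_simps)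
  show "M = 6 \<Longrightarrow> word_prod [a, b, a, b, a, b] = word_prod [b, a, b, a, b, a]"
    using assms(3) by (intro all) (auto simp: S algebra_simps)
qed

section \<open>Rank two: reduction to small exponents\<close>

text \<open>
  A point of minimal norm in a coset of the lattice spanned by two coroots. Minimality bounds the
  values of all roots of the rank two system at that point.
\<close>

lemma minimal_point:
  assumes lt: "(grad a \<bullet> coroot (grad b)) * (grad b \<bullet> coroot (grad a)) < 4"
  obtains m n :: int where "\<And>(m' :: int) (n' :: int). norm (pt y m n) \<le> norm (pt y m' n')"
proof -
  let ?A = "grad a \<bullet> coroot (grad b)" and ?B = "grad b \<bullet> coroot (grad a)"
  \<comment> \<open>The two roots bound the coordinates of a lattice vector by its norm, so that only finitely many
    points of the coset are at most as long as \<open>y\<close>.\<close>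
  define N where "N = (\<lambda>(m :: int, n :: int). norm (pt y m n))"
  define F where "F = {mn. N mn \<le> N (0, 0)}"
  define R where "R = 2 * norm y"
  define D where "D = 4 - ?A * ?B"
  define Z where "Z = (2 * (norm (grad a) * R) + \<bar>?A\<bar> * (norm (grad b) * R)) / D +
    (2 * (norm (grad b) * R) + \<bar>?B\<bar> * (norm (grad a) * R)) / D"
  have D: "0 < D" using lt by (simp add: D_def)
  have R: "0 \<le> R" by (simp add: R_def)
  have bnd: "\<bar>of_int m\<bar> \<le> Z \<and> \<bar>of_int n\<bar> \<le> Z" if "N (m, n) \<le> N (0, 0)" for m n
  proof -
    define u where "u = real_of_int m *\<^sub>R coroot (grad a) + real_of_int n *\<^sub>R coroot (grad b)"
    have "norm (y + u) \<le> norm y" using that by (simp add: N_def pt_def u_def add.assoc)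
    then have "norm u \<le> R" using norm_triangle_ineq4[of "y + u" y] by (simp add: R_def)
    then have "\<bar>g \<bullet> u\<bar> \<le> norm g * R" for g
      using Cauchy_Schwarz_ineq2[of g u] by (meson mult_left_mono norm_ge_zero order_trans)
    moreover have "grad a \<bullet> u = 2 * m + ?A * n" "grad b \<bullet> u = ?B * m + 2 * n"
      using self_inner_coroot[OF root_nz[OF grad_root[OF ab(1)]]]
        self_inner_coroot[OF root_nz[OF grad_root[OF ab(2)]]]
      by (simp_all add: u_def inner_add_right)
    ultimately have e: "\<bar>2 * m + ?A * n\<bar> \<le> norm (grad a) * R" "\<bar>?B * m + 2 * n\<bar> \<le> norm (grad b) * R"
      by metis+
    have comb: "\<bar>2 * s - z * t\<bar> \<le> 2 * S + \<bar>z\<bar> * T" if "\<bar>s\<bar> \<le> S" "\<bar>t\<bar> \<le> T" for s t z S T :: real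
    proof -
      have "\<bar>2 * s - z * t\<bar> \<le> \<bar>2 * s\<bar> + \<bar>z * t\<bar>" by (rule abs_triangle_ineq4)
      also have "\<dots> \<le> 2 * S + \<bar>z\<bar> * T"
        using that by (simp add: abs_mult mult_left_mono add_mono)
      finally show ?thesis .
    qed
    have "m * D = 2 * (2 * m + ?A * n) - ?A * (?B * m + 2 * n)"
      "n * D = 2 * (?B * m + 2 * n) - ?B * (2 * m + ?A * n)"
      by (simp_all add: D_def algebra_simps)
    then have "\<bar>m * D\<bar> \<le> 2 * (norm (grad a) * R) + \<bar>?A\<bar> * (norm (grad b) * R)"
      "\<bar>n * D\<bar> \<le> 2 * (norm (grad b) * R) + \<bar>?B\<bar> * (norm (grad a) * R)"
      using comb[OF e] comb[OF e(2,1)] by metis+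
    then have "\<bar>of_int m\<bar> \<le> (2 * (norm (grad a) * R) + \<bar>?A\<bar> * (norm (grad b) * R)) / D"
      "\<bar>of_int n\<bar> \<le> (2 * (norm (grad b) * R) + \<bar>?B\<bar> * (norm (grad a) * R)) / D"
      using D by (simp_all add: abs_mult pos_le_divide_eq)
    moreover have "0 \<le> (2 * (norm (grad a) * R) + \<bar>?A\<bar> * (norm (grad b) * R)) / D"
      "0 \<le> (2 * (norm (grad b) * R) + \<bar>?B\<bar> * (norm (grad a) * R)) / D"
      using D R by simp_all
    ultimately show ?thesis unfolding Z_def by linarith
  qed
  have "F \<subseteq> {- \<lceil>Z\<rceil>..\<lceil>Z\<rceil>} \<times> {- \<lceil>Z\<rceil>..\<lceil>Z\<rceil>}"
  proof
    fix mn assume "mn \<in> F"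
    then obtain m n where mn: "mn = (m, n)" "\<bar>of_int m\<bar> \<le> Z" "\<bar>of_int n\<bar> \<le> Z"
      using bnd by (cases mn) (auto simp: F_def)
    then have "\<bar>m\<bar> \<le> \<lceil>Z\<rceil>" "\<bar>n\<bar> \<le> \<lceil>Z\<rceil>" by (simp_all add: le_ceiling_iff)
    then show "mn \<in> {- \<lceil>Z\<rceil>..\<lceil>Z\<rceil>} \<times> {- \<lceil>Z\<rceil>..\<lceil>Z\<rceil>}" using mn(1) by auto
  qed
  then have "finite F" by (rule finite_subset) simp
  moreover have "(0, 0) \<in> F" by (simp add: F_def)
  ultimately obtain mn where mn: "mn \<in> F" "\<And>mn'. mn' \<in> F \<Longrightarrow> N mn \<le> N mn'"
    by (metis (no_types, lifting) arg_min_if_finite(1) arg_min_least empty_iff)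
  have min: "N mn \<le> N mn'" for mn'
    using mn(2)[of mn'] mn(1) by (cases "mn' \<in> F") (auto simp: F_def)
  obtain m n where "mn = (m, n)" by (cases mn)
  then have "norm (pt y m n) \<le> norm (pt y m' n')" for m' n' :: int
    using min[of "(m', n')"] by (simp add: N_def)
  then show thesis using that by blast
qed

text \<open>
  Minimality is compared with the points that differ by the lattice vector with coordinates \<open>c\<close>,
  \<open>d\<close>.
\<close>

lemma minimal_point_bound:
  fixes c d m n :: int
  assumes min: "\<And>(m' :: int) (n' :: int). norm (pt y m n) \<le> norm (pt y m' n')"
  defines "z \<equiv> pt y m n"
  defines "Na \<equiv> (norm (grad a))\<^sup>2" and "Nb \<equiv> (norm (grad b))\<^sup>2"
  shows "\<bar>c * (grad a \<bullet> z) / Na + d * (grad b \<bullet> z) / Nb\<bar> \<le>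
    c\<^sup>2 / Na + d\<^sup>2 / Nb + c * d * (grad a \<bullet> coroot (grad b)) / Na"
proof -
  let ?ca = "coroot (grad a)" and ?cb = "coroot (grad b)"
  have pos: "0 < Na" "0 < Nb" using root_nz grad_root ab by (auto simp: Na_def Nb_def)
  define v where "v = real_of_int c *\<^sub>R ?ca + real_of_int d *\<^sub>R ?cb"
  have "norm z \<le> norm (z + v)" "norm z \<le> norm (z - v)"
    using min[of "m + c" "n + d"] min[of "m - c" "n - d"]
    by (simp_all add: z_def pt_def v_def algebra_simps)
  then have "z \<bullet> z \<le> (z + v) \<bullet> (z + v)" "z \<bullet> z \<le> (z - v) \<bullet> (z - v)"
    by (simp_all add: norm_le)
  then have b: "2 * \<bar>z \<bullet> v\<bar> \<le> v \<bullet> v"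
    by (simp add: inner_add_left inner_add_right inner_diff_left inner_diff_right inner_commute)
  have zv: "z \<bullet> v = 2 * (c * (grad a \<bullet> z) / Na + d * (grad b \<bullet> z) / Nb)"
    using pos by (simp add: v_def inner_add_right inner_coroot inner_commute Na_def Nb_def field_simps)
  have "?ca \<bullet> ?ca = 4 / Na" "?cb \<bullet> ?cb = 4 / Nb" "?ca \<bullet> ?cb = 2 * (grad a \<bullet> ?cb) / Na"
    using pos self_inner_coroot[of "grad a"] self_inner_coroot[of "grad b"]
    by (auto simp: coroot_inner[of "grad a"] coroot_inner[of "grad b"] Na_def Nb_def)
  then have vv: "v \<bullet> v = 4 * (c\<^sup>2 / Na + d\<^sup>2 / Nb + c * d * (grad a \<bullet> ?cb) / Na)"
    by (simp add: v_def inner_add_left inner_add_right inner_commute[of ?cb ?ca] power2_eq_square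
      field_simps)
  have half: "2 * (2 * w) \<le> 4 * u \<Longrightarrow> w \<le> u" for w u :: real by simp
  have "2 * (2 * \<bar>c * (grad a \<bullet> z) / Na + d * (grad b \<bullet> z) / Nb\<bar>) \<le>
      4 * (c\<^sup>2 / Na + d\<^sup>2 / Nb + c * d * (grad a \<bullet> ?cb) / Na)"
    using b unfolding zv vv by (simp only: abs_mult abs_numeral)
  then show ?thesis by (rule half)
qed

end

end

section \<open>The braid relations\<close>

context quasi_poly_datum
begin

text \<open>The alternating product \<open>T\<^sub>i T\<^sub>j T\<^sub>i \<dots>\<close> with \<open>m\<close> factors.\<close>

fun alt_op :: "nat \<Rightarrow> nat \<Rightarrow> nat \<Rightarrow> ('a \<Rightarrow>\<^sub>0 'f) \<Rightarrow> ('a \<Rightarrow>\<^sub>0 'f)" where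
  "alt_op i j 0 p = p"
| "alt_op i j (Suc m) p = T i (alt_op j i m p)"

lemma k_simple_eq: "norm (grad i) = norm (grad j) \<Longrightarrow> i \<in> {0..r} \<Longrightarrow> j \<in> {0..r} \<Longrightarrow> k_simple i = k_simple j"
proof -
  have "\<exists>\<beta> \<in> \<Phi>. k_simple j = k \<beta> \<and> norm \<beta> = norm (grad j)" if "j \<in> {0..r}" for j
    using that highest_root simple_root by (cases "j = 0") (auto simp: k_simple_def grad_def)
  then show "norm (grad i) = norm (grad j) \<Longrightarrow> i \<in> {0..r} \<Longrightarrow> j \<in> {0..r} \<Longrightarrow> ?thesis"
    using k_norm by metis
qed

lemma inner_refl_eq: "x \<bullet> refl \<beta> v = x \<bullet> v - (x \<bullet> coroot \<beta>) * (\<beta> \<bullet> v)"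
  by (simp add: refl_def inner_diff_right)

text \<open>
  Along a word all of whose steps start at a point with \<open>0 \<le> D\<alpha>\<^sub>j \<le> 1\<close> the operators \<open>T\<^sub>j\<close> act by the
  affine Weyl group up to a scalar.
\<close>

definition word_point :: "nat list \<Rightarrow> 'a \<Rightarrow> 'a" where
  "word_point js y = foldr (\<lambda>j. refl (grad j)) js y"

fun word_small :: "nat list \<Rightarrow> 'a \<Rightarrow> bool" where
  "word_small [] y = True"
| "word_small (j # js) y = (0 \<le> grad j \<bullet> word_point js y \<and> grad j \<bullet> word_point js y \<le> 1 \<and>
  word_small js y)"

fun word_fac :: "nat list \<Rightarrow> 'a \<Rightarrow> 'f" where
  "word_fac [] y = 1"
| "word_fac (j # js) y = gfac j (grad j \<bullet> word_point js y) * word_fac js y"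

lemma word_point_simps [simp]:
  "word_point [] y = y" "word_point (j # js) y = refl (grad j) (word_point js y)"
  by (simp_all add: word_point_def)

lemma word_point_orbit: "set js \<subseteq> {0..r} \<Longrightarrow> y \<in> Orb \<Longrightarrow> word_point js y \<in> Orb"
  by (induction js) (auto intro!: orbit_refl grad_root)

lemma lin_part_word: "set js \<subseteq> {0..r} \<Longrightarrow> lin_part (word_prod js) y = word_point js y"
proof (induction js)
  case (Cons j js)
  have "lin_part (word_prod (j # js)) y = refl (grad j) (lin_part (word_prod js) y)"
    by (simp add: lin_part_def simple_refl_eq_refl flip: refl_diff)
  moreover have "lin_part (word_prod js) y = word_point js y" using Cons by simp
  ultimately show ?case by (simp only: word_point_simps)
qed (simp add: lin_part_def)

lemma T_word_small:
  assumes "set js \<subseteq> {0..r}" "y \<in> Orb" "word_small js y"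
  shows "foldr T js (mono_x y) = scal (word_fac js y) * weyl_mono (word_prod js) y"
  using assms
proof (induction js)
  case Nil
  then show ?case unfolding word_prod_simps weyl_mono_id[OF Nil(2)] by simp
next
  case (Cons j js)
  let ?z = "word_point js y"
  have j: "j \<in> {0..r}" and js: "set js \<subseteq> {0..r}" using Cons by auto
  have z: "?z \<in> Orb" by (rule word_point_orbit[OF js Cons.prems(2)])
  obtain s where s: "weyl_mono (word_prod js) y = scal s * mono_x ?z"
    using lin_part_word[OF js] by (auto simp: weyl_mono_def)
  have "weyl_mono (word_prod (j # js)) y = lin_ext (weyl_mono (simple_refl j)) (scal s * mono_x ?z)"
    using weyl_mono_comp[OF simple_refl_affine[OF j] word_prod_affine[OF js] Cons.prems(2)] s by simp
  also have "\<dots> = scal s * s_op c t j ?z" by (simp add: lin_ext_scal s_op_eq[OF j z])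
  finally have w: "weyl_mono (word_prod (j # js)) y = scal s * s_op c t j ?z" .
  have "foldr T (j # js) (mono_x y) = scal (word_fac js y) * (scal s * T_mono j ?z)"
    using Cons js by (simp add: s T_linear T_mono_x)
  also have "T_mono j ?z = scal (gfac j (grad j \<bullet> ?z)) * s_op c t j ?z"
    by (rule T_small_pos[OF j z]) (use Cons.prems in auto)
  finally show ?case unfolding w by (simp add: mult_ac flip: scal_mult)
qed

context
  fixes a b :: nat
  assumes ab: "a \<in> {0..r}" "b \<in> {0..r}"
begin

interpretation P: quadratic_pair V "T a" "T b" "scal (kap a)" "scal (kap b)"
  by unfold_locales
     (auto simp: T_linear T_quadratic[OF ab(1)] T_quadratic[OF ab(2)] intro: T_space ab
       poly_space_diff poly_space_scal)

abbreviation (input) "A12 \<equiv> grad a \<bullet> coroot (grad b)"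
abbreviation (input) "A21 \<equiv> grad b \<bullet> coroot (grad a)"
abbreviation (input) "K \<equiv> P.braid_ker"

lemma ker_scal: "u \<in> K m \<Longrightarrow> scal s * u \<in> K m"
  by (rule P.braid_ker_scalar) (auto simp: T_linear intro: poly_space_scal)

lemma ker_scal_iff: "s \<noteq> 0 \<Longrightarrow> scal s * u \<in> K m \<longleftrightarrow> u \<in> K m"
proof
  assume s: "s \<noteq> 0" and h: "scal s * u \<in> K m"
  have "scal (inverse s) * (scal s * u) \<in> K m" by (rule ker_scal[OF h])
  moreover have "scal (inverse s) * (scal s * u) = u"
    using s by (simp only: scal_mult left_inverse scal_one mult_1 not_False_eq_True flip: mult.assoc)
  ultimately show "u \<in> K m" by simp
qed (rule ker_scal)

text \<open>
  The monomial with coordinates \<open>m\<close>, \<open>n\<close> relative to the two affine coroots (which includes a power of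
  \<open>q\<close> if one of the indices is \<open>0\<close>), and its exponent.
\<close>

definition XM :: "int \<Rightarrow> int \<Rightarrow> ('a \<Rightarrow>\<^sub>0 'f)" where
  "XM m n = x_coroot a m * x_coroot b n"

definition lat :: "int \<Rightarrow> int \<Rightarrow> 'a" where
  "lat m n = of_int m *\<^sub>R coroot (grad a) + of_int n *\<^sub>R coroot (grad b)"

lemma lat_mem: "lat m n \<in> coroot_lattice \<Phi>"
  unfolding lat_def by (intro lattice_add lattice_scale lattice_coroot grad_root ab)

lemma XM_mono: "\<exists>s. s \<noteq> 0 \<and> XM m n = scal s * mono_x (lat m n)"
proof -
  let ?s = "\<lambda>j n. (if j = 0 then q_root highest_root else 1) powi n"
  have "XM m n = scal (?s a m * ?s b n) * mono_x (lat m n)"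
    by (simp add: XM_def x_coroot_eq lat_def mono_x_add mult_ac flip: scal_mult)
  moreover have "?s a m * ?s b n \<noteq> 0" using q_root_nonzero by simp
  ultimately show ?thesis by blast
qed

lemma XM_mult: "XM m n * XM m' n' = XM (m + m') (n + n')"
  by (simp add: XM_def x_coroot_add mult_ac)

lemma XM_zero [simp]: "XM 0 0 = 1" by (simp add: XM_def)

lemma XM_V: "u \<in> V \<Longrightarrow> XM m n * u \<in> V"
proof -
  assume u: "u \<in> V"
  obtain s where "XM m n = scal s * mono_x (lat m n)" using XM_mono by blast
  then show ?thesis using u by (simp add: mult.assoc poly_space_scal mono_mult_space lat_mem)
qed

lemma grad_lat: "grad a \<bullet> lat m n = 2 * of_int m + A12 * of_int n"
  "grad b \<bullet> lat m n = A21 * of_int m + 2 * of_int n"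
  using self_inner_coroot[OF root_nz[OF grad_root[OF ab(1)]]]
    self_inner_coroot[OF root_nz[OF grad_root[OF ab(2)]]]
  by (simp_all add: lat_def inner_add_right)

lemma Ta_XM:
  assumes u: "u \<in> V"
  shows "2 * of_int m + A12 * of_int n = 0 \<Longrightarrow> T a (XM m n * u) = XM m n * T a u"
    "2 * of_int m + A12 * of_int n = 1 \<Longrightarrow> T a (XM m n * u) = XM (m - 1) n * P.Ai u"
    "T a (XM 1 0 * u) = XM (- 1) 0 * P.Ai u - scal (kap a) * u"
proof -
  obtain s where s: "XM m n = scal s * mono_x (lat m n)" using XM_mono by blast
  show "T a (XM m n * u) = XM m n * T a u" if "2 * of_int m + A12 * of_int n = 0"
    using T_mult_scal_mono[OF ab(1) lat_mem _ u s, of 0] that grad_lat geom_values[OF ab(1)] by simp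
  have x: "x_coroot a (- 1) * XM m n = XM (m - 1) n"
    using XM_mult[of "- 1" 0 m n] by (simp add: XM_def)
  show "T a (XM m n * u) = XM (m - 1) n * P.Ai u" if "2 * of_int m + A12 * of_int n = 1"
  proof -
    have "T a (XM m n * u) = x_coroot a (- 1) * XM m n * T a u +
        scal (kap a) * (- x_coroot a (- 1) * XM m n) * u"
      using T_mult_scal_mono[OF ab(1) lat_mem _ u s, of 1] that grad_lat geom_values[OF ab(1)] by simp
    also have "\<dots> = x_coroot a (- 1) * XM m n * P.Ai u" unfolding P.Ai_def by (simp add: algebra_simps)
    finally show ?thesis unfolding x .
  qed
  show "T a (XM 1 0 * u) = XM (- 1) 0 * P.Ai u - scal (kap a) * u"
    using T_x_coroot(1)[OF ab(1) u] by (simp add: XM_def P.Ai_def)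
qed

lemma Tb_XM:
  assumes u: "u \<in> V"
  shows "A21 * of_int m + 2 * of_int n = 0 \<Longrightarrow> T b (XM m n * u) = XM m n * T b u"
    "A21 * of_int m + 2 * of_int n = 1 \<Longrightarrow> T b (XM m n * u) = XM m (n - 1) * P.Bi u"
    "T b (XM 0 1 * u) = XM 0 (- 1) * P.Bi u - scal (kap b) * u"
proof -
  obtain s where s: "XM m n = scal s * mono_x (lat m n)" using XM_mono by blast
  show "T b (XM m n * u) = XM m n * T b u" if "A21 * of_int m + 2 * of_int n = 0"
    using T_mult_scal_mono[OF ab(2) lat_mem _ u s, of 0] that grad_lat geom_values[OF ab(2)] by simp
  have x: "x_coroot b (- 1) * XM m n = XM m (n - 1)"
    using XM_mult[of 0 "- 1" m n] by (simp add: XM_def)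
  show "T b (XM m n * u) = XM m (n - 1) * P.Bi u" if "A21 * of_int m + 2 * of_int n = 1"
  proof -
    have "T b (XM m n * u) = x_coroot b (- 1) * XM m n * T b u +
        scal (kap b) * (- x_coroot b (- 1) * XM m n) * u"
      using T_mult_scal_mono[OF ab(2) lat_mem _ u s, of 1] that grad_lat geom_values[OF ab(2)] by simp
    also have "\<dots> = x_coroot b (- 1) * XM m n * P.Bi u" unfolding P.Bi_def by (simp add: algebra_simps)
    finally show ?thesis unfolding x .
  qed
  show "T b (XM 0 1 * u) = XM 0 (- 1) * P.Bi u - scal (kap b) * u"
    using T_x_coroot(1)[OF ab(2) u] by (simp add: XM_def P.Bi_def)
qed

text \<open>The subspace on which the braid relation holds is stable under the lattice of the two coroots.\<close>

lemma ker_generators: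
  assumes t: "(A12, A21, M) \<in> {(0, 0, 2), (- 1, - 1, 3), (- 2, - 1, 4), (- 3, - 1, 6)}"
    and kk: "M = 3 \<Longrightarrow> kap a = kap b" and u: "u \<in> V"
  shows "XM 1 0 * u \<in> K M \<longleftrightarrow> u \<in> K M" "XM 0 1 * u \<in> K M \<longleftrightarrow> u \<in> K M"
proof -
  have XX: "XM 1 0 * XM 0 1 = XM 1 1" "XM (- 1) 0 * XM 0 (- 1) = XM (- 1) (- 1)"
    "XM 1 0 * XM 1 0 = XM 2 0" "XM 2 0 * XM 0 1 = XM 2 1"
    "XM (- 1) 0 * XM (- 1) 0 = XM (- 2) 0" "XM (- 2) 0 * XM 0 (- 1) = XM (- 2) (- 1)"
    "XM 1 0 * XM (- 1) 0 = 1" "XM 0 1 * XM 0 (- 1) = 1"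
    by (simp_all add: XM_mult)
  consider "A12 = 0" "A21 = 0" "M = 2" | "A12 = - 1" "A21 = - 1" "M = 3" | "A12 = - 2" "A21 = - 1"
    "M = 4"
    | "A12 = - 3" "A21 = - 1" "M = 6" using t by auto
  then have "(XM 1 0 * u \<in> K M \<longleftrightarrow> u \<in> K M) \<and> (XM 0 1 * u \<in> K M \<longleftrightarrow> u \<in> K M)"
  proof cases
    case 1
    interpret Q: quadratic_pair V "T b" "T a" "scal (kap b)" "scal (kap a)"
      by unfold_locales
         (auto simp: T_linear T_quadratic[OF ab(1)] T_quadratic[OF ab(2)] intro: T_space ab
           poly_space_diff poly_space_scal)
    have QK: "u \<in> Q.braid_ker 2 \<longleftrightarrow> u \<in> K 2" for u
      by (auto simp: P.unfold_ker Q.unfold_ker)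
    have QA: "Q.Ai = P.Bi" by (rule ext) (simp add: Q.Ai_def P.Bi_def)
    have "XM 1 0 * u \<in> K 2 \<longleftrightarrow> u \<in> K 2"
      by (rule P.braid_ker_shift_2[where X' = "XM (- 1) 0"])
         (use 1 in \<open>simp_all add: XM_V XX Ta_XM Tb_XM u\<close>)
    moreover have "XM 0 1 * u \<in> Q.braid_ker 2 \<longleftrightarrow> u \<in> Q.braid_ker 2"
      by (rule Q.braid_ker_shift_2[where X' = "XM 0 (- 1)"])
         (use 1 in \<open>simp_all add: XM_V XX Ta_XM Tb_XM u QA\<close>)
    ultimately show ?thesis using QK 1 by simp
  next
    case 2
    have "(XM 1 0 * u \<in> K 3 \<longleftrightarrow> u \<in> K 3) \<and> (XM 0 1 * u \<in> K 3 \<longleftrightarrow> u \<in> K 3)"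
      by (intro conjI; rule P.braid_ker_shift_3[where X' = "XM (- 1) 0" and Y' = "XM 0 (- 1)" and
            X = "XM 1 0" and Y = "XM 0 1"])
         (use 2 kk in \<open>simp_all add: XM_V XX Ta_XM Tb_XM u\<close>)
    then show ?thesis using 2 by simp
  next
    case 3
    have "(XM 1 0 * u \<in> K 4 \<longleftrightarrow> u \<in> K 4) \<and> (XM 0 1 * u \<in> K 4 \<longleftrightarrow> u \<in> K 4)"
      by (intro conjI; rule P.braid_ker_shift_4[where X' = "XM (- 1) 0" and Y' = "XM 0 (- 1)" and
            X = "XM 1 0" and Y = "XM 0 1"])
         (use 3 in \<open>simp_all add: XM_V XX Ta_XM Tb_XM u\<close>)
    then show ?thesis using 3 by simp
  next
    case 4
    have "(XM 1 0 * u \<in> K 6 \<longleftrightarrow> u \<in> K 6) \<and> (XM 0 1 * u \<in> K 6 \<longleftrightarrow> u \<in> K 6)"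
      by (intro conjI; rule P.braid_ker_shift_6[where X' = "XM (- 1) 0" and Y' = "XM 0 (- 1)" and
            X = "XM 1 0" and Y = "XM 0 1"])
         (use 4 in \<open>simp_all add: XM_V XX Ta_XM Tb_XM u\<close>)
    then show ?thesis using 4 by simp
  qed
  then show "XM 1 0 * u \<in> K M \<longleftrightarrow> u \<in> K M" "XM 0 1 * u \<in> K M \<longleftrightarrow> u \<in> K M" by auto
qed

lemma int_shift_iff:
  assumes "\<And>n :: int. P (n + 1) \<longleftrightarrow> P n"
  shows "P n \<longleftrightarrow> P (0 :: int)"
proof (induction n rule: int_induct[where k = 0])
  case (step2 i)
  then show ?case using assms[of "i - 1"] by simp
qed (use assms in auto)

lemma ker_lattice:
  assumes t: "(A12, A21, M) \<in> {(0, 0, 2), (- 1, - 1, 3), (- 2, - 1, 4), (- 3, - 1, 6)}"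
    and kk: "M = 3 \<Longrightarrow> kap a = kap b" and y: "y \<in> Orb"
  shows "mono_x (lat m n + y) \<in> K M \<longleftrightarrow> mono_x y \<in> K M"
proof -
  have V: "mono_x y \<in> V" using y by (rule poly_space_mono)
  have 1: "XM (m + 1) n * u \<in> K M \<longleftrightarrow> XM m n * u \<in> K M" if "u \<in> V" for m n u
    using ker_generators(1)[OF t kk XM_V[OF that], of m n] XM_mult[of 1 0 m n]
    by (simp add: add.commute flip: mult.assoc)
  have 2: "XM m (n + 1) * u \<in> K M \<longleftrightarrow> XM m n * u \<in> K M" if "u \<in> V" for m n u
    using ker_generators(2)[OF t kk XM_V[OF that], of m n] XM_mult[of 0 1 m n]
    by (simp add: add.commute flip: mult.assoc)
  have "XM m n * mono_x y \<in> K M \<longleftrightarrow> XM 0 n * mono_x y \<in> K M"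
    by (rule int_shift_iff[where P = "\<lambda>m. XM m n * mono_x y \<in> K M"]) (rule 1[OF V])
  also have "\<dots> \<longleftrightarrow> XM 0 0 * mono_x y \<in> K M"
    by (rule int_shift_iff[where P = "\<lambda>n. XM 0 n * mono_x y \<in> K M"]) (rule 2[OF V])
  finally have e: "XM m n * mono_x y \<in> K M \<longleftrightarrow> mono_x y \<in> K M" by simp
  obtain s where s: "s \<noteq> 0" "XM m n = scal s * mono_x (lat m n)" using XM_mono by blast
  have "XM m n * mono_x y = scal s * mono_x (lat m n + y)"
    unfolding s(2) by (simp add: mono_x_add mult.assoc)
  then show ?thesis using e ker_scal_iff[OF s(1)] by simp
qed

text \<open>
  Exponents that are small for the rank two system can be made dominant by reflections, staying in
  the subspace where the braid relation holds. Here \<open>small\<close> is a bound on the values of the positive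
  roots, \<open>neg\<close> counts the positive roots with a negative value, and the values are expressed
  through those of the two simple roots.
\<close>

lemma ker_descent:
  fixes small :: "real \<Rightarrow> real \<Rightarrow> bool" and neg :: "real \<Rightarrow> real \<Rightarrow> nat"
  assumes M: "M \<in> {2, 4, 6} \<or> M = 3 \<and> kap a = kap b"
    and bound: "\<And>p q. small p q \<Longrightarrow> \<bar>p\<bar> \<le> 1 \<and> \<bar>q\<bar> \<le> 1"
    and step1: "\<And>p q. small p q \<Longrightarrow> p < 0 \<Longrightarrow> small (- p) (q - A21 * p) \<and> neg (- p) (q - A21 * p) < neg p q"
    and step2: "\<And>p q. small p q \<Longrightarrow> q < 0 \<Longrightarrow> small (p - A12 * q) (- q) \<and> neg (p - A12 * q) (- q) < neg p q"
    and dom: "\<And>z. z \<in> Orb \<Longrightarrow> small (grad a \<bullet> z) (grad b \<bullet> z) \<Longrightarrow> 0 \<le> grad a \<bullet> z \<Longrightarrow> 0 \<le> grad b \<bullet> z \<Longrightarrow>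
      mono_x z \<in> K M"
    and z: "z \<in> Orb" "small (grad a \<bullet> z) (grad b \<bullet> z)"
  shows "mono_x z \<in> K M"
  using z
proof (induction "neg (grad a \<bullet> z) (grad b \<bullet> z)" arbitrary: z rule: less_induct)
  case less
  have M': "M \<in> {2, 4, 6} \<or> M = 3 \<and> scal (kap a) = (scal (kap b) :: 'a \<Rightarrow>\<^sub>0 'f)" using M by auto
  have up: "mono_x z \<in> K M"
    if j: "j = a \<or> j = b" and lt: "grad j \<bullet> z < 0" "- 1 \<le> grad j \<bullet> z" and ker:
      "mono_x (refl (grad j) z) \<in> K M" for j
  proof -
    have jr: "j \<in> {0..r}" using j ab by auto
    let ?z = "refl (grad j) z"
    have z': "?z \<in> Orb" by (rule orbit_refl[OF grad_root[OF jr] less.prems(1)])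
    have g: "grad j \<bullet> ?z = - (grad j \<bullet> z)" by (metis inner_minus_left inner_refl_left refl_self)
    obtain s where s: "s_op c t j ?z = scal s * mono_x z"
      using s_op_scal[OF jr, of ?z] by auto
    have "s \<noteq> 0"
    proof
      assume "s = 0"
      then have "S j (S j (mono_x ?z)) = 0" using s by (simp add: S_mono S_linear)
      then have "(mono_x ?z :: 'a \<Rightarrow>\<^sub>0 'f) = 0" using S_S[OF jr poly_space_mono[OF z']] by simp
      then show False by (metis keys_mono_x keys_zero insert_not_empty)
    qed
    have "T j (mono_x ?z) = scal (gfac j (grad j \<bullet> ?z) * s) * mono_x z"
      using T_small_pos[OF jr z'] g lt s by (simp add: T_mono_x scal_mult flip: mult.assoc)
    moreover have "T j (mono_x ?z) \<in> K M" using P.braid_ker_A[OF ker M'] j by auto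
    moreover have "gfac j (grad j \<bullet> ?z) * s \<noteq> 0"
      using \<open>s \<noteq> 0\<close> k_simple_nonzero[OF jr] by (simp add: gfac_def)
    ultimately show ?thesis using ker_scal_iff by metis
  qed
  have self: "grad a \<bullet> coroot (grad a) = 2" "grad b \<bullet> coroot (grad b) = 2"
    using self_inner_coroot root_nz grad_root ab by blast+
  consider "grad a \<bullet> z < 0" | "grad b \<bullet> z < 0" | "0 \<le> grad a \<bullet> z" "0 \<le> grad b \<bullet> z" by linarith
  then show ?case
  proof cases
    case 1
    have "mono_x (refl (grad a) z) \<in> K M"
      by (rule less.hyps)
         (use step1[OF less.prems(2) 1] orbit_refl[OF grad_root[OF ab(1)] less.prems(1)] self in
           \<open>auto simp: inner_refl_eq\<close>)
    then show ?thesis using up[of a] 1 bound[OF less.prems(2)] by auto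
  next
    case 2
    have "mono_x (refl (grad b) z) \<in> K M"
      by (rule less.hyps)
         (use step2[OF less.prems(2) 2] orbit_refl[OF grad_root[OF ab(2)] less.prems(1)] self in
           \<open>auto simp: inner_refl_eq\<close>)
    then show ?thesis using up[of b] 2 bound[OF less.prems(2)] by auto
  next
    case 3
    then show ?thesis using dom less.prems by blast
  qed
qed

text \<open>
  At a small dominant exponent both sides of the braid relation run once through all positive roots
  of the rank two system, in opposite orders, so they agree by the braid relation in the affine
  Weyl group.
\<close>

lemma ker_dominant:
  assumes t: "(A12, A21, M) \<in> {(0, 0, 2), (- 1, - 1, 3), (- 2, - 1, 4), (- 3, - 1, 6)}"
    and kk: "M = 3 \<Longrightarrow> k_simple a = k_simple b"
    and c: "cox_order a b m" and z: "z \<in> Orb"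
    and pq: "0 \<le> grad a \<bullet> z" "0 \<le> grad b \<bullet> z" "grad a \<bullet> z \<le> 1" "grad b \<bullet> z \<le> 1"
    and s3: "M = 3 \<Longrightarrow> grad a \<bullet> z + grad b \<bullet> z \<le> 1"
    and s4: "M = 4 \<Longrightarrow> grad a \<bullet> z + grad b \<bullet> z \<le> 1 \<and> grad a \<bullet> z + 2 * (grad b \<bullet> z) \<le> 1"
    and s6: "M = 6 \<Longrightarrow> grad a \<bullet> z + grad b \<bullet> z \<le> 1 \<and> grad a \<bullet> z + 2 * (grad b \<bullet> z) \<le> 1 \<and>
      grad a \<bullet> z + 3 * (grad b \<bullet> z) \<le> 1 \<and> 2 * (grad a \<bullet> z) + 3 * (grad b \<bullet> z) \<le> 1"
  shows "mono_x z \<in> K M"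
proof -
  have self: "grad a \<bullet> coroot (grad a) = 2" "grad b \<bullet> coroot (grad b) = 2"
    using self_inner_coroot root_nz grad_root ab by blast+
  have zV: "mono_x z \<in> V" using z by (rule poly_space_mono)
  have words: "foldr T js (mono_x z) = foldr T ks (mono_x z)"
    if "set js \<subseteq> {a, b}" "set ks \<subseteq> {a, b}" "word_small js z" "word_small ks z"
      "word_fac js z = word_fac ks z" "word_prod js = word_prod ks" for js ks
  proof -
    have "set js \<subseteq> {0..r}" "set ks \<subseteq> {0..r}" using that(1,2) ab by auto
    then show ?thesis using T_word_small z that by simp
  qed
  note O = order_rank_two[OF ab HOL.refl HOL.refl t c]
  have wp: "grad a \<bullet> word_point (a # js) z = - (grad a \<bullet> word_point js z)"
    "grad b \<bullet> word_point (b # js) z = - (grad b \<bullet> word_point js z)"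
    "grad b \<bullet> word_point (a # js) z = grad b \<bullet> word_point js z - A21 * (grad a \<bullet> word_point js z)"
    "grad a \<bullet> word_point (b # js) z = grad a \<bullet> word_point js z - A12 * (grad b \<bullet> word_point js z)"
      for js
    by (simp_all add: inner_refl_eq self)
  consider "A12 = 0" "A21 = 0" "M = 2" | "A12 = - 1" "A21 = - 1" "M = 3" | "A12 = - 2" "A21 = - 1"
    "M = 4"
    | "A12 = - 3" "A21 = - 1" "M = 6" using t by auto
  then show ?thesis
  proof cases
    case 1
    have "foldr T [a, b] (mono_x z) = foldr T [b, a] (mono_x z)"
    proof (rule words)
      show "word_small [a, b] z" "word_small [b, a] z"
        using pq 1(3) by (simp_all add: wp 1 del: word_point_simps(2))
      show "word_fac [a, b] z = word_fac [b, a] z"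
        by (simp add: wp 1 algebra_simps del: word_point_simps(2))
    qed (use 1 O(2) in auto)
    then show ?thesis using zV 1 by (simp add: P.unfold_ker)
  next
    case 2
    have gf: "gfac a = gfac b" using kk 2 by (simp add: gfac_def fun_eq_iff)
    have "foldr T [a, b, a] (mono_x z) = foldr T [b, a, b] (mono_x z)"
    proof (rule words)
      show "word_small [a, b, a] z" "word_small [b, a, b] z"
        using pq s3 2(3) by (simp_all add: wp 2 del: word_point_simps(2))
      show "word_fac [a, b, a] z = word_fac [b, a, b] z"
        by (simp add: wp 2 gf algebra_simps del: word_point_simps(2))
    qed (use 2 O(3) in auto)
    then show ?thesis using zV 2 by (simp add: P.unfold_ker)
  next
    case 3
    have "foldr T [a, b, a, b] (mono_x z) = foldr T [b, a, b, a] (mono_x z)"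
    proof (rule words)
      show "word_small [a, b, a, b] z" "word_small [b, a, b, a] z"
        using pq s4 3(3) by (simp_all add: wp 3 del: word_point_simps(2))
      show "word_fac [a, b, a, b] z = word_fac [b, a, b, a] z"
        by (simp add: wp 3 algebra_simps del: word_point_simps(2))
    qed (use 3 O(4) in auto)
    then show ?thesis using zV 3 by (simp add: P.unfold_ker)
  next
    case 4
    have "foldr T [a, b, a, b, a, b] (mono_x z) = foldr T [b, a, b, a, b, a] (mono_x z)"
    proof (rule words)
      show "word_small [a, b, a, b, a, b] z" "word_small [b, a, b, a, b, a] z"
        using pq s6 4(3) by (simp_all add: wp 4 del: word_point_simps(2))
      show "word_fac [a, b, a, b, a, b] z = word_fac [b, a, b, a, b, a] z"
        by (simp add: wp 4 algebra_simps del: word_point_simps(2))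
    qed (use 4 O(5) in auto)
    then show ?thesis using zV 4 by (simp add: P.unfold_ker)
  qed
qed

text \<open>
  The bounds at a point of minimal norm: for the two simple roots, and for the pairing with the
  lattice vector with coordinates \<open>e\<close>, \<open>d\<close>. If this vector is a coroot of the rank two system, the
  latter says that the corresponding root is at most \<open>1\<close> in absolute value.
\<close>

lemma minimal_bounds:
  fixes m n e d :: int
  assumes min: "\<And>(m' :: int) (n' :: int). norm (pt a b y m n) \<le> norm (pt a b y m' n')"
    and A21: "A21 = - 1 \<or> A21 = 0 \<and> A12 = 0"
  defines "z \<equiv> pt a b y m n"
  shows "\<bar>grad a \<bullet> z\<bar> \<le> 1" "\<bar>grad b \<bullet> z\<bar> \<le> 1"
    "A21 = - 1 \<Longrightarrow> \<bar>e * (grad a \<bullet> z) - d * A12 * (grad b \<bullet> z)\<bar> \<le> e\<^sup>2 - d\<^sup>2 * A12 + e * d * A12"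
      (is "_ \<Longrightarrow> ?L \<le> ?R")
proof -
  let ?Na = "(norm (grad a))\<^sup>2" and ?Nb = "(norm (grad b))\<^sup>2"
  have pos: "0 < ?Na" "0 < ?Nb" using root_nz grad_root ab by auto
  note B = minimal_point_bound[OF ab min, folded z_def]
  show "\<bar>grad a \<bullet> z\<bar> \<le> 1" using B[of 1 0] pos by (simp add: abs_divide divide_le_cancel)
  show "\<bar>grad b \<bullet> z\<bar> \<le> 1" using B[of 0 1] pos by (simp add: abs_divide divide_le_cancel)
  show "?L \<le> ?R" if "A21 = - 1"
  proof -
    have "A12 * ?Nb = A21 * ?Na" using pos by (simp add: inner_coroot inner_commute)
    then have N: "?Na = - A12 * ?Nb" using that by simp
    have "A12 \<noteq> 0" using N pos by auto
    then have "1 / ?Nb = - A12 / ?Na" using N pos by (simp add: field_simps)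
    then have Nb: "x / ?Nb = - x * A12 / ?Na" for x
      by (metis divide_inverse mult.assoc mult_minus_left mult_minus_right mult_1 times_divide_eq_right)
    have "\<bar>(e * (grad a \<bullet> z) - d * A12 * (grad b \<bullet> z)) / ?Na\<bar> \<le>
        (e\<^sup>2 - d\<^sup>2 * A12 + e * d * A12) / ?Na"
      using B[of e d] unfolding Nb by (simp add: diff_divide_distrib add_divide_distrib mult_ac)
    then show ?thesis using pos by (simp add: abs_divide divide_le_cancel)
  qed
qed

lemma ker_all:
  assumes t: "(A12, A21, M) \<in> {(0, 0, 2), (- 1, - 1, 3), (- 2, - 1, 4), (- 3, - 1, 6)}"
    and c: "cox_order a b m" and y: "y \<in> Orb"
  shows "mono_x y \<in> K M"
proof -
  have kk: "k_simple a = k_simple b" if "M = 3"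
  proof (rule k_simple_eq[OF _ ab])
    have "A12 = - 1" "A21 = - 1" using t that by auto
    then have "(norm (grad a))\<^sup>2 = (norm (grad b))\<^sup>2"
      using root_nz[OF grad_root[OF ab(1)]] root_nz[OF grad_root[OF ab(2)]]
      by (simp add: inner_coroot inner_commute field_simps)
    then show "norm (grad a) = norm (grad b)" by (simp add: power2_eq_iff_nonneg)
  qed
  then have kk': "M = 3 \<Longrightarrow> kap a = kap b" by (simp add: kap_def)
  have lt: "A12 * A21 < 4" using t by auto
  obtain u v :: int where min: "\<And>(m' :: int) (n' :: int). norm (pt a b y u v) \<le> norm (pt a b y m' n')"
    using minimal_point[OF ab lt] by metis
  define z where "z = pt a b y u v"
  have zl: "z = lat u v + y" by (simp add: z_def pt_def[OF ab] lat_def)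
  have z: "z \<in> Orb" using orbit_add[OF lat_mem y] by (simp add: zl add.commute)
  have A21: "A21 = - 1 \<or> A21 = 0 \<and> A12 = 0" using t by auto
  note B = minimal_bounds[OF min A21, folded z_def]
  let ?p = "grad a \<bullet> z" and ?q = "grad b \<bullet> z"
  have "mono_x z \<in> K M"
  proof -
    consider "A12 = 0" "A21 = 0" "M = 2" | "A12 = - 1" "A21 = - 1" "M = 3" | "A12 = - 2"
      "A21 = - 1" "M = 4"
      | "A12 = - 3" "A21 = - 1" "M = 6" using t by auto
    then show ?thesis
    proof cases
      case 1
      show ?thesis
      proof (rule ker_descent[where small = "\<lambda>p q. \<bar>p\<bar> \<le> 1 \<and> \<bar>q\<bar> \<le> 1" and
            neg = "\<lambda>p q. (if p < 0 then 1 else 0) + (if q < 0 then 1 else 0)"])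
        show "mono_x z \<in> K M" if "z \<in> Orb" "\<bar>grad a \<bullet> z\<bar> \<le> 1 \<and> \<bar>grad b \<bullet> z\<bar> \<le> 1" "0 \<le> grad a \<bullet> z"
          "0 \<le> grad b \<bullet> z" for z
          by (rule ker_dominant[OF t kk c]) (use that 1 in auto)
      qed (use 1 B z in auto)
    next
      case 2
      have "\<bar>?p + ?q\<bar> \<le> 1" using B(3)[of 1 1] 2 by simp
      show ?thesis
      proof (rule ker_descent[where small = "\<lambda>p q. \<bar>p\<bar> \<le> 1 \<and> \<bar>q\<bar> \<le> 1 \<and> \<bar>p + q\<bar> \<le> 1" and
            neg = "\<lambda>p q. (if p < 0 then 1 else 0) + (if q < 0 then 1 else 0) + (if p + q < 0 then
              1 else 0)"])
        show "mono_x z \<in> K M" if "z \<in> Orb"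
          "\<bar>grad a \<bullet> z\<bar> \<le> 1 \<and> \<bar>grad b \<bullet> z\<bar> \<le> 1 \<and> \<bar>grad a \<bullet> z + grad b \<bullet> z\<bar> \<le> 1" "0 \<le> grad a \<bullet> z"
            "0 \<le> grad b \<bullet> z" for z
          by (rule ker_dominant[OF t kk c]) (use that 2 in auto)
      qed (use 2 kk' B z \<open>\<bar>?p + ?q\<bar> \<le> 1\<close> in \<open>auto simp: algebra_simps\<close>)
    next
      case 3
      \<comment> \<open>The instances are the coordinates of the coroots of the positive roots.\<close>
      have s: "\<bar>?p + 2 * ?q\<bar> \<le> 1" using B(3)[of 1 1] 3 by simp
      have s': "\<bar>?p + ?q\<bar> \<le> 1" using B(3)[of 2 1] 3 by (simp add: abs_le_iff)
      show ?thesis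
      proof (rule ker_descent[where
            small = "\<lambda>p q. \<bar>p\<bar> \<le> 1 \<and> \<bar>q\<bar> \<le> 1 \<and> \<bar>p + q\<bar> \<le> 1 \<and> \<bar>p + 2 * q\<bar> \<le> 1" and
            neg = "\<lambda>p q. (if p < 0 then 1 else 0) + (if q < 0 then 1 else 0) + (if p + q < 0 then
              1 else 0) +
              (if p + 2 * q < 0 then 1 else 0)"])
        show "mono_x z \<in> K M" if "z \<in> Orb"
          "\<bar>grad a \<bullet> z\<bar> \<le> 1 \<and> \<bar>grad b \<bullet> z\<bar> \<le> 1 \<and> \<bar>grad a \<bullet> z + grad b \<bullet> z\<bar> \<le> 1 \<and>
            \<bar>grad a \<bullet> z + 2 * (grad b \<bullet> z)\<bar> \<le> 1"
          "0 \<le> grad a \<bullet> z" "0 \<le> grad b \<bullet> z" for z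
          by (rule ker_dominant[OF t kk c]) (use that 3 in auto)
      qed (use 3 B z s s' in \<open>auto simp: algebra_simps\<close>)
    next
      case 4
      have s1: "\<bar>?p + 3 * ?q\<bar> \<le> 1" using B(3)[of 1 1] 4 by simp
      have s2: "\<bar>2 * ?p + 3 * ?q\<bar> \<le> 1" using B(3)[of 2 1] 4 by simp
      have s3: "\<bar>?p + ?q\<bar> \<le> 1" using B(3)[of 3 1] 4 by (simp add: abs_le_iff)
      have s4: "\<bar>?p + 2 * ?q\<bar> \<le> 1" using B(3)[of 3 2] 4 by (simp add: abs_le_iff)
      show ?thesis
      proof (rule ker_descent[where
            small = "\<lambda>p q. \<bar>p\<bar> \<le> 1 \<and> \<bar>q\<bar> \<le> 1 \<and> \<bar>p + q\<bar> \<le> 1 \<and> \<bar>p + 2 * q\<bar> \<le> 1 \<and> \<bar>p + 3 * q\<bar> \<le> 1 \<and>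
              \<bar>2 * p + 3 * q\<bar> \<le> 1" and
            neg = "\<lambda>p q. (if p < 0 then 1 else 0) + (if q < 0 then 1 else 0) + (if p + q < 0 then
              1 else 0) +
              (if p + 2 * q < 0 then 1 else 0) + (if p + 3 * q < 0 then 1 else 0) +
              (if 2 * p + 3 * q < 0 then 1 else 0)"])
        show "mono_x z \<in> K M" if "z \<in> Orb"
          "\<bar>grad a \<bullet> z\<bar> \<le> 1 \<and> \<bar>grad b \<bullet> z\<bar> \<le> 1 \<and> \<bar>grad a \<bullet> z + grad b \<bullet> z\<bar> \<le> 1 \<and>
            \<bar>grad a \<bullet> z + 2 * (grad b \<bullet> z)\<bar> \<le> 1 \<and>
            \<bar>grad a \<bullet> z + 3 * (grad b \<bullet> z)\<bar> \<le> 1 \<and> \<bar>2 * (grad a \<bullet> z) + 3 * (grad b \<bullet> z)\<bar> \<le> 1"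
          "0 \<le> grad a \<bullet> z" "0 \<le> grad b \<bullet> z" for z
          by (rule ker_dominant[OF t kk c]) (use that 4 in auto)
      qed (use 4 B z s1 s2 s3 s4 in \<open>auto simp: algebra_simps\<close>)
    qed
  qed
  then show ?thesis using ker_lattice[OF t kk' y] zl by simp
qed

lemma alt_op_eq: "P.alt s m p = (if s then alt_op a b m p else alt_op b a m p)"
  by (induction m arbitrary: s) auto

lemma T_braid_typed:
  fixes M :: nat
  assumes t: "(A12, A21, M) \<in> {(0, 0, 2), (- 1, - 1, 3), (- 2, - 1, 4), (- 3, - 1, 6)}"
    and c: "cox_order a b m" and p: "p \<in> V"
  shows "alt_op a b m p = alt_op b a m p"
proof -
  have "m = M" by (rule order_rank_two(1)[OF ab HOL.refl HOL.refl t c])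
  have "p \<in> K M"
    using p
  proof (induction rule: poly_space_induct)
    case (mono y)
    then show ?case by (rule ker_all[OF t c])
  next
    case (add u v)
    then show ?case by (auto simp: P.braid_ker_def P.alt_add poly_space_add)
  qed (rule ker_scal)
  then show ?thesis using \<open>m = M\<close> by (simp add: P.braid_ker_def alt_op_eq)
qed

end

lemma T_braid:
  assumes ij: "i \<in> {0..r}" "j \<in> {0..r}" "i \<noteq> j" and c: "cox_order i j m" and p: "p \<in> V"
  shows "alt_op i j m p = alt_op j i m p"
proof -
  have "grad i \<noteq> - grad j" using cox_order_opposite[OF ij] c by blast
  from rank_two_cases[OF ij this]
  show ?thesis
    using T_braid_typed[OF ij(1,2) _ c p] T_braid_typed[OF ij(2,1) _ cox_order_sym[OF ij(1,2) c] p]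
    by auto
qed

end

section \<open>The free algebra\<close>

lemma letters_add: "letters (u + v) = letters u @ letters v"
  by (simp add: plus_free_mon_def)

lemma letters_zero: "letters 0 = []"
  by (simp add: zero_free_mon_def)

lemma free_alg_simps:
  "(p \<in> carrier (free_alg G)) = (\<forall>w \<in> Poly_Mapping.keys p. set (letters w) \<subseteq> G)"
  "mult (free_alg G) = (*)" "one (free_alg G) = 1" "zero (free_alg G) = 0" "add (free_alg G) = (+)"
  "module.smult (free_alg G) = (\<lambda>a p. scal a * p)"
  by (simp_all add: free_alg_def)

lemma free_alg_closed:
  fixes p p' :: "'g free_mon \<Rightarrow>\<^sub>0 'f::comm_ring_1"
  shows "p \<in> carrier (free_alg G) \<Longrightarrow> p' \<in> carrier (free_alg G) \<Longrightarrow> p + p' \<in> carrier (free_alg G)"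
    "p \<in> carrier (free_alg G) \<Longrightarrow> p' \<in> carrier (free_alg G) \<Longrightarrow> p * p' \<in> carrier (free_alg G)"
    "p \<in> carrier (free_alg G) \<Longrightarrow> - p \<in> carrier (free_alg G)"
    "(0 :: 'g free_mon \<Rightarrow>\<^sub>0 'f) \<in> carrier (free_alg G)"
    "(1 :: 'g free_mon \<Rightarrow>\<^sub>0 'f) \<in> carrier (free_alg G)"
    "scal a \<in> carrier (free_alg G)"
  using keys_add[of p p'] keys_mult[of p p']
  by (auto simp: free_alg_simps scal_def letters_zero letters_add split: if_splits)
     (fastforce simp: letters_add)+

lemma free_alg_diff:
  fixes p p' :: "'g free_mon \<Rightarrow>\<^sub>0 'f::comm_ring_1"
  shows "p \<in> carrier (free_alg G) \<Longrightarrow> p' \<in> carrier (free_alg G) \<Longrightarrow> p - p' \<in> carrier (free_alg G)"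
  using free_alg_closed(1)[OF _ free_alg_closed(3), of p G p'] by simp

lemma ring_free_alg: "ring (free_alg G :: ('f::comm_ring_1, 'g free_mon \<Rightarrow>\<^sub>0 'f) module)"
proof (rule ringI)
  show "abelian_group (free_alg G :: ('f, 'g free_mon \<Rightarrow>\<^sub>0 'f) module)"
  proof (rule abelian_groupI)
    fix p :: "'g free_mon \<Rightarrow>\<^sub>0 'f" assume "p \<in> carrier (free_alg G)"
    then show "\<exists>p' \<in> carrier (free_alg G). p' \<oplus>\<^bsub>free_alg G\<^esub> p = \<zero>\<^bsub>free_alg G\<^esub>"
      by (intro bexI[of _ "- p"] free_alg_closed(3)) (simp_all add: free_alg_simps)
  qed (simp_all only: free_alg_simps(2-) free_alg_closed add_ac add_0 add_0_right)
  show "Group.monoid (free_alg G :: ('f, 'g free_mon \<Rightarrow>\<^sub>0 'f) module)"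
    by (rule monoidI) (simp_all only: free_alg_simps(2-) free_alg_closed mult.assoc mult_1 mult_1_right)
qed (simp_all only: free_alg_simps(2-) distrib_left distrib_right)

section \<open>Evaluation of the free algebra\<close>

context quasi_poly_datum
begin

text \<open>The operators by which the generators and the words in them act.\<close>

fun gen_op :: "'a daha_gen \<Rightarrow> ('a \<Rightarrow>\<^sub>0 'f) \<Rightarrow> ('a \<Rightarrow>\<^sub>0 'f)" where
  "gen_op (T_gen j) = T j"
| "gen_op (X_gen \<mu>) = (\<lambda>p. mono_x \<mu> * p)"

definition word_op :: "'a daha_gen free_mon \<Rightarrow> ('a \<Rightarrow>\<^sub>0 'f) \<Rightarrow> ('a \<Rightarrow>\<^sub>0 'f)" where
  "word_op w p = foldr gen_op (letters w) p"

text \<open>The action of an element of the free algebra.\<close>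

definition ev :: "('a daha_gen free_mon \<Rightarrow>\<^sub>0 'f) \<Rightarrow> ('a \<Rightarrow>\<^sub>0 'f) \<Rightarrow> ('a \<Rightarrow>\<^sub>0 'f)" where
  "ev P p = lin_ext (\<lambda>w. word_op w p) P"

lemma gen_op_linear:
  "gen_op g (u + v) = gen_op g u + gen_op g v" "gen_op g (scal s * u) = scal s * gen_op g u"
  by (cases g; simp add: T_linear distrib_left mult.left_commute)+

lemma foldr_op_linear:
  "foldr gen_op gs (u + v) = foldr gen_op gs u + foldr gen_op gs v"
  "foldr gen_op gs (scal s * u) = scal s * foldr gen_op gs u"
  by (induction gs) (simp_all add: gen_op_linear)

lemma word_op_linear:
  "word_op w (u + v) = word_op w u + word_op w v" "word_op w (scal s * u) = scal s * word_op w u"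
  by (simp_all add: word_op_def foldr_op_linear)

lemma word_op_add: "word_op (w + w') p = word_op w (word_op w' p)"
  by (simp add: word_op_def letters_add)

lemma word_op_zero: "word_op 0 p = p"
  by (simp add: word_op_def letters_zero)

lemma ev_add: "ev (P + Q) p = ev P p + ev Q p" by (simp add: ev_def lin_ext_add)
lemma ev_diff: "ev (P - Q) p = ev P p - ev Q p" by (simp add: ev_def lin_ext_diff)
lemma ev_minus: "ev (- P) p = - ev P p" by (simp add: ev_def lin_ext_minus)
lemma ev_scal: "ev (scal s * P) p = scal s * ev P p" by (simp add: ev_def lin_ext_scal)
lemma ev_zero: "ev 0 p = 0" by (simp add: ev_def)
lemma ev_single: "ev (Poly_Mapping.single w s) p = scal s * word_op w p"
  by (simp add: ev_def lin_ext_single)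

lemma ev_one: "ev 1 p = p"
  using ev_single[of 0 1 p] by (simp add: word_op_zero)

lemma ev_scal_one: "ev (scal s) p = scal s * p"
  using ev_scal[of s 1 p] by (simp add: ev_one)

lemma ev_gen: "ev (gen g) p = gen_op g p"
  by (simp add: gen_def ev_single word_op_def)

lemma ev_linear: "ev P (u + v) = ev P u + ev P v" "ev P (scal s * u) = scal s * ev P u"
proof -
  show "ev P (u + v) = ev P u + ev P v"
    by (induction P rule: poly_mapping_induct[OF subset_UNIV])
       (simp_all add: ev_zero ev_single ev_add word_op_linear distrib_left)
  show "ev P (scal s * u) = scal s * ev P u"
    by (induction P rule: poly_mapping_induct[OF subset_UNIV])
       (simp_all add: ev_zero ev_single ev_add word_op_linear distrib_left mult.left_commute)
qed

lemma ev_zero_arg: "ev P 0 = 0"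
  using ev_linear(2)[of P 0 0] by simp

lemma ev_mult: "ev (P * Q) p = ev P (ev Q p)"
proof (induction P rule: poly_mapping_induct[OF subset_UNIV])
  case (2 w s)
  show ?case
  proof (induction Q rule: poly_mapping_induct[OF subset_UNIV])
    case (2 w' s')
    show ?case
      by (simp add: mult_single ev_single word_op_add ev_linear word_op_linear mult.assoc flip:
        scal_mult)
  qed (simp_all add: ev_zero ev_zero_arg ev_add ev_linear distrib_left)
qed (simp_all add: ev_zero ev_add distrib_right)

lemma gen_op_space: "g \<in> daha_gens \<Longrightarrow> p \<in> V \<Longrightarrow> gen_op g p \<in> V"
  by (auto simp: daha_gens_def T_space mono_mult_space)

lemma word_op_space: "set (letters w) \<subseteq> daha_gens \<Longrightarrow> p \<in> V \<Longrightarrow> word_op w p \<in> V"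
proof -
  have "set gs \<subseteq> daha_gens \<Longrightarrow> p \<in> V \<Longrightarrow> foldr gen_op gs p \<in> V" for gs
    by (induction gs) (auto intro: gen_op_space)
  then show "set (letters w) \<subseteq> daha_gens \<Longrightarrow> p \<in> V \<Longrightarrow> word_op w p \<in> V" by (simp add: word_op_def)
qed

lemma daha_free_induct [consumes 1, case_names zero single add]:
  assumes "P \<in> carrier daha_free" and "Q 0"
    and "\<And>w s. set (letters w) \<subseteq> daha_gens \<Longrightarrow> Q (Poly_Mapping.single w s)"
    and "\<And>u v. Q u \<Longrightarrow> Q v \<Longrightarrow> Q (u + v)"
  shows "Q P"
  by (rule poly_mapping_induct[where A = "{w. set (letters w) \<subseteq> daha_gens}"])
     (use assms in \<open>auto simp: daha_free_def free_alg_simps\<close>)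

lemma ev_space: "P \<in> carrier daha_free \<Longrightarrow> p \<in> V \<Longrightarrow> ev P p \<in> V"
  by (induction rule: daha_free_induct)
     (auto simp: ev_zero ev_single ev_add intro: poly_space_zero poly_space_scal word_op_space
       poly_space_add)

lemma ev_alt_T: "ev (alt_T i j m) p = alt_op i j m p"
  by (induction m arbitrary: i j) (simp_all add: ev_one ev_mult ev_gen)

lemma poly_word_lin_ext: "poly_word f = lin_ext (\<lambda>\<mu>. gen (X_gen \<mu>)) f"
  by (simp add: poly_word_def lin_ext_def)

lemma ev_poly_word: "ev (poly_word f) p = f * p"
  unfolding poly_word_lin_ext
  by (induction f rule: poly_mapping_induct[OF subset_UNIV])
     (simp_all add: ev_zero lin_ext_scal lin_ext_add ev_add ev_scal ev_gen distrib_right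
       single_mono_x mult.assoc)

lemma daha_free_closed:
  "P \<in> carrier daha_free \<Longrightarrow> Q \<in> carrier daha_free \<Longrightarrow> P + Q \<in> carrier daha_free"
  "P \<in> carrier daha_free \<Longrightarrow> Q \<in> carrier daha_free \<Longrightarrow> P * Q \<in> carrier daha_free"
  "P \<in> carrier daha_free \<Longrightarrow> - P \<in> carrier daha_free"
  "0 \<in> carrier daha_free" "1 \<in> carrier daha_free" "scal s \<in> carrier daha_free"
  "P \<in> carrier daha_free \<Longrightarrow> Q \<in> carrier daha_free \<Longrightarrow> P - Q \<in> carrier daha_free"
  unfolding daha_free_def by (fact free_alg_closed free_alg_diff)+

lemma gen_carrier: "g \<in> daha_gens \<Longrightarrow> gen g \<in> carrier daha_free"
  by (simp add: daha_free_def free_alg_simps gen_def)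

lemma T_gen_carrier: "j \<in> {0..r} \<Longrightarrow> gen (T_gen j) \<in> carrier daha_free"
  by (rule gen_carrier) (simp add: daha_gens_def)

lemma X_gen_carrier: "\<mu> \<in> coroot_lattice \<Phi> \<Longrightarrow> gen (X_gen \<mu>) \<in> carrier daha_free"
  by (rule gen_carrier) (simp add: daha_gens_def)

lemma alt_T_carrier: "i \<in> {0..r} \<Longrightarrow> j \<in> {0..r} \<Longrightarrow> alt_T i j m \<in> carrier daha_free"
  by (induction m arbitrary: i j) (simp_all add: daha_free_closed T_gen_carrier del: atLeastAtMost_iff)

lemma poly_word_carrier:
  assumes "Poly_Mapping.keys f \<subseteq> coroot_lattice \<Phi>"
  shows "poly_word f \<in> carrier daha_free"
  unfolding poly_word_lin_ext using assms
  by (induction f rule: poly_mapping_induct)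
     (simp_all add: lin_ext_single lin_ext_add daha_free_closed X_gen_carrier)

text \<open>The elements of the free algebra that act trivially form an ideal containing the relators.\<close>

definition ev_ker :: "('a daha_gen free_mon \<Rightarrow>\<^sub>0 'f) set" where
  "ev_ker = {P \<in> carrier daha_free. \<forall>p \<in> V. ev P p = 0}"

lemma ring_daha_free: "ring daha_free"
  unfolding daha_free_def by (rule ring_free_alg)

lemma daha_free_simps:
  "mult daha_free = (*)" "one daha_free = 1" "zero daha_free = 0" "add daha_free = (+)"
  "module.smult daha_free = (\<lambda>a p. scal a * p)"
  by (simp_all add: daha_free_def free_alg_simps)

lemma a_inv_daha_free: "P \<in> carrier daha_free \<Longrightarrow> \<ominus>\<^bsub>daha_free\<^esub> P = - P"
proof -
  interpret ring daha_free by (rule ring_daha_free)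
  assume P: "P \<in> carrier daha_free"
  then have "- P \<in> carrier daha_free" by (rule daha_free_closed)
  then show ?thesis using P minus_equality[of "- P" P] by (simp add: daha_free_simps)
qed

lemma ideal_ev_ker: "ideal ev_ker daha_free"
proof (rule idealI[OF ring_daha_free])
  interpret ring daha_free by (rule ring_daha_free)
  show "subgroup ev_ker (add_monoid daha_free)"
  proof (rule group.subgroupI[OF a_group])
    show "ev_ker \<subseteq> carrier (add_monoid daha_free)" by (auto simp: ev_ker_def)
    have "0 \<in> ev_ker" by (simp add: ev_ker_def ev_zero daha_free_closed)
    then show "ev_ker \<noteq> {}" by blast
    fix P assume P: "P \<in> ev_ker"
    have "inv\<^bsub>add_monoid daha_free\<^esub> P = - P"
      using a_inv_daha_free P by (simp add: a_inv_def ev_ker_def)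
    then show "inv\<^bsub>add_monoid daha_free\<^esub> P \<in> ev_ker"
      using P by (simp add: ev_ker_def ev_minus daha_free_closed)
    fix Q assume "Q \<in> ev_ker"
    then show "P \<otimes>\<^bsub>add_monoid daha_free\<^esub> Q \<in> ev_ker"
      using P by (simp add: ev_ker_def ev_add daha_free_closed daha_free_simps)
  qed
  fix P Q assume "P \<in> ev_ker" "Q \<in> carrier daha_free"
  then show "Q \<otimes>\<^bsub>daha_free\<^esub> P \<in> ev_ker" "P \<otimes>\<^bsub>daha_free\<^esub> Q \<in> ev_ker"
    by (simp_all add: ev_ker_def daha_free_simps daha_free_closed ev_mult ev_zero_arg ev_space)
qed

lemma relators_ev_ker: "daha_relators \<subseteq> ev_ker"
proof
  fix R assume "R \<in> daha_relators"
  then consider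
    (braid) i j m where "R = alt_T i j m - alt_T j i m" "i \<in> {0..r}" "j \<in> {0..r}" "i \<noteq> j"
      "cox_order i j m"
  | (quadratic) j where "R = (gen (T_gen j) - scal (k_simple j)) * (gen (T_gen j) + scal (inverse
    (k_simple j)))"
      "j \<in> {0..r}"
  | (lattice) \<mu> \<nu> where "R = gen (X_gen \<mu>) * gen (X_gen \<nu>) - gen (X_gen (\<mu> + \<nu>))"
      "\<mu> \<in> coroot_lattice \<Phi>" "\<nu> \<in> coroot_lattice \<Phi>"
  | (unit) "R = gen (X_gen 0) - 1"
  | (cross) j \<mu> where "R = gen (T_gen j) * gen (X_gen \<mu>) - poly_word (act_mono (simple_refl j) \<mu>)
    * gen (T_gen j)
        - scal (k_simple j - inverse (k_simple j)) *
          poly_word (exact_div (mono_x \<mu> - act_mono (simple_refl j) \<mu>) (1 - x_coroot j 1))"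
      "j \<in> {0..r}" "\<mu> \<in> coroot_lattice \<Phi>"
    unfolding daha_relators_def by blast
  then show "R \<in> ev_ker"
  proof cases
    case braid
    then show ?thesis
      using T_braid[OF braid(2-5)] alt_T_carrier
      by (simp add: ev_ker_def ev_diff ev_alt_T daha_free_closed del: atLeastAtMost_iff)
  next
    case quadratic
    note j = quadratic(2)
    have "ev R p = 0" if p: "p \<in> V" for p
    proof -
      have k: "scal (k_simple j) * (scal (inverse (k_simple j)) * p) = p"
        using k_simple_nonzero[OF j] by (simp add: scal_mult flip: mult.assoc)
      have "ev R p = T j (T j p) + scal (inverse (k_simple j)) * T j p - scal (k_simple j) * T j p - p"
        unfolding quadratic(1) ev_mult ev_diff ev_add ev_gen ev_scal_one gen_op.simps T_linear
        by (simp add: distrib_left k)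
      also have "\<dots> = 0"
        unfolding T_quadratic[OF j p] kap_def scal_diff by (simp add: algebra_simps)
      finally show ?thesis .
    qed
    moreover have "R \<in> carrier daha_free"
      unfolding quadratic(1) by (intro daha_free_closed T_gen_carrier j)
    ultimately show ?thesis by (simp add: ev_ker_def)
  next
    case lattice
    then show ?thesis
      by (simp add: ev_ker_def ev_diff ev_mult ev_gen mono_x_add mult.assoc daha_free_closed
          X_gen_carrier lattice_add)
  next
    case unit
    then show ?thesis
      by (simp add: ev_ker_def ev_diff ev_gen ev_one daha_free_closed X_gen_carrier lattice_zero)
  next
    case cross
    have "R \<in> carrier daha_free"
      unfolding cross(1)
      by (intro daha_free_closed T_gen_carrier X_gen_carrier poly_word_carrier T_cross(2,3)[OF
        cross(2,3) poly_space_zero] cross)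
    moreover have "ev R p = 0" if "p \<in> V" for p
      unfolding cross(1) ev_diff ev_mult ev_gen ev_scal ev_poly_word gen_op.simps T_cross(1)[OF
        cross(2,3) that]
      by (simp add: ev_scal_one mult.assoc)
    ultimately show ?thesis by (simp add: ev_ker_def)
  qed
qed

lemma relators_carrier: "daha_relators \<subseteq> carrier daha_free"
  using relators_ev_ker by (auto simp: ev_ker_def)

lemma daha_ideal_ideal: "ideal daha_ideal daha_free"
  unfolding daha_ideal_def by (rule ring.genideal_ideal[OF ring_daha_free relators_carrier])

lemma daha_ideal_ev_ker: "daha_ideal \<subseteq> ev_ker"
  unfolding daha_ideal_def by (rule ring.genideal_minimal[OF ring_daha_free ideal_ev_ker
    relators_ev_ker])

section \<open>The quotient\<close>

abbreviation coset :: "('a daha_gen free_mon \<Rightarrow>\<^sub>0 'f) \<Rightarrow> ('a daha_gen free_mon \<Rightarrow>\<^sub>0 'f) set" where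
  "coset P \<equiv> daha_ideal +>\<^bsub>daha_free\<^esub> P"

lemma coset_eq: "coset P = {Q + P | Q. Q \<in> daha_ideal}"
  by (auto simp: a_r_coset_def' daha_free_simps)

lemma coset_self: "P \<in> coset P"
proof -
  interpret ideal daha_ideal daha_free by (rule daha_ideal_ideal)
  have "0 \<in> daha_ideal" using additive_subgroup.zero_closed[OF is_additive_subgroup]
    by (simp add: daha_free_simps)
  then show ?thesis unfolding coset_eq by force
qed

lemma daha_simps:
  "carrier daha = coset ` carrier daha_free"
  "\<one>\<^bsub>daha\<^esub> = coset 1"
  "P \<in> carrier daha_free \<Longrightarrow> Q \<in> carrier daha_free \<Longrightarrow> coset P \<otimes>\<^bsub>daha\<^esub> coset Q = coset (P * Q)"
  "P \<in> carrier daha_free \<Longrightarrow> Q \<in> carrier daha_free \<Longrightarrow> coset P \<oplus>\<^bsub>daha\<^esub> coset Q = coset (P + Q)"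
  "P \<in> carrier daha_free \<Longrightarrow> s \<odot>\<^bsub>daha\<^esub> coset P = coset (scal s * P)"
proof -
  interpret ideal daha_ideal daha_free by (rule daha_ideal_ideal)
  show "carrier daha = coset ` carrier daha_free"
    by (auto simp: daha_def quot_alg_def FactRing_def A_RCOSETS_def')
  show "\<one>\<^bsub>daha\<^esub> = coset 1"
    by (simp add: daha_def quot_alg_def FactRing_def daha_free_simps)
  show "coset P \<otimes>\<^bsub>daha\<^esub> coset Q = coset (P * Q)"
    if "P \<in> carrier daha_free" "Q \<in> carrier daha_free"
    using rcoset_mult_add[OF that] by (simp add: daha_def quot_alg_def FactRing_def daha_free_simps)
  show "coset P \<oplus>\<^bsub>daha\<^esub> coset Q = coset (P + Q)"
    if "P \<in> carrier daha_free" "Q \<in> carrier daha_free"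
    using a_rcos_sum[OF that] by (simp add: daha_def quot_alg_def FactRing_def daha_free_simps)
  show "s \<odot>\<^bsub>daha\<^esub> coset P = coset (scal s * P)" if P: "P \<in> carrier daha_free"
  proof -
    have sub: "daha_ideal \<subseteq> carrier daha_free" using a_subset .
    have "coset (scal s * X) = coset (scal s * P)" if "X \<in> coset P" for X
    proof -
      obtain Q where Q: "Q \<in> daha_ideal" "X = Q + P" using \<open>X \<in> coset P\<close> by (auto simp: coset_eq)
      have sQ: "scal s * Q \<in> daha_ideal"
        using I_l_closed[OF Q(1) daha_free_closed(6), of s] by (simp add: daha_free_simps)
      have "scal s * X \<in> coset (scal s * P)"
        using sQ Q(2) by (auto simp: coset_eq distrib_left)
      then show ?thesis
        using a_repr_independence[OF _ _ a_subgroup] P by (simp add: daha_free_closed)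
    qed
    then have "(\<Union>X \<in> coset P. coset (scal s * X)) = coset (scal s * P)" using coset_self[of P] by blast
    then show ?thesis by (simp add: daha_def quot_alg_def daha_free_simps)
  qed
qed

text \<open>The representation, as the map induced by the evaluation.\<close>

definition rep :: "('a daha_gen free_mon \<Rightarrow>\<^sub>0 'f) set \<Rightarrow> ('a \<Rightarrow>\<^sub>0 'f) \<Rightarrow> ('a \<Rightarrow>\<^sub>0 'f)" where
  "rep X = (if X \<in> carrier daha then (\<lambda>p \<in> V. ev (SOME P. P \<in> X) p) else undefined)"

lemma rep_coset:
  assumes P: "P \<in> carrier daha_free"
  shows "rep (coset P) = (\<lambda>p \<in> V. ev P p)"
proof -
  have "(SOME X. X \<in> coset P) \<in> coset P" using coset_self by (rule someI)
  then obtain Q where Q: "Q \<in> daha_ideal" "(SOME X. X \<in> coset P) = Q + P" by (auto simp: coset_eq)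
  then have "ev (SOME X. X \<in> coset P) p = ev P p" if "p \<in> V" for p
    using daha_ideal_ev_ker that by (auto simp: ev_ker_def ev_add)
  then show ?thesis using P by (auto simp: rep_def daha_simps(1) fun_eq_iff)
qed

lemma End_alg_simps:
  "f \<in> carrier (End_alg V) \<longleftrightarrow> f \<in> V \<rightarrow>\<^sub>E V \<and> (\<forall>u \<in> V. \<forall>v \<in> V. f (u + v) = f u + f v) \<and>
     (\<forall>s. \<forall>v \<in> V. f (scal s * v) = scal s * f v)"
  "f \<otimes>\<^bsub>End_alg V\<^esub> g = (\<lambda>v \<in> V. f (g v))" "\<one>\<^bsub>End_alg V\<^esub> = (\<lambda>v \<in> V. v)"
  "f \<oplus>\<^bsub>End_alg V\<^esub> g = (\<lambda>v \<in> V. f v + g v)" "s \<odot>\<^bsub>End_alg V\<^esub> f = (\<lambda>v \<in> V. scal s * f v)"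
  by (auto simp: End_alg_def)

lemma ev_End: "P \<in> carrier daha_free \<Longrightarrow> (\<lambda>p \<in> V. ev P p) \<in> carrier (End_alg V)"
  by (auto simp: End_alg_simps ev_space ev_linear poly_space_add poly_space_scal)

lemma rep_alg_hom: "rep \<in> alg_hom daha (End_alg V)"
proof -
  have hom: "rep \<in> ring_hom daha (End_alg V)"
  proof (rule ring_hom_memI)
    show "rep X \<in> carrier (End_alg V)" if "X \<in> carrier daha" for X
      using that by (auto simp: daha_simps(1) rep_coset ev_End)
    show "rep (X \<otimes>\<^bsub>daha\<^esub> Y) = rep X \<otimes>\<^bsub>End_alg V\<^esub> rep Y" if XY: "X \<in> carrier daha"
      "Y \<in> carrier daha" for X Y
    proof -
      obtain P Q where PQ: "P \<in> carrier daha_free" "X = coset P" "Q \<in> carrier daha_free" "Y = coset Q"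
        using XY by (auto simp: daha_simps(1))
      then show ?thesis
        by (auto simp: daha_simps(3) rep_coset daha_free_closed End_alg_simps ev_mult ev_space
          fun_eq_iff)
    qed
    show "rep (X \<oplus>\<^bsub>daha\<^esub> Y) = rep X \<oplus>\<^bsub>End_alg V\<^esub> rep Y" if XY: "X \<in> carrier daha"
      "Y \<in> carrier daha" for X Y
    proof -
      obtain P Q where PQ: "P \<in> carrier daha_free" "X = coset P" "Q \<in> carrier daha_free" "Y = coset Q"
        using XY by (auto simp: daha_simps(1))
      then show ?thesis
        by (auto simp: daha_simps(4) rep_coset daha_free_closed End_alg_simps ev_add fun_eq_iff)
    qed
    show "rep \<one>\<^bsub>daha\<^esub> = \<one>\<^bsub>End_alg V\<^esub>"
      by (auto simp: daha_simps(2) rep_coset daha_free_closed End_alg_simps ev_one fun_eq_iff)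
  qed
  have "rep (s \<odot>\<^bsub>daha\<^esub> X) = s \<odot>\<^bsub>End_alg V\<^esub> rep X" if "X \<in> carrier daha" for s X
  proof -
    obtain P where P: "P \<in> carrier daha_free" "X = coset P" using \<open>X \<in> carrier daha\<close>
      by (auto simp: daha_simps(1))
    then show ?thesis
      by (auto simp: daha_simps(5) rep_coset daha_free_closed End_alg_simps ev_scal fun_eq_iff)
  qed
  then show ?thesis using hom by (auto simp: alg_hom_def)
qed

lemma rep_T: "j \<in> {0..r} \<Longrightarrow> y \<in> Orb \<Longrightarrow> rep (daha_T j) (mono_x y) = T_mono j y"
  unfolding daha_T_def by (simp add: rep_coset T_gen_carrier poly_space_mono ev_gen T_mono_x)

lemma rep_X: "\<mu> \<in> coroot_lattice \<Phi> \<Longrightarrow> y \<in> Orb \<Longrightarrow> rep (daha_X \<mu>) (mono_x y) = mono_x (y + \<mu>)"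
  unfolding daha_X_def
  by (simp add: rep_coset X_gen_carrier poly_space_mono ev_gen mono_x_add mult.commute)

lemma rep_extensional: "rep \<in> extensional (carrier daha)"
  by (simp add: rep_def extensional_def)

lemma rep_unique:
  assumes hom: "\<pi> \<in> alg_hom daha (End_alg V)" and ext: "\<pi> \<in> extensional (carrier daha)"
    and T: "\<And>j y. j \<in> {0..r} \<Longrightarrow> y \<in> Orb \<Longrightarrow> \<pi> (daha_T j) (mono_x y) = T_mono j y"
    and X: "\<And>\<mu> y. \<mu> \<in> coroot_lattice \<Phi> \<Longrightarrow> y \<in> Orb \<Longrightarrow> \<pi> (daha_X \<mu>) (mono_x y) = mono_x (y + \<mu>)"
  shows "\<pi> = rep"
proof
  have rh: "\<pi> \<in> ring_hom daha (End_alg V)" using hom by (simp add: alg_hom_def)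
  have mem: "coset P \<in> carrier daha" if "P \<in> carrier daha_free" for P using that
    by (simp add: daha_simps(1))
  have End: "\<pi> (coset P) \<in> carrier (End_alg V)" if "P \<in> carrier daha_free" for P
    using ring_hom_closed[OF rh mem[OF that]] .
  have agree: "f = (\<lambda>p \<in> V. ev P p)"
    if f: "f \<in> carrier (End_alg V)" and P: "P \<in> carrier daha_free"
      and eq: "\<And>y. y \<in> Orb \<Longrightarrow> f (mono_x y) = ev P (mono_x y)" for f P
  proof
    fix p
    show "f p = (\<lambda>p \<in> V. ev P p) p"
    proof (cases "p \<in> V")
      case True
      then have "p \<in> V \<and> f p = ev P p"
      proof (induction rule: poly_space_induct)
        case (mono y)
        then show ?case using eq by (simp add: poly_space_mono)
      next
        case (add u v)
        then show ?case using f by (auto simp: End_alg_simps ev_linear poly_space_add)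
      next
        case (scal s u)
        then show ?case using f by (auto simp: End_alg_simps ev_linear poly_space_scal)
      qed
      then show ?thesis by simp
    next
      case False
      then show ?thesis using f by (auto simp: End_alg_simps PiE_def extensional_def)
    qed
  qed
  have gens: "\<pi> (coset (gen g)) = (\<lambda>p \<in> V. ev (gen g) p)" if g: "g \<in> daha_gens" for g
  proof (rule agree[OF End gen_carrier[OF g]])
    show "gen g \<in> carrier daha_free" by (rule gen_carrier[OF g])
    show "\<pi> (coset (gen g)) (mono_x y) = ev (gen g) (mono_x y)" if "y \<in> Orb" for y
    proof -
      from g consider j where "g = T_gen j" "j \<in> {0..r}" | \<mu> where "g = X_gen \<mu>" "\<mu> \<in> coroot_lattice \<Phi>"
        unfolding daha_gens_def by blast
      then show ?thesis
      proof cases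
        case 1
        then show ?thesis using T[OF 1(2) that] by (simp add: daha_T_def ev_gen T_mono_x)
      next
        case 2
        then show ?thesis
          using X[OF 2(2) that] by (simp add: daha_X_def ev_gen mono_x_add mult.commute)
      qed
    qed
  qed
  have word: "Poly_Mapping.single (Word gs) 1 \<in> carrier daha_free \<and>
      \<pi> (coset (Poly_Mapping.single (Word gs) 1)) = (\<lambda>p \<in> V. ev (Poly_Mapping.single (Word gs) 1) p)"
    if "set gs \<subseteq> daha_gens" for gs
    using that
  proof (induction gs)
    case Nil
    have one: "Poly_Mapping.single (Word []) 1 = (1 :: 'a daha_gen free_mon \<Rightarrow>\<^sub>0 'f)"
      using single_one[where ?'a = "'a daha_gen free_mon"] by (simp add: zero_free_mon_def)
    show ?case unfolding one
      using ring_hom_one[OF rh]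
      by (auto simp: daha_simps(2) End_alg_simps ev_one daha_free_closed fun_eq_iff)
  next
    case (Cons g gs)
    let ?w = "Poly_Mapping.single (Word gs) 1 :: 'a daha_gen free_mon \<Rightarrow>\<^sub>0 'f"
    have g: "g \<in> daha_gens" and w: "?w \<in> carrier daha_free" "\<pi> (coset ?w) = (\<lambda>p \<in> V. ev ?w p)"
      using Cons by auto
    have m: "Poly_Mapping.single (Word (g # gs)) 1 = gen g * ?w"
      by (simp add: gen_def mult_single plus_free_mon_def)
    have c: "gen g * ?w \<in> carrier daha_free" using gen_carrier[OF g] w(1) by (rule daha_free_closed)
    have "\<pi> (coset (gen g * ?w)) = \<pi> (coset (gen g)) \<otimes>\<^bsub>End_alg V\<^esub> \<pi> (coset ?w)"
      using ring_hom_mult[OF rh mem[OF gen_carrier[OF g]] mem[OF w(1)]]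
      by (simp add: daha_simps(3)[OF gen_carrier[OF g] w(1)])
    also have "\<dots> = (\<lambda>p \<in> V. ev (gen g * ?w) p)"
      unfolding gens[OF g] w(2) by (auto simp: End_alg_simps ev_mult ev_space[OF w(1)] fun_eq_iff)
    finally show ?case unfolding m using c by blast
  qed
  have sc: "\<pi> (coset (scal s * P)) = (\<lambda>p \<in> V. ev (scal s * P) p)"
    if "P \<in> carrier daha_free" "\<pi> (coset P) = (\<lambda>p \<in> V. ev P p)" for s P
  proof -
    have "\<pi> (s \<odot>\<^bsub>daha\<^esub> coset P) = s \<odot>\<^bsub>End_alg V\<^esub> \<pi> (coset P)"
      using hom mem[OF that(1)] by (simp add: alg_hom_def)
    then show ?thesis using that by (auto simp: daha_simps(5) End_alg_simps ev_scal fun_eq_iff)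
  qed
  have all: "P \<in> carrier daha_free \<and> \<pi> (coset P) = (\<lambda>p \<in> V. ev P p)" if "P \<in> carrier daha_free" for P
    using that
  proof (induction rule: daha_free_induct)
    case zero
    show ?case using sc[of "Poly_Mapping.single (Word []) 1" 0] word[of "[]"]
      by (simp add: daha_free_closed)
  next
    case (single w s)
    have e: "Poly_Mapping.single w s = scal s * Poly_Mapping.single (Word (letters w)) 1"
      by (simp add: scal_single)
    show ?case unfolding e
      using word[OF single] sc daha_free_closed(2)[OF daha_free_closed(6)] by blast
  next
    case (add P Q)
    then have c: "P \<in> carrier daha_free" "Q \<in> carrier daha_free" by auto
    have "\<pi> (coset (P + Q)) = \<pi> (coset P) \<oplus>\<^bsub>End_alg V\<^esub> \<pi> (coset Q)"
      using ring_hom_add[OF rh mem[OF c(1)] mem[OF c(2)]] by (simp add: daha_simps(4)[OF c])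
    then show ?case using add by (auto simp: End_alg_simps ev_add daha_free_closed fun_eq_iff)
  qed
  fix Z
  show "\<pi> Z = rep Z"
  proof (cases "Z \<in> carrier daha")
    case True
    then obtain P where "P \<in> carrier daha_free" "Z = coset P" by (auto simp: daha_simps(1))
    then show ?thesis using all rep_coset by simp
  next
    case False
    then show ?thesis using ext by (simp add: rep_def extensional_def)
  qed
qed

end

section \<open>Quasi-polynomial representations\<close>

theorem theorem1p1:
  fixes \<Phi> :: "'a::euclidean_space set"
    and r :: nat
    and \<alpha> :: "nat \<Rightarrow> 'a"
    and q :: "'f::field_char_0"
    and k :: "'a \<Rightarrow> 'f"
    and J :: "nat set"
    and c :: 'a
    and t :: "'a \<Rightarrow> 'f"
  assumes "daha_datum \<Phi> r \<alpha> q k"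
    and "J \<subset> {0..r}"
    and "c \<in> root_datum.face \<Phi> r \<alpha> J"
    and "t \<in> daha_datum.torus_face \<Phi> r \<alpha> q J"
  shows "\<exists>!\<pi>. \<pi> \<in> alg_hom (daha_datum.daha \<Phi> r \<alpha> q k) (End_alg (poly_space \<Phi> c)) \<and>
    \<pi> \<in> extensional (carrier (daha_datum.daha \<Phi> r \<alpha> q k)) \<and>
    (\<forall>j \<in> {0..r}. \<forall>y \<in> orbit \<Phi> c.
      \<pi> (daha_datum.daha_T \<Phi> r \<alpha> q k j) (mono_x y) =
        scal (daha_datum.k_simple \<Phi> r \<alpha> k j
                ^ indicator \<int> (root_datum.aff_root \<Phi> r \<alpha> j y)) *
          daha_datum.s_op \<Phi> r \<alpha> q c t j y +
        scal (daha_datum.k_simple \<Phi> r \<alpha> k j - inverse (daha_datum.k_simple \<Phi> r \<alpha> k j)) *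
          daha_datum.nabla \<Phi> r \<alpha> q j y) \<and>
    (\<forall>\<mu> \<in> coroot_lattice \<Phi>. \<forall>y \<in> orbit \<Phi> c.
      \<pi> (daha_datum.daha_X \<Phi> r \<alpha> q k \<mu>) (mono_x y) = mono_x (y + \<mu>))"
proof -
  interpret quasi_poly_datum \<Phi> r \<alpha> q k J c t
    using assms by (intro quasi_poly_datum.intro quasi_poly_datum_axioms.intro)
  show ?thesis
    unfolding T_mono_def[symmetric]
    using rep_alg_hom rep_extensional rep_T rep_X rep_unique by (intro ex1I[of _ rep]) blast+
qed

end
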